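(* Let $M$ be a closed connected Riemannian manifold and let $N$ be a connected Riemannian manifold such that $(M,N)$ satisfies the $*$-condition. Then all isometries of $M\times N$ split, i.e. $\mathrm{Iso}(M\times N)=\mathrm{Iso}(M)\times \mathrm{Iso}(N)$.
   Context: All manifolds are Hausdorff and second countable; all maps are $C^\infty$. Put $n=\dim(M)$. No completeness of $N$ is assumed. $M\times N$ carries the product Riemannian metric, and $\mathrm{Iso}(X)$ denotes the group of isometries of a Riemannian manifold $X$. The pair $(M,N)$ satisfies the $*$-condition if $\pi^*:H^n(M;\mathbb{Z}_2)\to H^n(M\times N;\mathbb{Z}_2)$ is an isomorphism, where $\pi:M\times N\to M$ is the natural projection. An isometry $f=(f_1,f_2)$ of $M\times N$ splits if its $M$-component $f_1:M\times N\to M$ is independent of the $N$-coordinate and its $N$-component $f_2:M\times N\to N$ is independent of the $M$-coordinate; in this case $f_1$ and $f_2$ can be seen as isometries of $M$ and $N$ respectively. *)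

theory Defs
  imports "HOL-Analysis.Analysis" "HOL-Homology.Homology" "HOL-Algebra.Bij"
begin

section \<open>Smooth maps between open subsets of finite-dimensional vector spaces\<close>

text \<open>Only meant for open \<open>S\<close>. Every iterated directional derivative exists (in the
  Frechet sense) and is continuous, which amounts to being \<open>k\<close> times continuously differentiable
  when the domain is finite-dimensional.\<close>

primrec Ck_on :: "nat \<Rightarrow> 'e::real_normed_vector set \<Rightarrow> ('e \<Rightarrow> 'f::real_normed_vector) \<Rightarrow> bool" where
  "Ck_on 0 S f \<longleftrightarrow> continuous_on S f"
| "Ck_on (Suc k) S f \<longleftrightarrow> (\<forall>x\<in>S. f differentiable (at x)) \<and>
     (\<forall>v. Ck_on k S (\<lambda>x. frechet_derivative f (at x) v))"

definition smooth_on :: "'e::real_normed_vector set \<Rightarrow> ('e \<Rightarrow> 'f::real_normed_vector) \<Rightarrow> bool" where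
  "smooth_on S f \<longleftrightarrow> (\<forall>k. Ck_on k S f)"


section \<open>Riemannian manifolds\<close>

text \<open>A manifold is a topological space with an indexed atlas of charts
  \<open>(chart_dom i, chart_coord i)\<close>, \<open>i \<in> charts\<close>, into the model space \<open>'e\<close>. The model space is any
  finite-dimensional normed space rather than a member of \<^class>\<open>euclidean_space\<close>, so that
  zero-dimensional manifolds are covered. The Riemannian metric is given by its expressions in the
  charts: \<open>metric i p u v\<close> is the inner product of the two tangent vectors at \<open>p\<close> whose coordinates
  in chart \<open>i\<close> are \<open>u\<close> and \<open>v\<close>.\<close>

record ('a, 'e, 'i) riemannian =
  topo :: "'a topology"
  charts :: "'i set"
  chart_dom :: "'i \<Rightarrow> 'a set"
  chart_coord :: "'i \<Rightarrow> 'a \<Rightarrow> 'e"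
  metric :: "'i \<Rightarrow> 'a \<Rightarrow> 'e \<Rightarrow> 'e \<Rightarrow> real"

abbreviation points :: "('a, 'e, 'i) riemannian \<Rightarrow> 'a set" where
  "points M \<equiv> topspace (topo M)"

definition chart_inv :: "('a, 'e, 'i) riemannian \<Rightarrow> 'i \<Rightarrow> 'e \<Rightarrow> 'a" where
  "chart_inv M i = inv_into (chart_dom M i) (chart_coord M i)"

definition local_expr ::
    "('a, 'e, 'i) riemannian \<Rightarrow> ('b, 'f, 'j) riemannian \<Rightarrow> 'i \<Rightarrow> 'j \<Rightarrow> ('a \<Rightarrow> 'b) \<Rightarrow> 'e \<Rightarrow> 'f" where
  "local_expr M N i j f = chart_coord N j \<circ> f \<circ> chart_inv M i"

definition local_deriv ::
    "('a, 'e::real_normed_vector, 'i) riemannian \<Rightarrow> ('b, 'f::real_normed_vector, 'j) riemannian \<Rightarrow>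
      'i \<Rightarrow> 'j \<Rightarrow> ('a \<Rightarrow> 'b) \<Rightarrow> 'a \<Rightarrow> 'e \<Rightarrow> 'f" where
  "local_deriv M N i j f p = frechet_derivative (local_expr M N i j f) (at (chart_coord M i p))"

definition smooth_map ::
    "('a, 'e::real_normed_vector, 'i) riemannian \<Rightarrow> ('b, 'f::real_normed_vector, 'j) riemannian \<Rightarrow>
      ('a \<Rightarrow> 'b) \<Rightarrow> bool" where
  "smooth_map M N f \<longleftrightarrow> continuous_map (topo M) (topo N) f \<and>
     (\<forall>i\<in>charts M. \<forall>j\<in>charts N.
        smooth_on (chart_coord M i ` {p \<in> chart_dom M i. f p \<in> chart_dom N j}) (local_expr M N i j f))"

definition metric_preserving ::
    "('a, 'e::real_normed_vector, 'i) riemannian \<Rightarrow> ('b, 'f::real_normed_vector, 'j) riemannian \<Rightarrow>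
      ('a \<Rightarrow> 'b) \<Rightarrow> bool" where
  "metric_preserving M N f \<longleftrightarrow>
     (\<forall>i\<in>charts M. \<forall>j\<in>charts N. \<forall>p\<in>chart_dom M i. f p \<in> chart_dom N j \<longrightarrow>
        (\<forall>u v. metric N j (f p) (local_deriv M N i j f p u) (local_deriv M N i j f p v)
             = metric M i p u v))"

definition smooth_atlas :: "('a, 'e::real_normed_vector, 'i) riemannian \<Rightarrow> bool" where
  "smooth_atlas M \<longleftrightarrow>
     (\<Union>i\<in>charts M. chart_dom M i) = points M \<and>
     (\<forall>i\<in>charts M. openin (topo M) (chart_dom M i) \<and> open (chart_coord M i ` chart_dom M i) \<and>
        homeomorphic_map (subtopology (topo M) (chart_dom M i))
          (top_of_set (chart_coord M i ` chart_dom M i)) (chart_coord M i)) \<and>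
     (\<forall>i\<in>charts M. \<forall>j\<in>charts M.
        smooth_on (chart_coord M i ` (chart_dom M i \<inter> chart_dom M j)) (local_expr M M i j (\<lambda>p. p)))"

text \<open>The last conjunct says that the local expressions of the metric transform as a covariant
  2-tensor under changes of charts.\<close>

definition riemannian_metric :: "('a, 'e::real_normed_vector, 'i) riemannian \<Rightarrow> bool" where
  "riemannian_metric M \<longleftrightarrow>
     (\<forall>i\<in>charts M.
        (\<forall>p\<in>chart_dom M i. bilinear (metric M i p) \<and>
           (\<forall>u v. metric M i p u v = metric M i p v u) \<and>
           (\<forall>v. v \<noteq> 0 \<longrightarrow> 0 < metric M i p v v)) \<and>
        (\<forall>u v. smooth_on (chart_coord M i ` chart_dom M i) (\<lambda>x. metric M i (chart_inv M i x) u v))) \<and>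
     metric_preserving M M (\<lambda>p. p)"

definition riemannian_manifold :: "('a, 'e::real_normed_vector, 'i) riemannian \<Rightarrow> bool" where
  "riemannian_manifold M \<longleftrightarrow>
     (\<exists>B::'e set. finite B \<and> span B = UNIV) \<and>
     Hausdorff_space (topo M) \<and> second_countable (topo M) \<and>
     smooth_atlas M \<and> riemannian_metric M"

definition mdim :: "('a, 'e::real_normed_vector, 'i) riemannian \<Rightarrow> nat" where
  "mdim M = dim (UNIV :: 'e set)"

text \<open>Connected manifolds are nonempty by convention.\<close>

definition connected_manifold :: "('a, 'e, 'i) riemannian \<Rightarrow> bool" where
  "connected_manifold M \<longleftrightarrow> connected_space (topo M) \<and> points M \<noteq> {}"

text \<open>The charts are modelled on open subsets of a vector space, so there is no boundary and
  \<open>closed\<close> just means compact.\<close>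

definition closed_manifold :: "('a, 'e, 'i) riemannian \<Rightarrow> bool" where
  "closed_manifold M \<longleftrightarrow> compact_space (topo M)"

definition prod_riemannian ::
    "('a, 'e, 'i) riemannian \<Rightarrow> ('b, 'f, 'j) riemannian \<Rightarrow> ('a \<times> 'b, 'e \<times> 'f, 'i \<times> 'j) riemannian" where
  "prod_riemannian M N =
     \<lparr>topo = prod_topology (topo M) (topo N),
      charts = charts M \<times> charts N,
      chart_dom = (\<lambda>(i, j). chart_dom M i \<times> chart_dom N j),
      chart_coord = (\<lambda>(i, j). map_prod (chart_coord M i) (chart_coord N j)),
      metric = (\<lambda>(i, j) (p, q) (u, u') (v, v'). metric M i p u v + metric N j q u' v')\<rparr>"


section \<open>Isometries\<close>

definition isometry ::
    "('a, 'e::real_normed_vector, 'i) riemannian \<Rightarrow> ('b, 'f::real_normed_vector, 'j) riemannian \<Rightarrow>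
      ('a \<Rightarrow> 'b) \<Rightarrow> bool" where
  "isometry M N f \<longleftrightarrow> bij_betw f (points M) (points N) \<and>
     smooth_map M N f \<and> smooth_map N M (inv_into (points M) f) \<and> metric_preserving M N f"

text \<open>As in \<^const>\<open>BijGroup\<close>, group elements are functions that are \<^const>\<open>undefined\<close> outside the
  manifold, so that distinct elements are distinct maps.\<close>

definition Iso :: "('a, 'e::real_normed_vector, 'i) riemannian \<Rightarrow> ('a \<Rightarrow> 'a) monoid" where
  "Iso M = BijGroup (points M)\<lparr>carrier := {f \<in> extensional (points M). isometry M M f}\<rparr>"

definition splits ::
    "('a, 'e, 'i) riemannian \<Rightarrow> ('b, 'f, 'j) riemannian \<Rightarrow> ('a \<times> 'b \<Rightarrow> 'a \<times> 'b) \<Rightarrow> bool" where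
  "splits M N f \<longleftrightarrow>
     (\<forall>x\<in>points M. \<forall>y\<in>points N. \<forall>y'\<in>points N. fst (f (x, y)) = fst (f (x, y'))) \<and>
     (\<forall>x\<in>points M. \<forall>x'\<in>points M. \<forall>y\<in>points N. snd (f (x, y)) = snd (f (x', y)))"

definition prod_isometry ::
    "('a, 'e, 'i) riemannian \<Rightarrow> ('b, 'f, 'j) riemannian \<Rightarrow>
      ('a \<Rightarrow> 'a) \<times> ('b \<Rightarrow> 'b) \<Rightarrow> 'a \<times> 'b \<Rightarrow> 'a \<times> 'b" where
  "prod_isometry M N = (\<lambda>(g, h). restrict (map_prod g h) (points M \<times> points N))"


section \<open>Singular cohomology with coefficients\<close>

text \<open>For an abelian group \<open>G\<close>, the cochain complex is \<open>Hom(C\<^sub>\<bullet>(X), G)\<close>, where \<open>C\<^sub>\<bullet>(X)\<close> is the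
  singular chain complex. Cochains are extensional on \<open>C\<^sub>p(X)\<close>.\<close>

definition cochain_group :: "('g, 'z) monoid_scheme \<Rightarrow> nat \<Rightarrow> 'a topology \<Rightarrow> ('a chain \<Rightarrow> 'g) monoid" where
  "cochain_group G p X =
     \<lparr>carrier = hom (chain_group p X) G \<inter> extensional (singular_chain_set p X),
      mult = (\<lambda>\<phi> \<psi>. \<lambda>c\<in>singular_chain_set p X. \<phi> c \<otimes>\<^bsub>G\<^esub> \<psi> c),
      one = (\<lambda>c\<in>singular_chain_set p X. \<one>\<^bsub>G\<^esub>)\<rparr>"

definition coboundary :: "nat \<Rightarrow> 'a topology \<Rightarrow> ('a chain \<Rightarrow> 'g) \<Rightarrow> 'a chain \<Rightarrow> 'g" where
  "coboundary p X \<phi> = (\<lambda>c\<in>singular_chain_set (Suc p) X. \<phi> (chain_boundary (Suc p) c))"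

definition cocycles :: "('g, 'z) monoid_scheme \<Rightarrow> nat \<Rightarrow> 'a topology \<Rightarrow> ('a chain \<Rightarrow> 'g) set" where
  "cocycles G p X =
     {\<phi> \<in> carrier (cochain_group G p X). coboundary p X \<phi> = \<one>\<^bsub>cochain_group G (Suc p) X\<^esub>}"

definition coboundaries :: "('g, 'z) monoid_scheme \<Rightarrow> nat \<Rightarrow> 'a topology \<Rightarrow> ('a chain \<Rightarrow> 'g) set" where
  "coboundaries G p X =
     (case p of 0 \<Rightarrow> {\<one>\<^bsub>cochain_group G 0 X\<^esub>}
      | Suc q \<Rightarrow> coboundary q X ` carrier (cochain_group G q X))"

definition cocycle_group :: "('g, 'z) monoid_scheme \<Rightarrow> nat \<Rightarrow> 'a topology \<Rightarrow> ('a chain \<Rightarrow> 'g) monoid" where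
  "cocycle_group G p X = cochain_group G p X\<lparr>carrier := cocycles G p X\<rparr>"

definition cohomology_group ::
    "('g, 'z) monoid_scheme \<Rightarrow> nat \<Rightarrow> 'a topology \<Rightarrow> ('a chain \<Rightarrow> 'g) set monoid" where
  "cohomology_group G p X = cocycle_group G p X Mod coboundaries G p X"

definition cochain_map ::
    "nat \<Rightarrow> 'a topology \<Rightarrow> ('a \<Rightarrow> 'b) \<Rightarrow> ('b chain \<Rightarrow> 'g) \<Rightarrow> 'a chain \<Rightarrow> 'g" where
  "cochain_map p X f \<phi> = (\<lambda>c\<in>singular_chain_set p X. \<phi> (chain_map p f c))"

text \<open>For a continuous map \<open>f\<close> from \<open>X\<close> to some \<open>Y\<close> and a class \<open>a = [\<phi>]\<close> in the cohomology of \<open>Y\<close>,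
  the cochain map sends \<open>a\<close> into a single coset of the coboundaries of \<open>X\<close>; adding all coboundaries
  of \<open>X\<close> gives the whole coset, i.e. the class of the pullback of \<open>\<phi>\<close>.\<close>

definition cohomology_map ::
    "('g, 'z) monoid_scheme \<Rightarrow> nat \<Rightarrow> 'a topology \<Rightarrow> ('a \<Rightarrow> 'b) \<Rightarrow>
      ('b chain \<Rightarrow> 'g) set \<Rightarrow> ('a chain \<Rightarrow> 'g) set" where
  "cohomology_map G p X f a = coboundaries G p X <#>\<^bsub>cocycle_group G p X\<^esub> (cochain_map p X f ` a)"


definition star_condition ::
    "('a, 'e::real_normed_vector, 'i) riemannian \<Rightarrow> ('b, 'f, 'j) riemannian \<Rightarrow> bool" where
  "star_condition M N \<longleftrightarrow>
     cohomology_map (integer_mod_group 2) (mdim M) (topo (prod_riemannian M N)) fst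
       \<in> iso (cohomology_group (integer_mod_group 2) (mdim M) (topo M))
             (cohomology_group (integer_mod_group 2) (mdim M) (topo (prod_riemannian M N)))"

end

(* Let f be an isometry of M x N, fix q in N and put g(x) = fst (f (x, q)).

   The *-condition forces g to be surjective. M carries a fundamental cycle z modulo 2. If g missed a
   point p, a functional psi on the n-chains modulo 2 that kills boundaries and chains avoiding p, with
   psi z = 1, would be a cocycle pulled back to 0 by g. Since pr1* is onto, the class of
   (pr1 o f)* psi is a pullback pr1* chi; restricting to M x {q} shows that chi vanishes on cycles, and
   evaluating at the image of z under the inverse of f gives psi z = 0, a contradiction.

   As g does not increase lengths of tangent vectors, it is nonexpanding for the Riemannian distance,
   and a surjective nonexpanding self-map of a compact metric space is isometric. Hence dg preserves
   lengths, so the N-component of df vanishes on TM and snd o f does not depend on x. Orthogonality of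
   TM and TN then makes the M-component of df vanish on TN, so fst o f does not depend on y. *)

theory Submission
  imports Defs
begin

section \<open>Singular chains modulo 2\<close>

text \<open>Classes modulo 2 are carried by integral chains, with doubles \<open>u + u\<close>
  allowed as errors, so integral facts on subdivision and on the homology of Euclidean space apply
  directly. The recurring difficulty is to control supports in the presence of these errors;
  \<open>chain_split_mod2\<close> resolves it. Coefficients modulo 2 dispense with orientations: the
  local homology at a point has a single nonzero class, so two relative cycles that are nonzero at a
  point agree there and can be glued. Passing from agreement at points to agreement on a compact set
  is the purpose of \<open>locally_detected\<close>. The functional psi comes from a maximal
  subgroup avoiding z. On the metric side, lengths of curves are avoided: \<open>test_dist\<close>
  is a supremum over functions of slope at most 1. Such functions pull back along g, and their
  behaviour at small scale recovers the Riemannian norm, which turns the global statement on g into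
  the one on dg.\<close>

definition relcycle2 :: "nat \<Rightarrow> 'a topology \<Rightarrow> 'a set \<Rightarrow> 'a chain \<Rightarrow> bool" where
  "relcycle2 p X S c \<longleftrightarrow> singular_chain p X c \<and>
     (\<exists>s u. singular_chain (p - 1) (subtopology X S) s \<and> singular_chain (p - 1) X u \<and>
            chain_boundary p c = s + (u + u))"

text \<open>Together with \<open>relcycle2\<close>, these are the boundaries and cycles of the
  quotient complex C(X) / (C(S) + 2 C(X)), that is, of singular homology of a pair modulo 2,
  expressed by integral representatives.\<close>

definition relboundary2 :: "nat \<Rightarrow> 'a topology \<Rightarrow> 'a set \<Rightarrow> 'a chain \<Rightarrow> bool" where
  "relboundary2 p X S c \<longleftrightarrow>
     (\<exists>d s u. singular_chain (Suc p) X d \<and> singular_chain p (subtopology X S) s \<and> singular_chain p X u \<and>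
            c = chain_boundary (Suc p) d + s + (u + u))"

lemma relcycle2_chain: "relcycle2 p X S c \<Longrightarrow> singular_chain p X c"
  by (simp add: relcycle2_def)

text \<open>In degree \<open>0\<close> the boundary lives, by convention, again in degree \<open>0\<close>; choosing \<open>s = u = 0\<close>
  there avoids a case distinction in every later use.\<close>

lemma relcycle2E:
  assumes "relcycle2 p X S c"
  obtains s u where "singular_chain (p - 1) (subtopology X S) s" "singular_chain (p - 1) X u"
    "chain_boundary p c = s + (u + u)" "p = 0 \<Longrightarrow> s = 0 \<and> u = 0"
proof (cases "p = 0")
  case True
  then show ?thesis using that[of 0 0] by (simp add: chain_boundary_def)
next
  case False
  then show ?thesis using assms that unfolding relcycle2_def by blast
qed

lemma relboundary2I:
  "\<lbrakk>singular_chain (Suc p) X d; singular_chain p (subtopology X S) s; singular_chain p X u;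
    c = chain_boundary (Suc p) d + s + (u + u)\<rbrakk> \<Longrightarrow> relboundary2 p X S c"
  unfolding relboundary2_def by blast

lemma relcycle2I:
  "\<lbrakk>singular_chain p X c; singular_chain (p - 1) (subtopology X S) s; singular_chain (p - 1) X u;
    chain_boundary p c = s + (u + u)\<rbrakk> \<Longrightarrow> relcycle2 p X S c"
  unfolding relcycle2_def by blast

lemma singular_chain_subI: "singular_chain p (subtopology X S) c \<Longrightarrow> singular_chain p X c"
  by (simp add: singular_chain_subtopology)

lemma relcycle2_mono:
  "\<lbrakk>relcycle2 p X S c; S \<subseteq> T\<rbrakk> \<Longrightarrow> relcycle2 p X T c"
  unfolding relcycle2_def using singular_chain_mono by blast

lemma relboundary2_mono:
  "\<lbrakk>relboundary2 p X S c; S \<subseteq> T\<rbrakk> \<Longrightarrow> relboundary2 p X T c"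
  unfolding relboundary2_def using singular_chain_mono by blast

lemma relcycle2_sub_mono:
  assumes "relcycle2 p (subtopology X W) S c" "W \<inter> S \<subseteq> T"
  shows "relcycle2 p X T c"
proof -
  from assms(1) obtain s u where *: "singular_chain p X c"
    "singular_chain (p - 1) (subtopology X (W \<inter> S)) s" "singular_chain (p - 1) X u"
    "chain_boundary p c = s + (u + u)"
    unfolding relcycle2_def by (auto simp: subtopology_subtopology dest: singular_chain_subI)
  with assms(2) show ?thesis
    by (intro relcycle2I[of p X c T s u]) (auto elim: singular_chain_mono)
qed

lemma relboundary2_sub_mono:
  assumes "relboundary2 p (subtopology X W) S c" "W \<inter> S \<subseteq> T"
  shows "relboundary2 p X T c"
proof -
  from assms(1) obtain d s u where *: "singular_chain (Suc p) X d"
    "singular_chain p (subtopology X (W \<inter> S)) s" "singular_chain p X u"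
    "c = chain_boundary (Suc p) d + s + (u + u)"
    unfolding relboundary2_def by (auto simp: subtopology_subtopology dest: singular_chain_subI)
  with assms(2) show ?thesis
    by (intro relboundary2I[of p X d T s u]) (auto elim: singular_chain_mono)
qed

lemma relcycle2_add:
  assumes "relcycle2 p X S a" "relcycle2 p X S b"
  shows "relcycle2 p X S (a + b)"
proof -
  from assms obtain s u s' u' where
    "singular_chain p X a" "singular_chain p X b"
    "singular_chain (p - 1) (subtopology X S) s" "singular_chain (p - 1) X u" "chain_boundary p a = s + (u + u)"
    "singular_chain (p - 1) (subtopology X S) s'" "singular_chain (p - 1) X u'" "chain_boundary p b = s' + (u' + u')"
    unfolding relcycle2_def by blast
  then show ?thesis
    by (intro relcycle2I[of p X "a+b" S "s+s'" "u+u'"])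
      (auto simp: chain_boundary_add intro: singular_chain_add)
qed

lemma relcycle2_minus:
  assumes "relcycle2 p X S a"
  shows "relcycle2 p X S (- a)"
proof -
  from assms obtain s u where
    "singular_chain p X a" 
    "singular_chain (p - 1) (subtopology X S) s" "singular_chain (p - 1) X u" "chain_boundary p a = s + (u + u)"
    unfolding relcycle2_def by blast
  then show ?thesis
    by (intro relcycle2I[of p X "-a" S "-s" "-u"])
      (auto simp: chain_boundary_minus singular_chain_minus)
qed

lemma relcycle2_diff:
  "\<lbrakk>relcycle2 p X S a; relcycle2 p X S b\<rbrakk> \<Longrightarrow> relcycle2 p X S (a - b)"
  using relcycle2_add[of p X S a "- b"] relcycle2_minus[of p X S b] by simp

lemma relboundary2_add:
  assumes "relboundary2 p X S a" "relboundary2 p X S b"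
  shows "relboundary2 p X S (a + b)"
proof -
  from assms obtain d s u d' s' u' where
    "singular_chain (Suc p) X d" "singular_chain p (subtopology X S) s" "singular_chain p X u"
    "a = chain_boundary (Suc p) d + s + (u + u)"
    "singular_chain (Suc p) X d'" "singular_chain p (subtopology X S) s'" "singular_chain p X u'"
    "b = chain_boundary (Suc p) d' + s' + (u' + u')"
    unfolding relboundary2_def by blast
  then show ?thesis
    by (intro relboundary2I[of p X "d+d'" S "s+s'" "u+u'"])
      (auto simp: chain_boundary_add intro: singular_chain_add)
qed

lemma relboundary2_minus:
  assumes "relboundary2 p X S a"
  shows "relboundary2 p X S (- a)"
proof -
  from assms obtain d s u where
    "singular_chain (Suc p) X d" "singular_chain p (subtopology X S) s" "singular_chain p X u"
    "a = chain_boundary (Suc p) d + s + (u + u)"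
    unfolding relboundary2_def by blast
  then show ?thesis
    by (intro relboundary2I[of p X "-d" S "-s" "-u"])
      (auto simp: chain_boundary_minus singular_chain_minus)
qed

lemma relboundary2_diff:
  "\<lbrakk>relboundary2 p X S a; relboundary2 p X S b\<rbrakk> \<Longrightarrow> relboundary2 p X S (a - b)"
  using relboundary2_add[of p X S a "- b"] relboundary2_minus[of p X S b] by simp

lemma relboundary2_congD:
  assumes "relboundary2 p X S (a - b)"
  shows "relboundary2 p X S a \<longleftrightarrow> relboundary2 p X S b"
proof
  show "relboundary2 p X S b" if "relboundary2 p X S a"
    using relboundary2_diff[OF that assms] by simp
  show "relboundary2 p X S a" if "relboundary2 p X S b"
    using relboundary2_add[OF that assms] by simp
qed

lemma relboundary2_subchain:
  "singular_chain p (subtopology X S) c \<Longrightarrow> relboundary2 p X S c"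
  by (rule relboundary2I[of p X 0 S c 0]) auto

lemma relboundary2_double: "singular_chain p X c \<Longrightarrow> relboundary2 p X S (c + c)"
  by (rule relboundary2I[of p X 0 S 0 c]) auto

lemma relboundary2_boundary:
  "singular_chain (Suc p) X d \<Longrightarrow> relboundary2 p X S (chain_boundary (Suc p) d)"
  by (rule relboundary2I[of p X d S 0 0]) auto

lemma relboundary2_imp_chain:
  "relboundary2 p X S c \<Longrightarrow> singular_chain p X c"
  unfolding relboundary2_def
  by (metis singular_chain_add singular_chain_boundary_alt singular_chain_subI)

lemma relboundary2_topspace:
  "singular_chain p X c \<Longrightarrow> relboundary2 p X (topspace X) c"
  by (simp add: relboundary2_subchain)

lemma relboundary_imp_relboundary2:
  assumes "singular_relboundary p X S c"
  shows "relboundary2 p X S c"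
proof -
  obtain d e where "singular_chain (Suc p) X d" "singular_chain p (subtopology X S) e"
    "chain_boundary (Suc p) d + e = c"
    using assms unfolding singular_relboundary by blast
  then show ?thesis
    by (intro relboundary2I[of p X d S e 0]) auto
qed

lemma relcycle_imp_relcycle2:
  "singular_relcycle p X S c \<Longrightarrow> relcycle2 p X S c"
  unfolding singular_relcycle
  by (rule relcycle2I[of p X c S "chain_boundary p c" 0]) auto

lemma relcycle2_chain_map:
  assumes "relcycle2 p X S c" "continuous_map X Y g" "g \<in> (topspace X \<inter> S) \<rightarrow> T"
  shows "relcycle2 p Y T (chain_map p g c)"
proof -
  from assms(1) obtain s u where *: "singular_chain p X c"
    "singular_chain (p - 1) (subtopology X S) s" "singular_chain (p - 1) X u"
    "chain_boundary p c = s + (u + u)"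
    unfolding relcycle2_def by auto
  have "continuous_map (subtopology X S) (subtopology Y T) g"
    using assms(2,3) by (auto simp: continuous_map_in_subtopology continuous_map_from_subtopology)
  with * assms(2) show ?thesis
    by (intro relcycle2I[where s = "chain_map (p-1) g s" and u = "chain_map (p-1) g u"])
      (auto simp: chain_boundary_chain_map chain_map_add intro: singular_chain_chain_map)
qed

lemma relboundary2_chain_map:
  assumes "relboundary2 p X S c" "continuous_map X Y g" "g \<in> (topspace X \<inter> S) \<rightarrow> T"
  shows "relboundary2 p Y T (chain_map p g c)"
proof -
  from assms(1) obtain d s u where *: "singular_chain (Suc p) X d"
    "singular_chain p (subtopology X S) s" "singular_chain p X u"
    "c = chain_boundary (Suc p) d + s + (u + u)"
    unfolding relboundary2_def by blast
  have "continuous_map (subtopology X S) (subtopology Y T) g"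
    using assms(2,3) by (auto simp: continuous_map_in_subtopology continuous_map_from_subtopology)
  with * assms(2) show ?thesis
    by (intro relboundary2I[where d = "chain_map (Suc p) g d" and s = "chain_map p g s" and u = "chain_map p g u"])
      (auto simp: chain_boundary_chain_map chain_map_add intro: singular_chain_chain_map)
qed

text \<open>A simplex with odd coefficient in \<open>q\<close> also has odd coefficient in
  \<open>s\<close>, so it lies in both \<open>U\<close> and \<open>V\<close>. Remainders and
  quotients of the coefficients by 2 separate these simplexes from an even rest that still lives in
  \<open>U\<close>.\<close>

lemma chain_split_mod2:
  assumes q: "singular_chain p (subtopology X U) q" and s: "singular_chain p (subtopology X V) s"
    and eq: "q = s + (w + w)"
  obtains t t' where "singular_chain p (subtopology X (U \<inter> V)) t" "singular_chain p (subtopology X U) t'"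
    "q = t + (t' + t')"
proof -
  define t where "t = Poly_Mapping.map (\<lambda>n. n mod 2) q"
  define t' where "t' = Poly_Mapping.map (\<lambda>n. n div 2) q"
  have lt: "Poly_Mapping.lookup t k = Poly_Mapping.lookup q k mod 2" for k
    by (simp add: t_def Poly_Mapping.map.rep_eq when_def)
  have lt': "Poly_Mapping.lookup t' k = Poly_Mapping.lookup q k div 2" for k
    by (simp add: t'_def Poly_Mapping.map.rep_eq when_def)
  have "q = t + (t' + t')"
  proof (rule poly_mapping_eqI)
    fix k show "Poly_Mapping.lookup q k = Poly_Mapping.lookup (t + (t' + t')) k"
      by (simp add: lookup_add lt lt')
  qed
  moreover have "Poly_Mapping.keys t' \<subseteq> Poly_Mapping.keys q"
    by (auto simp: in_keys_iff lt')
  then have "singular_chain p (subtopology X U) t'"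
    using q unfolding singular_chain_def by blast
  moreover have "Poly_Mapping.keys t \<subseteq> Poly_Mapping.keys q \<inter> Poly_Mapping.keys s"
  proof
    fix k assume "k \<in> Poly_Mapping.keys t"
    then have odd: "odd (Poly_Mapping.lookup q k)"
      by (auto simp: in_keys_iff lt)
    moreover have "Poly_Mapping.lookup q k = Poly_Mapping.lookup s k + 2 * Poly_Mapping.lookup w k"
      by (simp add: eq lookup_add)
    ultimately have "odd (Poly_Mapping.lookup s k)"
      by simp
    with odd show "k \<in> Poly_Mapping.keys q \<inter> Poly_Mapping.keys s"
      by (auto simp: in_keys_iff elim: oddE)
  qed
  then have "singular_chain p (subtopology X (U \<inter> V)) t"
    using q s unfolding singular_chain_def singular_simplex_subtopology by fastforce
  ultimately show ?thesis
    using that by blast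
qed


section \<open>Subdivision, Mayer-Vietoris and excision modulo 2\<close>

text \<open>\<open>sd\<close> stands for an iterated barycentric subdivision and \<open>h\<close>
  for its chain homotopy to the identity. Quantifying over every \<open>Y\<close> records that the
  same operators preserve the chains of every subspace; the number of iterations stays
  hidden.\<close>

definition subdivision_ops ::
    "(nat \<Rightarrow> 'a chain \<Rightarrow> 'a chain) \<Rightarrow> (nat \<Rightarrow> 'a chain \<Rightarrow> 'a chain) \<Rightarrow> bool" where
  "subdivision_ops sd h \<longleftrightarrow>
     (\<forall>q c1 c2. sd q (c1 + c2) = sd q c1 + sd q c2) \<and>
     (\<forall>q Y c. singular_chain q (Y :: 'a topology) c \<longrightarrow> singular_chain q Y (sd q c)) \<and>
     (\<forall>q. h q 0 = 0) \<and>
     (\<forall>q c1 c2. h q (c1 + c2) = h q c1 + h q c2) \<and>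
     (\<forall>q Y c. singular_chain q (Y :: 'a topology) c \<longrightarrow> singular_chain (Suc q) Y (h q c)) \<and>
     (\<forall>q Y c. singular_chain q (Y :: 'a topology) c \<longrightarrow>
         sd q c = c + chain_boundary (Suc q) (h q c) + h (q - 1) (chain_boundary q c))"

lemma subdivision_opsD:
  assumes "subdivision_ops sd h"
  shows "sd q (c1 + c2) = sd q c1 + sd q c2"
    and "singular_chain q Y c \<Longrightarrow> singular_chain q Y (sd q c)"
    and "h q 0 = 0"
    and "h q (c1 + c2) = h q c1 + h q c2"
    and "singular_chain q Y c \<Longrightarrow> singular_chain (Suc q) Y (h q c)"
    and "singular_chain q Y c \<Longrightarrow>
         sd q c = c + chain_boundary (Suc q) (h q c) + h (q - 1) (chain_boundary q c)"
  using assms unfolding subdivision_ops_def by blast+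

text \<open>Enough subdivisions make every simplex small for the cover of
  \<open>U \<union> V\<close> by the two sets; each small simplex is then assigned to one of
  them.\<close>

lemma small_chain_split:
  fixes X :: "'a topology"
  assumes U: "openin X U" and V: "openin X V" and c: "singular_chain p (subtopology X (U \<union> V)) c"
  obtains a b sd h where
    "singular_chain p (subtopology X U) a" "singular_chain p (subtopology X V) b" "sd p c = a + b"
    "subdivision_ops sd h"
proof -
  let ?Y = "subtopology X (U \<union> V)"
  have UV: "openin ?Y U" "openin ?Y V"
    using U V by (auto simp: openin_subtopology_Int2 openin_open_subtopology openin_Un)
  obtain n where n: "\<And>m f. \<lbrakk>n \<le> m; f \<in> Poly_Mapping.keys ((singular_subdivision p ^^ m) c)\<rbrakk>
                      \<Longrightarrow> \<exists>W \<in> {U, V}. f \<in> (standard_simplex p) \<rightarrow> W"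
    by (rule sufficient_iterated_singular_subdivision_exists[of "{U,V}" ?Y p c])
       (use UV c U V openin_subset in auto)
  obtain h where h:
        "\<And>p. h p 0 = (0 :: 'a chain)"
        "\<And>p c1 c2. h p (c1-c2) = h p c1 - h p c2"
        "\<And>p X c. singular_chain p X c \<Longrightarrow> singular_chain (Suc p) X (h p c)"
        "\<And>p X c. singular_chain p X c
                 \<Longrightarrow> chain_boundary (Suc p) (h p c) + h (p - Suc 0) (chain_boundary p c)
                   = (singular_subdivision p ^^ n) c - c"
    using chain_homotopic_iterated_singular_subdivision[of n] by metis
  define sd where "sd = (\<lambda>q. (singular_subdivision q ^^ n :: 'a chain \<Rightarrow> 'a chain))"
  have hadd: "h q (c1 + c2) = h q c1 + h q c2" for q c1 c2
    using h(2)[of q c1 "- c2"] h(2)[of q 0 c2] by (simp add: h(1))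
  have sdadd: "sd q (c1 + c2) = sd q c1 + sd q c2" for q c1 c2
    using singular_subdivision_power_diff[of n q c1 "- c2"] singular_subdivision_power_diff[of n q 0 c2]
    by (simp add: sd_def)
  have sdch: "singular_chain q Y (sd q c)" if "singular_chain q (Y :: 'a topology) c" for q Y c
  proof -
    have "singular_chain q Y ((singular_subdivision q ^^ m) c)" for m
      by (induction m) (auto simp: that singular_chain_singular_subdivision)
    then show ?thesis by (simp add: sd_def)
  qed
  have scs: "singular_chain p X (sd p c)"
    using sdch[OF c] singular_chain_subI by blast
  have "Poly_Mapping.keys (sd p c) \<subseteq> singular_simplex_set p (subtopology X U)
                              \<union> singular_simplex_set p (subtopology X V)"
  proof
    fix f assume f: "f \<in> Poly_Mapping.keys (sd p c)"
    then have "singular_simplex p X f"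
      using scs by (auto simp: singular_chain_def)
    with n[OF order_refl, of f] f show "f \<in> singular_simplex_set p (subtopology X U)
                              \<union> singular_simplex_set p (subtopology X V)"
      by (auto simp: singular_simplex_subtopology sd_def)
  qed
  from frag_split[OF this] obtain a b where
    "singular_chain p (subtopology X U) a" "singular_chain p (subtopology X V) b" "sd p c = a + b"
    unfolding singular_chain_def by metis
  moreover have "subdivision_ops sd h"
    using h(1,3) hadd sdadd sdch h(4) unfolding subdivision_ops_def
    by (auto simp: sd_def algebra_simps)
  ultimately show ?thesis using that by blast
qed

text \<open>The Mayer--Vietoris step: the difference of the two nullhomologies is a cycle relative to the
  union of \<open>U\<close> and \<open>V\<close>, one degree higher.\<close>

lemma relboundary2_Int:
  fixes X :: "'a topology"
  assumes U: "openin X U" and V: "openin X V"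
    and cU: "relboundary2 p X U c" and cV: "relboundary2 p X V c"
    and null: "\<And>e. relcycle2 (Suc p) X (U \<union> V) e \<Longrightarrow> relboundary2 (Suc p) X (U \<union> V) e"
  shows "relboundary2 p X (U \<inter> V) c"
proof -
  obtain d1 s1 u1 where 1: "singular_chain (Suc p) X d1" "singular_chain p (subtopology X U) s1"
      "singular_chain p X u1" "c = chain_boundary (Suc p) d1 + s1 + (u1 + u1)"
    using cU unfolding relboundary2_def by blast
  obtain d2 s2 u2 where 2: "singular_chain (Suc p) X d2" "singular_chain p (subtopology X V) s2"
      "singular_chain p X u2" "c = chain_boundary (Suc p) d2 + s2 + (u2 + u2)"
    using cV unfolding relboundary2_def by blast
  have s12: "singular_chain p (subtopology X (U \<union> V)) s1" "singular_chain p (subtopology X (U \<union> V)) s2"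
    using 1 2 singular_chain_mono by (metis Un_upper1 Un_upper2)+
  have bd: "chain_boundary (Suc p) (d1 - d2) = (s2 - s1) + ((u2 - u1) + (u2 - u1))"
    using 1(4) 2(4) by (simp add: chain_boundary_diff algebra_simps)
  have "relcycle2 (Suc p) X (U \<union> V) (d1 - d2)"
    by (rule relcycle2I[OF _ _ _ bd]) (auto simp: 1 2 s12 singular_chain_diff)
  then obtain w r v where w: "singular_chain (Suc (Suc p)) X w"
      "singular_chain (Suc p) (subtopology X (U \<union> V)) r"
      "singular_chain (Suc p) X v" "d1 - d2 = chain_boundary (Suc (Suc p)) w + r + (v + v)"
    using null unfolding relboundary2_def by blast
  obtain a b sd h where ab:
    "singular_chain (Suc p) (subtopology X U) a" "singular_chain (Suc p) (subtopology X V) b" "sd (Suc p) r = a + b"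
    and ops: "subdivision_ops sd h"
    using small_chain_split[OF U V w(2)] by blast
  note sd = subdivision_opsD(1,2)[OF ops] and h = subdivision_opsD(3-6)[OF ops]
  define y where "y = (u2 - u1) - chain_boundary (Suc p) v"
  have y: "singular_chain p X y"
    unfolding y_def using 1 2 w by (intro singular_chain_diff singular_chain_boundary_alt)
  have br: "chain_boundary (Suc p) r + s1 = s2 + (y + y)"
  proof -
    have "chain_boundary (Suc p) r = chain_boundary (Suc p) (d1 - d2) -
        chain_boundary (Suc p) (chain_boundary (Suc (Suc p)) w) - chain_boundary (Suc p) (v + v)"
      by (simp add: w(4) chain_boundary_add)
    also have "chain_boundary (Suc p) (chain_boundary (Suc (Suc p)) w) = 0"
      using chain_boundary_boundary_alt[OF w(1)] .
    finally show ?thesis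
      unfolding bd y_def by (simp add: chain_boundary_add algebra_simps)
  qed
  have rX: "singular_chain (Suc p) X r"
    using w singular_chain_subI by blast
  have sdr: "a + b = r + chain_boundary (Suc (Suc p)) (h (Suc p) r) + h p (chain_boundary (Suc p) r)"
    using h(4)[OF rX] ab(3) by simp
  have bab: "chain_boundary (Suc p) a + chain_boundary (Suc p) b =
      chain_boundary (Suc p) r + chain_boundary (Suc p) (h p (chain_boundary (Suc p) r))"
  proof -
    have "chain_boundary (Suc p) (chain_boundary (Suc (Suc p)) (h (Suc p) r)) = 0"
      using chain_boundary_boundary_alt h(3)[OF rX] by blast
    then show ?thesis
      using arg_cong[OF sdr, of "chain_boundary (Suc p)"] by (simp add: chain_boundary_add)
  qed
  have hbr: "h p (chain_boundary (Suc p) r) + h p s1 = h p s2 + (h p y + h p y)"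
    using arg_cong[OF br, of "h p"] by (simp add: h(2))
  \<comment> \<open>\<open>q\<close> collects the terms supported in \<open>U\<close> and \<sigma>
    those in \<open>V\<close>; they agree up to the double of \<tau>, so modulo 2 both are supported
    in the intersection. Cutting \<open>a\<close> and \<open>h p s1\<close> off \<open>d1\<close>
    then changes \<open>s1\<close> into \<open>q\<close>.\<close>
  define q where "q = s1 + chain_boundary (Suc p) a + chain_boundary (Suc p) (h p s1)"
  define \<sigma> where "\<sigma> = s2 - chain_boundary (Suc p) b + chain_boundary (Suc p) (h p s2)"
  define \<tau> where "\<tau> = y + chain_boundary (Suc p) (h p y)"
  have "chain_boundary (Suc p) (h p (chain_boundary (Suc p) r)) + chain_boundary (Suc p) (h p s1)
      = chain_boundary (Suc p) (h p s2) + (chain_boundary (Suc p) (h p y) + chain_boundary (Suc p) (h p y))"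
    using arg_cong[OF hbr, of "chain_boundary (Suc p)"] by (simp add: chain_boundary_add)
  note hbr' = this
  have "q = (chain_boundary (Suc p) a + chain_boundary (Suc p) b) + s1 + chain_boundary (Suc p) (h p s1)
        - chain_boundary (Suc p) b"
    by (simp add: q_def algebra_simps)
  also have "\<dots> = (chain_boundary (Suc p) r + s1) +
      (chain_boundary (Suc p) (h p (chain_boundary (Suc p) r)) + chain_boundary (Suc p) (h p s1)) -
        chain_boundary (Suc p) b"
    unfolding bab by (simp add: algebra_simps)
  also have "\<dots> = \<sigma> + (\<tau> + \<tau>)"
    unfolding hbr' br by (simp add: \<sigma>_def \<tau>_def algebra_simps)
  finally have eq: "q = \<sigma> + (\<tau> + \<tau>)" .
  have "singular_chain p (subtopology X U) q" "singular_chain p (subtopology X V) \<sigma>"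
    unfolding q_def \<sigma>_def using 1 2 ab h(3)
    by (intro singular_chain_add singular_chain_diff singular_chain_boundary_alt; blast)+
  then obtain t t' where t: "singular_chain p (subtopology X (U \<inter> V)) t"
      "singular_chain p (subtopology X U) t'" "q = t + (t' + t')"
    using chain_split_mod2[OF _ _ eq] by blast
  show ?thesis
  proof (rule relboundary2I)
    show "singular_chain (Suc p) X (d1 - a - h p s1)"
      using 1 ab h(3) singular_chain_subI by (intro singular_chain_diff; blast)
    show "singular_chain p (subtopology X (U \<inter> V)) t" by (rule t)
    show "singular_chain p X (t' + u1)"
      using t 1 singular_chain_subI singular_chain_add by blast
    show "c = chain_boundary (Suc p) (d1 - a - h p s1) + t + ((t' + u1) + (t' + u1))"
      using 1(4) t(3) unfolding q_def by (simp add: chain_boundary_diff chain_boundary_add algebra_simps)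
  qed
qed

lemma excise_relcycle2:
  fixes X :: "'a topology"
  assumes W: "openin X W" and K: "closedin X K" "K \<subseteq> W" and c: "relcycle2 p X (topspace X - K) c"
  obtains c' where "relcycle2 p (subtopology X W) (topspace X - K) c'"
    "relboundary2 p X (topspace X - K) (c - c')"
proof -
  let ?V = "topspace X - K"
  have V: "openin X ?V" using K by blast
  have WV: "W \<union> ?V = topspace X" using K openin_subset[OF W] by blast
  obtain s u where s: "singular_chain (p - 1) (subtopology X ?V) s" "singular_chain (p - 1) X u"
    "chain_boundary p c = s + (u + u)" "p = 0 \<Longrightarrow> s = 0 \<and> u = 0"
    using relcycle2E[OF c] by blast
  have cX: "singular_chain p X c" using c relcycle2_chain by blast
  then have "singular_chain p (subtopology X (W \<union> ?V)) c"
    by (simp add: WV)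
  then obtain a b sd h where ab:
    "singular_chain p (subtopology X W) a" "singular_chain p (subtopology X ?V) b" "sd p c = a + b"
    and ops: "subdivision_ops sd h"
    using small_chain_split[OF W V] by blast
  note sd = subdivision_opsD(1,2)[OF ops] and h = subdivision_opsD(3-6)[OF ops]
  \<comment> \<open>For positive \<open>p\<close> the homotopy \<open>h (p - 1)\<close> lands in
    degree \<open>p\<close>; for \<open>p = 0\<close> it would land in degree 1, and the choice of
    zero for \<open>s\<close> and \<open>u\<close> rescues the claim.\<close>
  have hp: "singular_chain p (subtopology X ?V) (h (p - 1) s)" "singular_chain p X (h (p - 1) u)"
    using s h by (cases p; force)+
  have hb: "h (p - 1) (chain_boundary p c) = h (p - 1) s + (h (p - 1) u + h (p - 1) u)"
    by (simp add: s(3) h(2))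
  have sdc: "a + b = c + chain_boundary (Suc p) (h p c) + (h (p - 1) s + (h (p - 1) u + h (p - 1) u))"
    using h(4)[OF cX] ab(3) hb by simp
  have rel: "relboundary2 p X ?V (c - a)"
  proof (rule relboundary2I)
    show "singular_chain (Suc p) X (- h p c)" using h(3)[OF cX] by (simp add: singular_chain_minus)
    show "singular_chain p (subtopology X ?V) (b - h (p - 1) s)" using ab hp by (intro singular_chain_diff)
    show "singular_chain p X (- h (p - 1) u)" using hp by (simp add: singular_chain_minus)
    show "c - a = chain_boundary (Suc p) (- h p c) + (b - h (p - 1) s) + (- h (p - 1) u + - h (p - 1) u)"
      using sdc by (simp add: chain_boundary_minus algebra_simps)
  qed
  have bh0: "chain_boundary p (chain_boundary (Suc p) (h p c)) = 0"
    using chain_boundary_boundary_alt h(3)[OF cX] by blast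
  have "chain_boundary p a = (s - chain_boundary p b + chain_boundary p (h (p - 1) s))
      + ((u + chain_boundary p (h (p - 1) u)) + (u + chain_boundary p (h (p - 1) u)))"
    using arg_cong[OF sdc, of "chain_boundary p"] bh0 s(3) by (simp add: chain_boundary_add algebra_simps)
  moreover have "singular_chain (p - 1) (subtopology X W) (chain_boundary p a)"
    using ab singular_chain_boundary[of p _ a] by simp
  moreover have "singular_chain (p - 1) (subtopology X ?V) (s - chain_boundary p b + chain_boundary p (h (p - 1) s))"
    using s ab hp singular_chain_boundary[of p "subtopology X ?V"] by (auto intro!: singular_chain_add singular_chain_diff)
  ultimately obtain t t' where "singular_chain (p - 1) (subtopology X (W \<inter> ?V)) t"
      "singular_chain (p - 1) (subtopology X W) t'" "chain_boundary p a = t + (t' + t')"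
    using chain_split_mod2 by blast
  then have "relcycle2 p (subtopology X W) ?V a"
    using ab by (intro relcycle2I[of p _ a _ t t']) (auto simp: subtopology_subtopology)
  with rel that show ?thesis by blast
qed

text \<open>Injectivity half of excision: the nullhomology \<open>d\<close> in \<open>X\<close> is
  subdivided, and its part \<open>a\<close> inside \<open>W\<close> bounds \<open>c\<close> up to
  chains avoiding \<open>K\<close> and doubles.\<close>

lemma excise_relboundary2:
  fixes X :: "'a topology"
  assumes W: "openin X W" and K: "closedin X K" "K \<subseteq> W"
    and c: "relcycle2 p (subtopology X W) (topspace X - K) c"
    and c0: "relboundary2 p X (topspace X - K) c"
  shows "relboundary2 p (subtopology X W) (topspace X - K) c"
proof -
  let ?V = "topspace X - K"
  have V: "openin X ?V" using K by blast
  have WV: "W \<union> ?V = topspace X" using K openin_subset[OF W] by blast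
  obtain s u where s: "singular_chain (p - 1) (subtopology X (W \<inter> ?V)) s" "singular_chain (p - 1) (subtopology X W) u"
    "chain_boundary p c = s + (u + u)" "p = 0 \<Longrightarrow> s = 0 \<and> u = 0"
    using relcycle2E[OF c] by (metis subtopology_subtopology)
  have cW: "singular_chain p (subtopology X W) c" using c relcycle2_chain by blast
  obtain d e v where d: "singular_chain (Suc p) X d" "singular_chain p (subtopology X ?V) e"
      "singular_chain p X v" "c = chain_boundary (Suc p) d + e + (v + v)"
    using c0 unfolding relboundary2_def by blast
  then have "singular_chain (Suc p) (subtopology X (W \<union> ?V)) d"
    by (simp add: WV)
  then obtain a b sd h where ab:
    "singular_chain (Suc p) (subtopology X W) a" "singular_chain (Suc p) (subtopology X ?V) b" "sd (Suc p) d = a + b"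
    and ops: "subdivision_ops sd h"
    using small_chain_split[OF W V] by blast
  note sd = subdivision_opsD(1,2)[OF ops] and h = subdivision_opsD(3-6)[OF ops]
  have hp: "singular_chain p (subtopology X (W \<inter> ?V)) (h (p - 1) s)" "singular_chain p (subtopology X W) (h (p - 1) u)"
    using s h by (cases p; force)+
  have hb: "h (p - 1) (chain_boundary p c) = h (p - 1) s + (h (p - 1) u + h (p - 1) u)"
    by (simp add: s(3) h(2))
  have sdc: "sd p c = c + chain_boundary (Suc p) (h p c) + (h (p - 1) s + (h (p - 1) u + h (p - 1) u))"
    using h(4)[OF cW] hb by simp
  have sdb: "sd p (chain_boundary (Suc p) d) = chain_boundary (Suc p) (a + b)"
  proof -
    have A: "sd (Suc p) d = d + chain_boundary (Suc (Suc p)) (h (Suc p) d) + h p (chain_boundary (Suc p) d)"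
      using h(4)[OF d(1)] by simp
    have B: "sd p (chain_boundary (Suc p) d) = chain_boundary (Suc p) d +
        chain_boundary (Suc p) (h p (chain_boundary (Suc p) d))"
      using h(4)[OF singular_chain_boundary_alt[OF d(1)]] chain_boundary_boundary_alt[OF d(1)] by (simp add: h(1))
    have C: "chain_boundary (Suc p) (chain_boundary (Suc (Suc p)) (h (Suc p) d)) = 0"
      using chain_boundary_boundary_alt h(3)[OF d(1)] by blast
    show ?thesis
      using arg_cong[OF A, of "chain_boundary (Suc p)"] B C ab(3) by (simp add: chain_boundary_add)
  qed
  \<comment> \<open>The left side lives in \<open>W\<close> and the first summand on the right
    avoids \<open>K\<close>, so \<open>chain_split_mod2\<close> moves the remainder into the
    intersection.\<close>
  have "sd p c - chain_boundary (Suc p) a = (chain_boundary (Suc p) b + sd p e) + (sd p v + sd p v)"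
    by (subst d(4)) (simp add: sd sdb chain_boundary_add algebra_simps)
  moreover have "singular_chain p (subtopology X W) (sd p c - chain_boundary (Suc p) a)"
    using cW sd ab by (intro singular_chain_diff singular_chain_boundary_alt; blast)
  moreover have "singular_chain p (subtopology X ?V) (chain_boundary (Suc p) b + sd p e)"
    using d sd ab by (intro singular_chain_add singular_chain_boundary_alt; blast)
  ultimately obtain t t' where t: "singular_chain p (subtopology X (W \<inter> ?V)) t"
      "singular_chain p (subtopology X W) t'" "sd p c - chain_boundary (Suc p) a = t + (t' + t')"
    using chain_split_mod2 by blast
  show ?thesis
  proof (rule relboundary2I)
    show "singular_chain (Suc p) (subtopology X W) (a - h p c)" using h(3)[OF cW] ab by (intro singular_chain_diff)
    show "singular_chain p (subtopology (subtopology X W) ?V) (t - h (p - 1) s)"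
      using t hp by (auto simp: subtopology_subtopology intro: singular_chain_diff)
    show "singular_chain p (subtopology X W) (t' - h (p - 1) u)" using t hp by (intro singular_chain_diff)
    show "c = chain_boundary (Suc p) (a - h p c) + (t - h (p - 1) s) + ((t' - h (p - 1) u) + (t' - h (p - 1) u))"
      using sdc t(3) by (simp add: chain_boundary_diff algebra_simps)
  qed
qed

section \<open>Finite-dimensional normed spaces\<close>

text \<open>The bound makes the coefficients of a convergent sequence Cauchy, so the limit is
  assembled by completeness of the reals, whatever the surrounding space.\<close>

lemma closed_span_of_coord_bound:
  fixes B :: "'e::real_normed_vector set"
  assumes B: "finite B" and C: "\<And>c b. b \<in> B \<Longrightarrow> \<bar>c b\<bar> \<le> C * norm (\<Sum>b\<in>B. c b *\<^sub>R b)"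
  shows "closed (span B)"
  unfolding closed_sequential_limits
proof (intro allI impI, elim conjE)
  fix x l assume x: "\<forall>n. x n \<in> span B" and l: "x \<longlonglongrightarrow> l"
  have "\<forall>n. \<exists>c. x n = (\<Sum>b\<in>B. c b *\<^sub>R b)"
    using x unfolding span_finite[OF B] by blast
  then obtain c where c: "\<And>n. x n = (\<Sum>b\<in>B. c n b *\<^sub>R b)"
    by metis
  have Cau: "Cauchy (\<lambda>n. c n b)" if b: "b \<in> B" for b
  proof (rule metric_CauchyI)
    fix e :: real assume e: "e > 0"
    have cx: "Cauchy x" using l by (rule LIMSEQ_imp_Cauchy)
    have "e / (\<bar>C\<bar> + 1) > 0" using e by simp
    then obtain N where N: "\<And>m n. m \<ge> N \<Longrightarrow> n \<ge> N \<Longrightarrow> dist (x m) (x n) < e / (\<bar>C\<bar> + 1)"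
      using metric_CauchyD[OF cx] by blast
    have "dist (c m b) (c n b) < e" if mn: "m \<ge> N" "n \<ge> N" for m n
    proof -
      have "\<bar>c m b - c n b\<bar> \<le> C * norm (\<Sum>b\<in>B. (c m b - c n b) *\<^sub>R b)"
        using C[OF b, of "\<lambda>b. c m b - c n b"] .
      also have "(\<Sum>b\<in>B. (c m b - c n b) *\<^sub>R b) = x m - x n"
        by (simp add: c scaleR_diff_left sum_subtractf)
      also have "C * norm (x m - x n) \<le> (\<bar>C\<bar> + 1) * norm (x m - x n)"
        by (intro mult_right_mono) auto
      also have "\<dots> < e"
        using N[OF mn] by (simp add: dist_norm pos_less_divide_eq mult.commute)
      finally show ?thesis by (simp add: dist_norm)
    qed
    then show "\<exists>N. \<forall>m\<ge>N. \<forall>n\<ge>N. dist (c m b) (c n b) < e" by blast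
  qed
  then have "\<forall>b\<in>B. \<exists>d. (\<lambda>n. c n b) \<longlonglongrightarrow> d"
    using Cauchy_convergent convergent_def by blast
  then obtain d where d: "\<And>b. b \<in> B \<Longrightarrow> (\<lambda>n. c n b) \<longlonglongrightarrow> d b"
    by metis
  have "(\<lambda>n. \<Sum>b\<in>B. c n b *\<^sub>R b) \<longlonglongrightarrow> (\<Sum>b\<in>B. d b *\<^sub>R b)"
    by (intro tendsto_sum tendsto_scaleR d tendsto_const)
  then have "l = (\<Sum>b\<in>B. d b *\<^sub>R b)"
    using l c LIMSEQ_unique by (metis (no_types, lifting) ext)
  then show "l \<in> span B"
    by (simp add: span_sum span_scale span_base)
qed

text \<open>Induction on the basis. By the bound already found, the span of the old vectors is
  closed, so the new vector \<open>a\<close> has positive distance \<delta> from it. This controls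
  the coefficient of \<open>a\<close> and, after subtracting, the remaining ones.\<close>

lemma coord_bound:
  fixes B :: "'e::real_normed_vector set"
  assumes "finite B" "independent B"
  shows "\<exists>C>0. \<forall>c. \<forall>b\<in>B. \<bar>c b\<bar> \<le> C * norm (\<Sum>b\<in>B. c b *\<^sub>R b)"
  using assms
proof (induction B rule: finite_induct)
  case empty
  show ?case by (rule exI[of _ 1]) simp
next
  case (insert a B)
  have ind: "independent B" "a \<notin> span B"
    using insert by (auto simp: independent_insert)
  obtain C where C: "C > 0" "\<And>c b. b \<in> B \<Longrightarrow> \<bar>c b\<bar> \<le> C * norm (\<Sum>b\<in>B. c b *\<^sub>R b)"
    using insert.IH[OF ind(1)] by blast
  have cl: "closed (span B)"
    by (rule closed_span_of_coord_bound[OF insert.hyps(1) C(2)])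
  define \<delta> where "\<delta> = infdist a (span B)"
  have ne: "span B \<noteq> {}" using span_zero by blast
  have \<delta>: "\<delta> > 0"
    unfolding \<delta>_def using ind(2) cl ne in_closed_iff_infdist_zero infdist_nonneg
    by (metis less_eq_real_def)
  have a: "\<bar>t\<bar> * \<delta> \<le> norm (t *\<^sub>R a + s)" if s: "s \<in> span B" for t s
  proof (cases "t = 0")
    case False
    have "\<delta> \<le> dist a (- (1/t) *\<^sub>R s)"
      unfolding \<delta>_def by (rule infdist_le) (rule span_scale[OF s])
    then have "\<bar>t\<bar> * \<delta> \<le> \<bar>t\<bar> * norm (a + (1/t) *\<^sub>R s)"
      by (intro mult_left_mono) (auto simp: dist_norm)
    also have "\<dots> = norm (t *\<^sub>R (a + (1/t) *\<^sub>R s))" by simp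
    also have "t *\<^sub>R (a + (1/t) *\<^sub>R s) = t *\<^sub>R a + s"
      using False by (simp add: scaleR_add_right)
    finally show ?thesis .
  qed simp
  \<comment> \<open>The first summand handles the coefficient of \<open>a\<close>; the second
    multiplies \<open>C\<close> by the bound on \<open>norm s\<close> that is left after removing
    the component along \<open>a\<close>.\<close>
  define D where "D = 1/\<delta> + C * (1 + norm a / \<delta>)"
  have D1: "1/\<delta> \<le> D" "C * (1 + norm a / \<delta>) \<le> D"
    using C(1) \<delta> by (auto simp: D_def intro!: mult_nonneg_nonneg add_nonneg_nonneg)
  show ?case
  proof (intro exI[of _ D] conjI allI ballI)
    show "D > 0" using D1 \<delta> by (meson divide_pos_pos less_le_trans zero_less_one)
    fix c b assume b: "b \<in> insert a B"
    define s where "s = (\<Sum>b\<in>B. c b *\<^sub>R b)"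
    have s: "s \<in> span B" unfolding s_def by (simp add: span_sum span_scale span_base)
    define N where "N = norm (\<Sum>b\<in>insert a B. c b *\<^sub>R b)"
    have N: "N = norm (c a *\<^sub>R a + s)" "N \<ge> 0" using insert.hyps by (auto simp: N_def s_def)
    have ca: "\<bar>c a\<bar> \<le> 1/\<delta> * N"
      using a[OF s, of "c a"] \<delta> by (simp add: N field_simps)
    have "norm s \<le> N + norm (c a *\<^sub>R a)"
      using norm_triangle_ineq4[of "c a *\<^sub>R a + s" "c a *\<^sub>R a"] by (simp add: N)
    also have "\<dots> \<le> N + 1/\<delta> * N * norm a"
      using mult_right_mono[OF ca norm_ge_zero[of a]] by simp
    finally have ns: "norm s \<le> (1 + norm a / \<delta>) * N" by (simp add: algebra_simps)
    show "\<bar>c b\<bar> \<le> D * norm (\<Sum>b\<in>insert a B. c b *\<^sub>R b)"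
    proof (cases "b = a")
      case True
      have "1/\<delta> * N \<le> D * N" by (intro mult_right_mono D1 N)
      then show ?thesis using True ca by (simp add: N_def)
    next
      case False
      then have "\<bar>c b\<bar> \<le> C * norm s" using C(2) b by (auto simp: s_def)
      also have "\<dots> \<le> C * ((1 + norm a / \<delta>) * N)" using ns C by (intro mult_left_mono) auto
      also have "\<dots> \<le> D * N" using mult_right_mono[OF D1(2) N(2)] by (simp add: mult.assoc)
      finally show ?thesis by (simp add: N_def)
    qed
  qed
qed

text \<open>Bounded coordinates for an arbitrary norm; the homeomorphism with Euclidean space,
  compactness of balls and continuity of the metric are all reduced to them.\<close>

lemma finite_dim_coordinates:
  fixes B0 :: "'e::real_normed_vector set"
  assumes fd: "finite B0" "span B0 = UNIV"
  obtains b :: "nat \<Rightarrow> 'e" and k :: "nat \<Rightarrow> 'e \<Rightarrow> real" and C :: real where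
    "C > 0" "\<forall>i. linear (k i)" "\<forall>i x. \<bar>k i x\<bar> \<le> C * norm x"
    "\<forall>x. x = (\<Sum>i<dim (UNIV :: 'e set). k i x *\<^sub>R b i)"
    "\<forall>c i. i < dim (UNIV :: 'e set) \<longrightarrow> k i (\<Sum>j<dim (UNIV :: 'e set). c j *\<^sub>R b j) = c i"
proof -
  let ?n = "dim (UNIV :: 'e set)"
  obtain B :: "'e set" where "B \<subseteq> UNIV" and B: "independent B" "UNIV \<subseteq> span B" "card B = ?n"
    by (rule basis_exists)
  have finB: "finite B"
    using independent_span_bound[OF fd(1) B(1)] fd(2) by auto
  have sB: "span B = UNIV" using B(2) by auto
  obtain C where C: "C > 0" "\<And>c b. b \<in> B \<Longrightarrow> \<bar>c b\<bar> \<le> C * norm (\<Sum>b\<in>B. c b *\<^sub>R b)"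
    using coord_bound[OF finB B(1)] by blast
  obtain b where b: "bij_betw b {..<?n} B"
    using ex_bij_betw_nat_finite[OF finB] B(3) by (metis atLeast0LessThan)
  \<comment> \<open>The value 0 beyond the dimension keeps linearity and the norm bound valid for
    every index.\<close>
  define k where "k = (\<lambda>i x. if i < ?n then representation B x (b i) else 0)"
  have rep: "x = (\<Sum>c\<in>B. representation B x c *\<^sub>R c)" for x
    using sum_representation_eq[OF B(1), of x B] finB sB by simp
  have sumb: "(\<Sum>i<?n. f (b i)) = sum f B" for f :: "'e \<Rightarrow> 'e"
    using sum.reindex_bij_betw[OF b] .
  show ?thesis
  proof (rule that[of C k b])
    show "C > 0" by (rule C)
    show "\<forall>i. linear (k i)"
      unfolding k_def using B(1) sB
      by (intro allI linearI) (auto simp: representation_add representation_scale)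
    show "\<forall>i x. \<bar>k i x\<bar> \<le> C * norm x"
    proof (intro allI)
      fix i x show "\<bar>k i x\<bar> \<le> C * norm x"
      proof (cases "i < ?n")
        case True
        then have "b i \<in> B" using b by (auto simp: bij_betw_def)
        from C(2)[OF this, of "representation B x"] show ?thesis
          using True rep[of x] by (simp add: k_def)
      qed (use C(1) in \<open>simp add: k_def\<close>)
    qed
    show "\<forall>x. x = (\<Sum>i<?n. k i x *\<^sub>R b i)"
    proof
      fix x
      have "(\<Sum>i<?n. k i x *\<^sub>R b i) = (\<Sum>i<?n. representation B x (b i) *\<^sub>R b i)"
        by (intro sum.cong) (auto simp: k_def)
      also have "\<dots> = x" using sumb[of "\<lambda>c. representation B x c *\<^sub>R c"] rep[of x] by simp
      finally show "x = (\<Sum>i<?n. k i x *\<^sub>R b i)" by simp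
    qed
    show "\<forall>c i. i < ?n \<longrightarrow> k i (\<Sum>j<?n. c j *\<^sub>R b j) = c i"
    proof (intro allI impI)
      fix c :: "nat \<Rightarrow> real" and i assume i: "i < ?n"
      let ?c = "\<lambda>x. c (the_inv_into {..<?n} b x)"
      define y where "y = (\<Sum>j<?n. c j *\<^sub>R b j)"
      have inj: "inj_on b {..<?n}" and bB: "b i \<in> B" using b i by (auto simp: bij_betw_def)
      have yB: "y = (\<Sum>x\<in>B. ?c x *\<^sub>R x)"
        unfolding y_def sumb[symmetric] using inj by (intro sum.cong) (auto simp: the_inv_into_f_f)
      have "(\<Sum>x\<in>B. (representation B y x - ?c x) *\<^sub>R x) = 0"
        using rep[of y] yB by (simp add: scaleR_diff_left sum_subtractf)
      then have "\<bar>representation B y (b i) - ?c (b i)\<bar> \<le> C * norm (0::'e)"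
        using C(2)[OF bB, of "\<lambda>x. representation B y x - ?c x"] by simp
      then show "k i (\<Sum>j<?n. c j *\<^sub>R b j) = c i"
        using i inj by (simp add: k_def y_def[symmetric] the_inv_into_f_f)
    qed
  qed
qed

text \<open>The normalisation at 0 lets the space punctured at 0 correspond to Euclidean space
  punctured at the origin.\<close>

lemma finite_dim_homeomorphic:
  fixes B0 :: "'e::real_normed_vector set"
  assumes fd: "finite B0" "span B0 = UNIV"
  obtains f g where
    "homeomorphic_maps (euclidean :: 'e topology) (Euclidean_space (dim (UNIV :: 'e set))) f g"
    "f 0 = (\<lambda>i. 0)"
proof -
  let ?n = "dim (UNIV :: 'e set)"
  obtain b :: "nat \<Rightarrow> 'e" and k :: "nat \<Rightarrow> 'e \<Rightarrow> real" and C :: real where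
    "C > 0" "\<forall>i. linear (k i)" "\<forall>i x. \<bar>k i x\<bar> \<le> C * norm x"
    "\<forall>x. x = (\<Sum>i<dim (UNIV :: 'e set). k i x *\<^sub>R b i)"
    "\<forall>c i. i < dim (UNIV :: 'e set) \<longrightarrow> k i (\<Sum>j<dim (UNIV :: 'e set). c j *\<^sub>R b j) = c i"
    by (rule finite_dim_coordinates[OF fd])
  note C = this(1) and lin = this(2)[rule_format] and kC = this(3)[rule_format]
    and kb = this(4)[rule_format] and ks = this(5)[rule_format]
  have "bounded_linear (k i)" for i
    using lin kC by (intro bounded_linear_intro[where K=C])
      (auto simp: linear_add linear_scale mult.commute)
  then have cont: "continuous_on UNIV (k i)" for i
    by (simp add: linear_continuous_on)
  let ?f = "\<lambda>x i. if i < ?n then k i x else 0"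
  let ?g = "\<lambda>y. \<Sum>i<?n. y i *\<^sub>R b i"
  have "homeomorphic_maps (euclidean :: 'e topology) (Euclidean_space ?n) ?f ?g"
    unfolding homeomorphic_maps_def
  proof (intro conjI ballI)
    show "continuous_map euclidean (Euclidean_space ?n) ?f"
      using cont by (simp add: continuous_map_componentwise_Euclidean_space)
    have "continuous_on (topspace (Euclidean_space ?n)) ?g"
      by (intro continuous_intros continuous_on_subset[OF continuous_on_product_coordinates] subset_UNIV)
    then show "continuous_map (Euclidean_space ?n) euclidean ?g"
      by (simp add: continuous_map_Euclidean_space_iff)
    show "?g (?f x) = x" for x
      using kb[of x] by simp
    show "?f (?g y) = y" if "y \<in> topspace (Euclidean_space ?n)" for y
      using that ks[of _ y] by (auto simp: topspace_Euclidean_space fun_eq_iff)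
  qed
  moreover have "?f 0 = (\<lambda>i. 0)" using lin by (auto simp: linear_0)
  ultimately show ?thesis using that by blast
qed

text \<open>The ball is a closed part of the image of a cube, compact by Tychonoff, under the
  continuous map that forms linear combinations of the basis.\<close>

lemma finite_dim_compact_cball:
  fixes B0 :: "'e::real_normed_vector set"
  assumes fd: "finite B0" "span B0 = UNIV"
  shows "compact (cball (x :: 'e) r)"
proof -
  let ?n = "dim (UNIV :: 'e set)"
  obtain b :: "nat \<Rightarrow> 'e" and k :: "nat \<Rightarrow> 'e \<Rightarrow> real" and C :: real where
    "C > 0" "\<forall>i. linear (k i)" "\<forall>i x. \<bar>k i x\<bar> \<le> C * norm x"
    "\<forall>x. x = (\<Sum>i<dim (UNIV :: 'e set). k i x *\<^sub>R b i)"
    "\<forall>c i. i < dim (UNIV :: 'e set) \<longrightarrow> k i (\<Sum>j<dim (UNIV :: 'e set). c j *\<^sub>R b j) = c i"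
    by (rule finite_dim_coordinates[OF fd])
  note C = this(1) and lin = this(2)[rule_format] and kC = this(3)[rule_format]
    and kb = this(4)[rule_format] and ks = this(5)[rule_format]
  let ?R = "C * (norm x + r)"
  let ?K = "PiE UNIV (\<lambda>i::nat. {-?R..?R})"
  have "compactin (powertop_real UNIV) ?K"
    by (simp add: compactin_PiE)
  then have "compact ?K"
    by (simp add: euclidean_product_topology)
  moreover have "continuous_on ?K (\<lambda>y. \<Sum>i<?n. y i *\<^sub>R b i)"
    by (intro continuous_intros continuous_on_subset[OF continuous_on_product_coordinates] subset_UNIV)
  ultimately have "compact ((\<lambda>y. \<Sum>i<?n. y i *\<^sub>R b i) ` ?K)"
    by (rule compact_continuous_image[rotated])
  moreover have "cball x r \<subseteq> (\<lambda>y. \<Sum>i<?n. y i *\<^sub>R b i) ` ?K"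
  proof
    fix z assume "z \<in> cball x r"
    then have "norm z \<le> norm x + r"
      using norm_triangle_ineq4[of x "x - z"] by (simp add: dist_norm)
    then have "\<bar>k i z\<bar> \<le> ?R" for i
      using order_trans[OF kC[of i z]] C by simp
    then have "(\<lambda>i. k i z) \<in> ?K" by (auto simp: abs_le_iff) (metis minus_le_iff)
    then show "z \<in> (\<lambda>y. \<Sum>i<?n. y i *\<^sub>R b i) ` ?K"
      by (rule rev_image_eqI) (rule kb)
  qed
  ultimately have "compact (((\<lambda>y. \<Sum>i<?n. y i *\<^sub>R b i) ` ?K) \<inter> cball x r)"
      and "((\<lambda>y. \<Sum>i<?n. y i *\<^sub>R b i) ` ?K) \<inter> cball x r = cball x r"
    by (auto intro: compact_Int_closed)
  then show ?thesis by simp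
qed

section \<open>Local homology of a finite-dimensional normed space\<close>

lemma trivial_relative_homology_imp_relboundary:
  assumes "trivial_group (relative_homology_group (int q) X S)" "singular_relcycle q X S c"
  shows "singular_relboundary q X S c"
proof -
  have "homologous_rel_set q X S c \<in> carrier (relative_homology_group (int q) X S)"
    using assms(2) by (simp add: carrier_relative_homology_group)
  moreover have "\<one>\<^bsub>relative_homology_group (int q) X S\<^esub> = singular_relboundary_set q X S"
    by simp
  ultimately show ?thesis
    using assms(1) homologous_rel_set_eq_relboundary unfolding trivial_group_def by (metis singletonD)
qed

text \<open>The dimension shift starts at Euclidean space of dimension 0, whose single point has
  empty complement; raising the dimension by \<open>n\<close> raises the degree by
  \<open>n\<close>.\<close>

lemma relative_homology_group_Euclidean_origin:
  "relative_homology_group (int q) (Euclidean_space n) (topspace (Euclidean_space n) - {\<lambda>i. 0})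
     \<cong> homology_group (int q - int n) (Euclidean_space 0)"
proof -
  have top0: "topspace (Euclidean_space 0) = {\<lambda>i. 0}"
    by (auto simp: topspace_Euclidean_space)
  have "closedin (Euclidean_space 0) {\<lambda>i. 0}"
    by (metis top0 closedin_topspace)
  from relative_homology_group_Euclidean_complement_step[OF this, of "int q - int n" n]
  have *: "relative_homology_group (int q - int n) (Euclidean_space 0) {}
      \<cong> relative_homology_group (int q) (Euclidean_space n) (topspace (Euclidean_space n) - {\<lambda>i. 0})"
    by (simp add: top0)
  show ?thesis
    by (rule group.iso_sym[OF _ *]) simp
qed

lemma Euclidean_origin_relboundary:
  assumes "q \<noteq> n" "singular_relcycle q (Euclidean_space n) (topspace (Euclidean_space n) - {\<lambda>i. 0}) c"
  shows "singular_relboundary q (Euclidean_space n) (topspace (Euclidean_space n) - {\<lambda>i. 0}) c"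
proof -
  have top0: "topspace (Euclidean_space 0) = {\<lambda>i. 0}"
    by (auto simp: topspace_Euclidean_space)
  have "trivial_group (homology_group (int q - int n) (Euclidean_space 0))"
    by (rule homology_dimension_axiom[OF top0]) (use assms in simp)
  then have "trivial_group (relative_homology_group (int q) (Euclidean_space n)
      (topspace (Euclidean_space n) - {\<lambda>i. 0}))"
    using isomorphic_group_triviality[OF relative_homology_group_Euclidean_origin] by simp
  from trivial_relative_homology_imp_relboundary[OF this assms(2)] show ?thesis .
qed

text \<open>This is the isomorphism of the relative homology in degree \<open>n\<close> with the
  integers, stated for cycles instead of classes, so that parity can be read off a chain.\<close>

definition index_map :: "nat \<Rightarrow> 'a topology \<Rightarrow> 'a set \<Rightarrow> ('a chain \<Rightarrow> int) \<Rightarrow> bool" where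
  "index_map n X S \<nu> \<longleftrightarrow>
     (\<forall>a b. singular_relcycle n X S a \<and> singular_relcycle n X S b \<longrightarrow> \<nu> (a + b) = \<nu> a + \<nu> b) \<and>
     (\<forall>c. singular_relcycle n X S c \<longrightarrow> (\<nu> c = 0 \<longleftrightarrow> singular_relboundary n X S c)) \<and>
     (\<forall>k. \<exists>c. singular_relcycle n X S c \<and> \<nu> c = k)"

lemma index_mapD:
  assumes "index_map n X S \<nu>"
  shows "\<lbrakk>singular_relcycle n X S a; singular_relcycle n X S b\<rbrakk> \<Longrightarrow> \<nu> (a + b) = \<nu> a + \<nu> b"
    and "singular_relcycle n X S c \<Longrightarrow> \<nu> c = 0 \<longleftrightarrow> singular_relboundary n X S c"
    and "\<exists>c. singular_relcycle n X S c \<and> \<nu> c = k"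
  using assms unfolding index_map_def by blast+

text \<open>The shift leads to degree 0 of a one-point space, whose homology is infinite cyclic;
  \<nu> is that isomorphism composed with the passage to classes.\<close>

lemma Euclidean_origin_index:
  fixes n :: nat
  defines "X \<equiv> Euclidean_space n" and "S \<equiv> topspace (Euclidean_space n) - {\<lambda>i. 0}"
  shows "\<exists>\<nu>. index_map n X S \<nu>"
proof -
  let ?G = "relative_homology_group (int n) X S"
  have top0: "topspace (Euclidean_space 0) = {\<lambda>i. 0}"
    by (auto simp: topspace_Euclidean_space)
  have "path_connected_space (Euclidean_space 0)"
    unfolding path_connected_space_def top0
    by (auto intro!: exI[of _ "\<lambda>x i. 0"] simp: pathin_def top0)
  then have Z: "homology_group 0 (Euclidean_space 0) \<cong> integer_group"
    by (rule isomorphic_integer_zeroth_homology_group) (simp add: top0)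
  have "?G \<cong> homology_group 0 (Euclidean_space 0)"
    unfolding X_def S_def using relative_homology_group_Euclidean_origin[of n n] by simp
  from iso_trans[OF this Z] obtain \<phi> where \<phi>: "\<phi> \<in> iso ?G integer_group"
    by (auto simp: is_iso_def)
  let ?cl = "homologous_rel_set n X S"
  have car: "carrier ?G = ?cl ` singular_relcycle_set n X S"
    by (simp add: carrier_relative_homology_group)
  have hom: "\<phi> \<in> hom ?G integer_group" and bij: "bij_betw \<phi> (carrier ?G) UNIV"
    using \<phi> by (auto simp: iso_def)
  interpret \<phi>: group_hom ?G integer_group \<phi>
    using hom by (simp add: group_hom_def group_hom_axioms_def)
  show ?thesis
    unfolding index_map_def
  proof (intro exI[of _ "\<phi> \<circ> ?cl"] conjI allI impI)
    fix a b assume ab: "singular_relcycle n X S a \<and> singular_relcycle n X S b"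
    then have "?cl (a + b) = ?cl a \<otimes>\<^bsub>?G\<^esub> ?cl b"
      using normal.rcos_sum[OF normal_subgroup_singular_relboundary_relcycle, of a n X S b]
      by (simp add: relative_homology_group_def FactGroup_def right_coset_singular_relboundary)
    then show "(\<phi> \<circ> ?cl) (a + b) = (\<phi> \<circ> ?cl) a + (\<phi> \<circ> ?cl) b"
      using ab \<phi>.hom_mult[of "?cl a" "?cl b"] by (simp add: car)
  next
    fix c assume c: "singular_relcycle n X S c"
    have "(\<phi> \<circ> ?cl) c = 0 \<longleftrightarrow> ?cl c = \<one>\<^bsub>?G\<^esub>"
    proof -
      have "inj_on \<phi> (carrier ?G)" using bij by (simp add: bij_betw_def)
      moreover have "?cl c \<in> carrier ?G" using c by (simp add: car)
      moreover have "\<one>\<^bsub>?G\<^esub> \<in> carrier ?G" by (rule \<phi>.G.one_closed)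
      moreover have "\<phi> \<one>\<^bsub>?G\<^esub> = 0" using \<phi>.hom_one by simp
      ultimately show ?thesis using inj_on_eq_iff[of \<phi> "carrier ?G"] by fastforce
    qed
    then show "((\<phi> \<circ> ?cl) c = 0) = singular_relboundary n X S c"
      by (simp add: homologous_rel_set_eq_relboundary)
  next
    fix k :: int
    have "k \<in> \<phi> ` carrier ?G" using bij by (simp add: bij_betw_def)
    then show "\<exists>c. singular_relcycle n X S c \<and> (\<phi> \<circ> ?cl) c = k"
      by (auto simp: car)
  qed
qed

lemma homeomorphic_maps_chain_map:
  assumes h: "homeomorphic_maps X Y f g" and c: "singular_chain p X c"
  shows "chain_map p g (chain_map p f c) = c"
proof -
  have "chain_map p g (chain_map p f c) = chain_map p (g \<circ> f) c"
    by (simp add: chain_map_compose)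
  also have "\<dots> = c"
    using h by (intro chain_map_id_gen[OF c]) (simp add: homeomorphic_maps_def)
  finally show ?thesis .
qed

lemma homeomorphic_maps_relboundary_iff:
  assumes h: "homeomorphic_maps X Y f g" "f \<in> S \<rightarrow> T" "g \<in> T \<rightarrow> S" and c: "singular_chain p X c"
  shows "singular_relboundary p Y T (chain_map p f c) \<longleftrightarrow> singular_relboundary p X S c"
  using singular_relboundary_chain_map[of p X S c Y f T] singular_relboundary_chain_map[of p Y T "chain_map p f c" X g S]
    h homeomorphic_maps_chain_map[OF h(1) c] by (auto simp: homeomorphic_maps_def)

text \<open>A translation to the origin followed by the coordinate homeomorphism carries the space
  punctured at \<open>x\<close> to Euclidean space punctured at the origin.\<close>

lemma
  fixes x :: "'e::real_normed_vector"
  assumes fd: "finite B0" "span B0 = (UNIV :: 'e set)"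
  shows local_relboundary: "\<lbrakk>q \<noteq> dim (UNIV :: 'e set); singular_relcycle q euclidean (- {x}) c\<rbrakk>
      \<Longrightarrow> singular_relboundary q euclidean (- {x}) c"
    and local_index: "\<exists>\<nu>. index_map (dim (UNIV :: 'e set)) euclidean (- {x}) \<nu>"
proof -
  let ?n = "dim (UNIV :: 'e set)"
  let ?T = "topspace (Euclidean_space ?n) - {\<lambda>i. 0}"
  obtain f g where fg: "homeomorphic_maps (euclidean :: 'e topology) (Euclidean_space ?n) f g"
    "f 0 = (\<lambda>i. 0)" using finite_dim_homeomorphic[OF fd] by blast
  have "homeomorphic_maps (euclidean :: 'e topology) euclidean (\<lambda>y. y - x) (\<lambda>y. y + x)"
    by (auto simp: homeomorphic_maps_def intro!: continuous_intros)
  from homeomorphic_maps_compose[OF conjI[OF this fg(1)]]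
  obtain F G where FG: "homeomorphic_maps (euclidean :: 'e topology) (Euclidean_space ?n) F G" "F x = (\<lambda>i. 0)"
    using fg(2) by (metis comp_apply diff_self)
  have GF: "G (F y) = y" for y using FG(1) by (simp add: homeomorphic_maps_def)
  have FG': "F (G y) = y" if "y \<in> topspace (Euclidean_space ?n)" for y using that FG(1) by (simp add: homeomorphic_maps_def)
  have Ftop: "F y \<in> topspace (Euclidean_space ?n)" for y
    using FG(1) by (auto simp: homeomorphic_maps_def continuous_map_def)
  have F: "F \<in> (- {x}) \<rightarrow> ?T" using FG(2) GF Ftop by (auto simp: Pi_iff) (metis GF)
  have G: "G \<in> ?T \<rightarrow> - {x}" using FG(2) FG' by auto
  have cF: "continuous_map euclidean (Euclidean_space ?n) F" and cG: "continuous_map (Euclidean_space ?n) euclidean G"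
    using FG(1) by (auto simp: homeomorphic_maps_def)
  have cyc: "singular_relcycle q (Euclidean_space ?n) ?T (chain_map q F c)"
    if "singular_relcycle q euclidean (- {x}) c" for q c
    using singular_relcycle_chain_map[OF that cF F] .
  have bd: "singular_relboundary q (Euclidean_space ?n) ?T (chain_map q F c) \<longleftrightarrow>
      singular_relboundary q euclidean (- {x}) c" if "singular_relcycle q euclidean (- {x}) c" for q c
    using that by (intro homeomorphic_maps_relboundary_iff[OF FG(1) F G]) (auto simp: singular_relcycle)
  show "singular_relboundary q euclidean (- {x}) c" if "q \<noteq> ?n" "singular_relcycle q euclidean (- {x}) c"
    using Euclidean_origin_relboundary[OF that(1) cyc[OF that(2)]] bd[OF that(2)] by simp
  obtain \<nu> where "index_map ?n (Euclidean_space ?n) ?T \<nu>"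
    using Euclidean_origin_index[of ?n] by blast
  note \<nu> = index_mapD[OF this]
  show "\<exists>\<nu>. index_map ?n euclidean (- {x}) \<nu>"
    unfolding index_map_def
  proof (intro exI[of _ "\<nu> \<circ> chain_map ?n F"] conjI allI impI)
    show "(\<nu> \<circ> chain_map ?n F) (a + b) = (\<nu> \<circ> chain_map ?n F) a + (\<nu> \<circ> chain_map ?n F) b"
      if "singular_relcycle ?n euclidean (- {x}) a \<and> singular_relcycle ?n euclidean (- {x}) b" for a b
      using that \<nu>(1) cyc by (simp add: chain_map_add)
    show "((\<nu> \<circ> chain_map ?n F) c = 0) = singular_relboundary ?n euclidean (- {x}) c"
      if "singular_relcycle ?n euclidean (- {x}) c" for c
      using \<nu>(2) cyc[OF that] bd[OF that] by simp
    fix k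
    obtain c where c: "singular_relcycle ?n (Euclidean_space ?n) ?T c" "\<nu> c = k"
      using \<nu>(3) by blast
    have "chain_map ?n F (chain_map ?n G c) = c"
      using c(1) homeomorphic_maps_chain_map[OF homeomorphic_maps_sym[THEN iffD1, OF FG(1)]]
      by (simp add: singular_relcycle)
    then show "\<exists>c. singular_relcycle ?n euclidean (- {x}) c \<and> (\<nu> \<circ> chain_map ?n F) c = k"
      using singular_relcycle_chain_map[OF c(1) cG G] c(2)
      by (intro exI[of _ "chain_map ?n G c"]) simp
  qed
qed

section \<open>Integral lifts of relative cycles modulo 2 and the local homology modulo 2\<close>

text \<open>Doubling does not change the support, as the integers have no 2-torsion.\<close>

lemma singular_chain_double: "singular_chain p X (u + u) \<Longrightarrow> singular_chain p X u"
  by (auto simp: singular_chain_def subset_iff in_keys_iff lookup_add)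

text \<open>A chain has finitely many simplexes, each with compact image. This provides room between
  a chain and the points that it avoids.\<close>

lemma singular_chain_compact_support:
  assumes "singular_chain p (subtopology X S) s"
  obtains C where "compactin X C" "C \<subseteq> S" "singular_chain p (subtopology X C) s"
proof -
  let ?C = "\<Union>f\<in>Poly_Mapping.keys s. f ` standard_simplex p"
  have f: "singular_simplex p (subtopology X S) f" if "f \<in> Poly_Mapping.keys s" for f
    using assms that by (auto simp: singular_chain_def)
  have "compactin X (f ` standard_simplex p)" if "f \<in> Poly_Mapping.keys s" for f
  proof -
    have "continuous_map (subtopology (powertop_real UNIV) (standard_simplex p)) X f"
      using f[OF that] by (auto simp: singular_simplex_def continuous_map_in_subtopology)
    moreover have "compactin (subtopology (powertop_real UNIV) (standard_simplex p)) (standard_simplex p)"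
      using compactin_standard_simplex by (simp add: compactin_subtopology)
    ultimately show ?thesis by (rule image_compactin[rotated])
  qed
  then have "compactin X ?C"
    by (intro compactin_Union) auto
  moreover have "?C \<subseteq> S"
    using f by (force simp: singular_simplex_subtopology)
  moreover have "singular_chain p (subtopology X ?C) s"
    using f by (force simp: singular_chain_def singular_simplex_subtopology)
  ultimately show ?thesis using that by blast
qed

text \<open>The chain \<open>u\<close> with \<open>\<partial>c = s + 2u\<close> represents the Bockstein image of \<open>c\<close>; it is 2-torsion.\<close>

lemma relcycle2_lift:
  assumes c: "relcycle2 p X S c"
    and tf: "\<And>u. \<lbrakk>p > 0; singular_relcycle (p - 1) X S u; singular_relboundary (p - 1) X S (u + u)\<rbrakk>
               \<Longrightarrow> singular_relboundary (p - 1) X S u"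
  obtains z v where "singular_relcycle p X S z" "singular_chain p X v" "c = z + (v + v)"
proof (cases "p = 0")
  case True
  then show ?thesis using that[of c 0] relcycle2_chain[OF c] by (simp add: singular_relcycle chain_boundary_def)
next
  case False
  then have p: "p > 0" "Suc (p - 1) = p" by auto
  have cX: "singular_chain p X c" using c relcycle2_chain by blast
  obtain s u where s: "singular_chain (p - 1) (subtopology X S) s" "singular_chain (p - 1) X u"
    "chain_boundary p c = s + (u + u)"
    using relcycle2E[OF c] by blast
  have "chain_boundary (p - 1) (chain_boundary p c) = 0"
    using chain_boundary_boundary[OF cX] by simp
  \<comment> \<open>Twice the boundary of \<open>u\<close> lies in \<open>S\<close>, hence so does
    the boundary itself: \<open>u\<close> is a relative cycle, and \<open>c\<close> shows that its
    double bounds.\<close>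
  then have "chain_boundary (p - 1) u + chain_boundary (p - 1) u = - chain_boundary (p - 1) s"
    by (simp add: s(3) chain_boundary_add eq_neg_iff_add_eq_0 add.commute)
  then have "singular_chain (p - 1 - 1) (subtopology X S) (chain_boundary (p - 1) u + chain_boundary (p - 1) u)"
    using singular_chain_boundary[OF s(1)] by (simp add: singular_chain_minus)
  then have u: "singular_relcycle (p - 1) X S u"
    using s singular_chain_double unfolding singular_relcycle by blast
  have "singular_relboundary (p - 1) X S (u + u)"
    unfolding singular_relboundary
    by (rule exI[of _ c], rule exI[of _ "- s"]) (use s cX p in \<open>simp add: singular_chain_minus\<close>)
  from tf[OF p(1) u this] obtain d e where d: "singular_chain p X d" "singular_chain (p - 1) (subtopology X S) e"
     "chain_boundary p d + e = u"
    unfolding singular_relboundary using p by auto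
  \<comment> \<open>Subtracting \<open>d + d\<close> replaces the error \<open>u\<close> by
    \<open>e\<close>, which already lies in \<open>S\<close>, so the corrected chain is an integral
    relative cycle.\<close>
  show ?thesis
  proof (rule that[of "c - (d + d)" d])
    have "chain_boundary p (c - (d + d)) = s + (e + e)"
      unfolding chain_boundary_diff chain_boundary_add s(3) d(3)[symmetric] by (simp add: algebra_simps)
    then show "singular_relcycle p X S (c - (d + d))"
      unfolding singular_relcycle using cX d s by (simp add: singular_chain_add singular_chain_diff)
  qed (use d in auto)
qed

text \<open>Universal coefficients in the simplest case: with vanishing integral homology there is
  no torsion to obstruct the lift, and the lift bounds.\<close>

lemma relboundary2_of_integral:
  assumes c: "relcycle2 p X S c" and null: "\<And>q z. singular_relcycle q X S z \<Longrightarrow> singular_relboundary q X S z"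
  shows "relboundary2 p X S c"
proof -
  obtain z v where "singular_relcycle p X S z" "singular_chain p X v" "c = z + (v + v)"
    using relcycle2_lift[OF c] null by metis
  then show ?thesis
    using null relboundary2_add relboundary2_double relboundary_imp_relboundary2 by metis
qed

text \<open>\<open>ty\<close> names the type of the model space, so that an interpretation can fix
  it.\<close>

locale finite_dim_normed =
  fixes ty :: "'e::real_normed_vector itself" and n :: nat
  assumes fin_dim: "\<exists>B::'e set. finite B \<and> span B = UNIV"
    and dim_n: "dim (UNIV :: 'e set) = n"
begin

lemma local_relboundary': 
  fixes x :: 'e
  shows "\<lbrakk>q \<noteq> n; singular_relcycle q euclidean (- {x}) c\<rbrakk> \<Longrightarrow> singular_relboundary q euclidean (- {x}) c"
  using fin_dim local_relboundary unfolding dim_n[symmetric] by blast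

lemma local_indexE:
  fixes x :: 'e
  obtains \<nu> where "index_map n euclidean (- {x}) \<nu>"
proof -
  obtain B0 where "finite B0" "span B0 = (UNIV :: 'e set)" using fin_dim by blast
  from local_index[OF this, of x] show ?thesis
    using that unfolding dim_n by blast
qed

text \<open>In degree \<open>n\<close> the homology is infinite cyclic, in all other degrees it is
  zero. This discharges the torsion condition of \<open>relcycle2_lift\<close>.\<close>

lemma local_torsion_free:
  fixes x :: 'e
  assumes u: "singular_relcycle q euclidean (- {x}) u" and uu: "singular_relboundary q euclidean (- {x}) (u + u)"
  shows "singular_relboundary q euclidean (- {x}) u"
proof (cases "q = n")
  case True
  obtain \<nu> where ix: "index_map n euclidean (- {x}) \<nu>"
    using local_indexE[of x] by blast
  note \<nu> = index_mapD[OF ix]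
  have "\<nu> (u + u) = 0"
    using \<nu>(2)[OF singular_relcycle_add[OF u u, unfolded True]] uu True by simp
  then have "\<nu> u = 0" using \<nu>(1)[of u u] u True by simp
  then show ?thesis using \<nu>(2) u True by simp
qed (use local_relboundary' u in blast)

text \<open>An integral lift exists and bounds, because its degree differs from
  \<open>n\<close>.\<close>

lemma local_relboundary2_above:
  fixes x :: 'e
  assumes "p > n" and c: "relcycle2 p euclidean (- {x}) c"
  shows "relboundary2 p euclidean (- {x}) c"
proof -
  obtain z v where zv: "singular_relcycle p euclidean (- {x}) z" "singular_chain p euclidean v" "c = z + (v + v)"
    using relcycle2_lift[OF c] local_torsion_free by blast
  have "singular_relboundary p euclidean (- {x}) z"
    using zv(1) assms(1) by (intro local_relboundary') auto
  then show ?thesis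
    unfolding zv(3) using zv(2) by (intro relboundary2_add relboundary2_double relboundary_imp_relboundary2)
qed

text \<open>If the index is even, a cycle \<open>w\<close> with half of it can be subtracted twice.
  Conversely, in a representation with error \<open>u + u\<close> the chain \<open>u\<close> is
  itself a relative cycle, so the index of \<open>z\<close> is twice that of
  \<open>u\<close>.\<close>

lemma local_relboundary2_even:
  fixes x :: 'e
  assumes ix: "index_map n euclidean (- {x}) \<nu>"
    and z: "singular_relcycle n euclidean (- {x}) z"
  shows "relboundary2 n euclidean (- {x}) z \<longleftrightarrow> even (\<nu> z)"
proof
  note \<nu> = index_mapD[OF ix]
  assume "even (\<nu> z)"
  then obtain k where k: "\<nu> z = k + k" by (metis evenE mult_2)
  obtain w where w: "singular_relcycle n euclidean (- {x}) w" "\<nu> w = k" using \<nu>(3) by blast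
  have ww: "singular_relcycle n euclidean (- {x}) (w + w)" using w by (intro singular_relcycle_add)
  have zw: "singular_relcycle n euclidean (- {x}) (z - (w + w))"
    using z ww by (intro singular_relcycle_diff)
  have "\<nu> (z - (w + w)) = 0"
    using \<nu>(1)[OF zw ww] \<nu>(1)[OF w(1) w(1)] k w(2) by simp
  then have "singular_relboundary n euclidean (- {x}) (z - (w + w))"
    using \<nu>(2)[OF zw] by simp
  from relboundary2_add[OF relboundary_imp_relboundary2[OF this] relboundary2_double[of n euclidean w]]
  show "relboundary2 n euclidean (- {x}) z"
    using w(1) by (simp add: singular_relcycle)
next
  note \<nu> = index_mapD[OF ix]
  assume "relboundary2 n euclidean (- {x}) z"
  then obtain d s u where d: "singular_chain (Suc n) euclidean d" "singular_chain n (subtopology euclidean (- {x})) s"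
    "singular_chain n euclidean u" "z = chain_boundary (Suc n) d + s + (u + u)"
    unfolding relboundary2_def by blast
  have "chain_boundary n u + chain_boundary n u = chain_boundary n z - chain_boundary n s"
    using chain_boundary_boundary_alt[OF d(1)] by (simp add: d(4) chain_boundary_add)
  moreover have "singular_chain (n - 1) (subtopology euclidean (- {x})) (chain_boundary n z - chain_boundary n s)"
    using z singular_chain_boundary[OF d(2)] by (intro singular_chain_diff) (auto simp: singular_relcycle)
  ultimately have u: "singular_relcycle n euclidean (- {x}) u"
    unfolding singular_relcycle using d singular_chain_double by metis
  have uu: "singular_relcycle n euclidean (- {x}) (u + u)" using u by (intro singular_relcycle_add)
  have zu: "singular_relcycle n euclidean (- {x}) (z - (u + u))"
    using z uu by (intro singular_relcycle_diff)
  have "singular_relboundary n euclidean (- {x}) (z - (u + u))"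
    unfolding singular_relboundary using d by (intro exI[of _ d] exI[of _ s]) simp
  then have "\<nu> (z - (u + u)) = 0" using \<nu>(2)[OF zu] by simp
  then have "\<nu> z = \<nu> u + \<nu> u" using \<nu>(1)[OF zu uu] \<nu>(1)[OF u u] by simp
  then show "even (\<nu> z)" by simp
qed

text \<open>Both integral lifts have odd index, so their difference has even index. Uniqueness of
  the nonzero class modulo 2 takes the place of an orientation.\<close>

lemma local_relboundary2_diff:
  fixes x :: 'e
  assumes c: "relcycle2 n euclidean (- {x}) c" "relcycle2 n euclidean (- {x}) c'"
    and n: "\<not> relboundary2 n euclidean (- {x}) c" "\<not> relboundary2 n euclidean (- {x}) c'"
  shows "relboundary2 n euclidean (- {x}) (c - c')"
proof -
  obtain \<nu> where ix: "index_map n euclidean (- {x}) \<nu>"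
    using local_indexE[of x] by blast
  note \<nu> = index_mapD[OF ix]
  note ev = local_relboundary2_even[OF ix]
  obtain z v where z: "singular_relcycle n euclidean (- {x}) z" "singular_chain n euclidean v" "c = z + (v + v)"
    using relcycle2_lift[OF c(1)] local_torsion_free by blast
  obtain z' v' where z': "singular_relcycle n euclidean (- {x}) z'" "singular_chain n euclidean v'" "c' = z' + (v' + v')"
    using relcycle2_lift[OF c(2)] local_torsion_free by blast
  have "odd (\<nu> z)" "odd (\<nu> z')"
    using n ev[OF z(1)] ev[OF z'(1)] relboundary2_add[OF _ relboundary2_double] z z' by blast+
  moreover have zz: "singular_relcycle n euclidean (- {x}) (z - z')" using z z' by (intro singular_relcycle_diff)
  then have "\<nu> z = \<nu> (z - z') + \<nu> z'" using \<nu>(1)[OF zz z'(1)] by simp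
  ultimately have "even (\<nu> (z - z'))" by presburger
  then have "relboundary2 n euclidean (- {x}) ((z - z') + ((v - v') + (v - v')))"
    using ev[OF zz] z z' by (intro relboundary2_add relboundary2_double singular_chain_diff) auto
  then show ?thesis by (simp add: z z' algebra_simps)
qed

text \<open>A cycle of index 1 has boundary supported in a compact set missing \<open>x\<close>. A
  dilation about \<open>x\<close> pushes that set beyond radius \<open>R\<close>, and the inverse
  dilation shows that the class stays nonzero.\<close>

lemma local_class_exists:
  fixes x :: 'e
  obtains c where "relcycle2 n euclidean (- cball x R) c" "\<not> relboundary2 n euclidean (- {x}) c"
proof -
  obtain \<nu> where ix: "index_map n euclidean (- {x}) \<nu>"
    using local_indexE[of x] by blast
  note \<nu> = index_mapD[OF ix]
  obtain z where z: "singular_relcycle n euclidean (- {x}) z" "\<nu> z = 1" using \<nu>(3) by blast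
  have nz: "\<not> relboundary2 n euclidean (- {x}) z"
    using local_relboundary2_even[OF ix z(1)] z(2) by simp
  obtain C where C: "compact C" "C \<subseteq> - {x}" "singular_chain (n - 1) (subtopology euclidean C) (chain_boundary n z)"
    using z(1) singular_chain_compact_support unfolding singular_relcycle by (metis compactin_euclidean_iff)
  have "open (- C)" using C(1) compact_imp_closed by blast
  then obtain r where r: "r > 0" "ball x r \<subseteq> - C" using C(2) by (meson ComplD ComplI open_contains_ball subsetD singletonI)
  \<comment> \<open>The boundary of \<open>z\<close> has distance at least \<open>r\<close> from
    \<open>x\<close>, and the factor sends it to distance at least \<open>\<bar>R\<bar> + 1\<close>.
    The absolute value keeps the factor positive for every \<open>R\<close>.\<close>
  define l where "l = (\<bar>R\<bar> + 1) / r"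
  have l: "l > 0" using r by (auto simp: l_def)
  define f where "f = (\<lambda>y. x + l *\<^sub>R (y - x))"
  define g where "g = (\<lambda>y. x + (1/l) *\<^sub>R (y - x))"
  have fg: "homeomorphic_maps (euclidean :: 'e topology) euclidean f g"
    unfolding homeomorphic_maps_def f_def g_def using l by (auto intro!: continuous_intros)
  have zC: "singular_relcycle n euclidean C z" using z C by (simp add: singular_relcycle)
  have "f y \<notin> cball x R" if "y \<in> C" for y
  proof -
    have "norm (y - x) \<ge> r" using r that by (force simp: subset_iff dist_norm norm_minus_commute not_less)
    then have "l * norm (y - x) \<ge> l * r" using l by simp
    then show ?thesis using l r by (simp add: f_def dist_norm l_def)
  qed
  then have 1: "relcycle2 n euclidean (- cball x R) (chain_map n f z)"
    using fg by (intro relcycle2_chain_map[OF relcycle_imp_relcycle2[OF zC]]) (auto simp: homeomorphic_maps_def)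
  have gx: "g \<in> topspace euclidean \<inter> - {x} \<rightarrow> - {x}" using l by (auto simp: g_def)
  have "continuous_map euclidean euclidean g" using fg by (simp add: homeomorphic_maps_def)
  then have "relboundary2 n euclidean (- {x}) (chain_map n g (chain_map n f z))"
    if "relboundary2 n euclidean (- {x}) (chain_map n f z)"
    using relboundary2_chain_map[OF that _ gx] by blast
  then have "\<not> relboundary2 n euclidean (- {x}) (chain_map n f z)"
    using nz homeomorphic_maps_chain_map[OF fg, of n z] z(1) by (auto simp: singular_relcycle)
  with 1 that show ?thesis by blast
qed

end

section \<open>Detecting classes at points of the model space\<close>

text \<open>Pushing points radially away from \<open>x\<close> deforms the punctured space into the
  complement of \<open>B\<close> and keeps that complement inside itself, so the pair has no
  homology.\<close>

lemma convex_complement_relboundary: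
  fixes x :: "'e::real_normed_vector"
  assumes B: "convex B" "bounded B" "x \<in> B"
    and c: "singular_relcycle q (top_of_set (- {x})) (- B) c"
  shows "singular_relboundary q (top_of_set (- {x})) (- B) c"
proof -
  obtain R where R: "B \<subseteq> ball x R" "R > 0"
    using B(2) bounded_subset_ballD by blast
  \<comment> \<open>The point \<open>y\<close> moves outward by \<open>t * R\<close>; at time 1 it
    has left the ball of radius \<open>R\<close>, hence \<open>B\<close>.\<close>
  define h where "h = (\<lambda>(t, y). y + (t * R / norm (y - x)) *\<^sub>R (y - x))"
  let ?V = "- {x}" and ?f = "\<lambda>y. h (1, y)"
  have h_eq: "h (t, y) - x = (1 + t * R / norm (y - x)) *\<^sub>R (y - x)" for t y
    by (simp add: h_def algebra_simps)
  have h_pos: "1 + t * R / norm (y - x) \<ge> 1" if "t \<ge> 0" for t and y :: 'e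
    using that R by simp
  have hV: "h (t, y) \<noteq> x" if "t \<ge> 0" "y \<noteq> x" for t y
    using h_eq[of t y] h_pos[OF that(1), of y] that(2) by auto
  have hW: "h (t, y) \<notin> B" if t: "t \<ge> 0" and y: "y \<notin> B" for t y
  proof
    assume hB: "h (t, y) \<in> B"
    let ?s = "1 + t * R / norm (y - x)"
    \<comment> \<open>\<open>y\<close> lies on the segment from \<open>x\<close> to
      \<open>h (t, y)\<close>, so convexity would put it into \<open>B\<close>.\<close>
    have "y - x = (1 / ?s) *\<^sub>R (h (t, y) - x)"
      unfolding h_eq using h_pos[OF t, of y] by simp
    then have "y = (1 - 1 / ?s) *\<^sub>R x + (1 / ?s) *\<^sub>R h (t, y)"
      by (simp add: algebra_simps)
    moreover have "(1 - 1 / ?s) *\<^sub>R x + (1 / ?s) *\<^sub>R h (t, y) \<in> B"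
      using h_pos[OF t, of y] by (intro convexD[OF B(1) B(3) hB]) (auto simp: divide_simps)
    ultimately show False using y by simp
  qed
  have f1: "?f y \<notin> B" if "y \<noteq> x" for y
  proof -
    have "norm (?f y - x) = (1 + R / norm (y - x)) * norm (y - x)"
      using h_pos[of 1 y] unfolding h_eq by simp
    also have "\<dots> = norm (y - x) + R" using that by (simp add: algebra_simps)
    finally have "norm (?f y - x) \<ge> R" by simp
    then show ?thesis using R by (auto simp: dist_norm norm_minus_commute)
  qed
  have cont: "continuous_map (prod_topology (top_of_set {0..1}) (top_of_set ?V)) (top_of_set ?V) h"
  proof -
    have "continuous_on ({0..1} \<times> ?V) h"
      unfolding h_def case_prod_unfold by (intro continuous_intros) auto
    moreover have "h \<in> {0..1} \<times> ?V \<rightarrow> ?V"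
    proof
      fix z :: "real \<times> 'e" assume z: "z \<in> {0..1} \<times> ?V"
      then show "h z \<in> ?V" using hV[of "fst z" "snd z"] by auto
    qed
    ultimately show ?thesis
      by (simp add: prod_topology_subtopology_eu continuous_map_in_subtopology image_subset_iff_funcset)
  qed
  have hom: "homotopic_with (\<lambda>k. k \<in> (- B) \<rightarrow> (- B)) (top_of_set ?V) (top_of_set ?V) id ?f"
    unfolding homotopic_with_def
    by (rule exI[of _ h]) (use cont hW in \<open>auto simp: h_def\<close>)
  have "homologous_rel q (top_of_set ?V) (- B) (chain_map q id c) (chain_map q ?f c)"
    by (rule homotopic_imp_homologous_rel_chain_maps[OF hom c])
  moreover have cV: "singular_chain q (top_of_set ?V) c" using c by (simp add: singular_relcycle)
  ultimately have "singular_relboundary q (top_of_set ?V) (- B) (c - chain_map q ?f c)"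
    by (simp add: homologous_rel_def chain_map_ident)
  moreover have "continuous_map (top_of_set ?V) (subtopology (top_of_set ?V) (- B)) ?f"
    using homotopic_with_imp_continuous_maps[OF hom] f1 by (auto simp: continuous_map_in_subtopology)
  then have "singular_chain q (subtopology (top_of_set ?V) (- B)) (chain_map q ?f c)"
    using cV by (rule singular_chain_chain_map[rotated])
  then have "singular_relboundary q (top_of_set ?V) (- B) (chain_map q ?f c)"
    by (rule singular_chain_imp_relboundary)
  ultimately show ?thesis
    using singular_relboundary_add by fastforce
qed

text \<open>Modulo boundaries and doubles, \<open>c\<close> becomes a chain \<open>s\<close> of the
  punctured space whose boundary still avoids \<open>B\<close> modulo 2. The pair of the two
  complements has no homology, so \<open>s\<close> bounds as well.\<close>

lemma convex_relboundary2:
  fixes x :: "'e::real_normed_vector"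
  assumes B: "convex B" "bounded B" "x \<in> B"
    and c: "relcycle2 p euclidean (- B) c" and c0: "relboundary2 p euclidean (- {x}) c"
  shows "relboundary2 p euclidean (- B) c"
proof -
  obtain d s u where d: "singular_chain (Suc p) euclidean d" "singular_chain p (top_of_set (- {x})) s"
    "singular_chain p euclidean u" "c = chain_boundary (Suc p) d + s + (u + u)"
    using c0 unfolding relboundary2_def by blast
  obtain s0 u0 where s0: "singular_chain (p - 1) (top_of_set (- B)) s0" "singular_chain (p - 1) euclidean u0"
    "chain_boundary p c = s0 + (u0 + u0)"
    using relcycle2E[OF c] by blast
  have "chain_boundary p s = s0 + ((u0 - chain_boundary p u) + (u0 - chain_boundary p u))"
    using s0(3) chain_boundary_boundary_alt[OF d(1)]
    by (simp add: d(4) chain_boundary_add algebra_simps)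
  moreover have "singular_chain (p - 1) (top_of_set (- {x})) (chain_boundary p s)"
    using singular_chain_boundary[OF d(2)] by simp
  ultimately obtain t t' where t: "singular_chain (p - 1) (top_of_set (- {x} \<inter> - B)) t"
      "singular_chain (p - 1) (top_of_set (- {x})) t'" "chain_boundary p s = t + (t' + t')"
    using chain_split_mod2[of "p - 1" euclidean "- {x}" _ "- B" s0] s0(1) by metis
  then have "relcycle2 p (top_of_set (- {x})) (- B) s"
    using d by (intro relcycle2I[of p _ s _ t t']) (auto simp: subtopology_subtopology)
  then have "relboundary2 p (top_of_set (- {x})) (- B) s"
    by (rule relboundary2_of_integral) (rule convex_complement_relboundary[OF B])
  then have "relboundary2 p euclidean (- B) s"
    by (rule relboundary2_sub_mono) auto
  moreover have "relboundary2 p euclidean (- B) (chain_boundary (Suc p) d + (u + u))"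
    using d by (intro relboundary2_add relboundary2_boundary relboundary2_double)
  ultimately have "relboundary2 p euclidean (- B) (s + (chain_boundary (Suc p) d + (u + u)))"
    by (rule relboundary2_add)
  then show ?thesis by (simp add: d(4) algebra_simps)
qed

text \<open>Restriction from the homology of (X, X - A) modulo 2 to the local homology at the points
  of \<open>A\<close> is injective in degrees from \<open>m\<close> on. Where the local homology
  vanishes above \<open>m\<close>, the homology of the pair vanishes there too.\<close>

definition locally_detected :: "nat \<Rightarrow> 'a topology \<Rightarrow> 'a set \<Rightarrow> bool" where
  "locally_detected m X A \<longleftrightarrow>
     (\<forall>p\<ge>m. \<forall>c. relcycle2 p X (topspace X - A) c \<longrightarrow>
        (\<forall>x\<in>A. relboundary2 p X (topspace X - {x}) c) \<longrightarrow> relboundary2 p X (topspace X - A) c)"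

lemma locally_detectedD:
  "\<lbrakk>locally_detected m X A; p \<ge> m; relcycle2 p X (topspace X - A) c;
    \<And>x. x \<in> A \<Longrightarrow> relboundary2 p X (topspace X - {x}) c\<rbrakk> \<Longrightarrow> relboundary2 p X (topspace X - A) c"
  unfolding locally_detected_def by blast

lemma locally_detected_empty: "locally_detected m X {}"
  by (auto simp: locally_detected_def intro: relboundary2_topspace relcycle2_chain)

text \<open>Mayer-Vietoris: the obstruction to combining the two nullhomologies lives one degree
  higher over \<open>A \<inter> B\<close>, where it vanishes because it vanishes at every
  point.\<close>

lemma locally_detected_Un:
  fixes X :: "'a topology"
  assumes A: "closedin X A" and B: "closedin X B"
    and det: "locally_detected m X A" "locally_detected m X B" "locally_detected m X (A \<inter> B)"
    and loc: "\<And>p x c. \<lbrakk>p > m; x \<in> A \<inter> B; relcycle2 p X (topspace X - {x}) c\<rbrakk>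
                \<Longrightarrow> relboundary2 p X (topspace X - {x}) c"
  shows "locally_detected m X (A \<union> B)"
  unfolding locally_detected_def
proof (intro allI impI)
  fix p c assume p: "m \<le> p" and c: "relcycle2 p X (topspace X - (A \<union> B)) c"
    and null: "\<forall>x\<in>A \<union> B. relboundary2 p X (topspace X - {x}) c"
  have eq: "(topspace X - A) \<union> (topspace X - B) = topspace X - (A \<inter> B)"
    "(topspace X - A) \<inter> (topspace X - B) = topspace X - (A \<union> B)" by auto
  have "relboundary2 p X ((topspace X - A) \<inter> (topspace X - B)) c"
  proof (rule relboundary2_Int)
    show "openin X (topspace X - A)" "openin X (topspace X - B)" using A B by auto
    show "relboundary2 p X (topspace X - A) c" "relboundary2 p X (topspace X - B) c"
      using c null p by (auto intro!: locally_detectedD[OF det(1)] locally_detectedD[OF det(2)] elim!: relcycle2_mono)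
    fix e assume e: "relcycle2 (Suc p) X (topspace X - A \<union> (topspace X - B)) e"
    then show "relboundary2 (Suc p) X (topspace X - A \<union> (topspace X - B)) e"
      unfolding eq using p
      by (intro locally_detectedD[OF det(3)] loc) (auto elim!: relcycle2_mono)
  qed
  then show "relboundary2 p X (topspace X - (A \<union> B)) c" by (simp add: eq)
qed

context finite_dim_normed
begin

lemma locally_detected_convex:
  fixes B :: "'e set"
  assumes "convex B" "bounded B"
  shows "locally_detected n euclidean B"
proof (cases "B = {}")
  case True then show ?thesis using locally_detected_empty by simp
next
  case False
  then obtain x where "x \<in> B" by blast
  then show ?thesis
    using convex_relboundary2[OF assms] unfolding locally_detected_def Compl_eq_Diff_UNIV by auto
qed

text \<open>The extra set \<open>B\<close> makes the induction close: the overlap met in the step is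
  again a finite union cut with a convex set, namely with \<open>A \<inter> B\<close>.\<close>

lemma locally_detected_Union_convex:
  fixes F :: "'e set set"
  assumes "finite F" "\<And>A. A \<in> F \<Longrightarrow> convex A \<and> compact A" "convex B" "closed B"
  shows "locally_detected n euclidean (\<Union>F \<inter> B)"
  using assms
proof (induction F arbitrary: B rule: finite_induct)
  case empty then show ?case by (simp add: locally_detected_empty)
next
  case (insert A F)
  have cl: "closed (\<Union>F)" using insert by (intro closed_Union) (auto intro: compact_imp_closed)
  have A: "convex A" "compact A" using insert by auto
  have "locally_detected n euclidean ((A \<inter> B) \<union> (\<Union>F \<inter> B))"
  proof (rule locally_detected_Un)
    show "closedin euclidean (A \<inter> B)" "closedin euclidean (\<Union>F \<inter> B)"
      using insert cl A by (auto intro: compact_imp_closed)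
    show "locally_detected n euclidean (A \<inter> B)"
      using A insert by (intro locally_detected_convex convex_Int bounded_Int) (auto intro: compact_imp_bounded)
    show "locally_detected n euclidean (\<Union>F \<inter> B)" using insert by auto
    have "locally_detected n euclidean (\<Union>F \<inter> (A \<inter> B))"
      using insert.prems A by (intro insert.IH convex_Int) (auto intro: compact_imp_closed)
    then show "locally_detected n euclidean (A \<inter> B \<inter> (\<Union>F \<inter> B))"
      by (simp add: Int_ac)
    show "relboundary2 p euclidean (topspace euclidean - {x}) c"
      if "n < p" "relcycle2 p euclidean (topspace euclidean - {x}) c" for p and x :: 'e and c
      using local_relboundary2_above[of p x c] that by (simp add: Compl_eq_Diff_UNIV)
  qed
  then show ?case by (simp add: Int_Un_distrib2)
qed

text \<open>The part of the boundary of \<open>c\<close> off \<open>K\<close> and the remainder of a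
  nullhomology at a point of \<open>K\<close> have compact support, so on a small ball around that
  point \<open>c\<close> remains a cycle and locally null. Finitely many such balls contain
  \<open>K\<close>, and vanishing over their union restricts to \<open>K\<close>.\<close>

lemma locally_detected_compact:
  fixes K :: "'e set"
  assumes K: "compact K"
  shows "locally_detected n euclidean K"
  unfolding locally_detected_def
proof (intro allI impI)
  fix p c assume p: "n \<le> p" and c: "relcycle2 p euclidean (topspace euclidean - K) c"
    and null: "\<forall>x\<in>K. relboundary2 p euclidean (topspace euclidean - {x}) c"
  have cX: "singular_chain p euclidean c" using c relcycle2_chain by blast
  obtain s u where s: "singular_chain (p - 1) (top_of_set (UNIV - K)) s" "singular_chain (p - 1) euclidean u"
    "chain_boundary p c = s + (u + u)"
    using relcycle2E[OF c] by (metis topspace_euclidean)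
  obtain C where C: "compact C" "C \<subseteq> UNIV - K" "singular_chain (p - 1) (top_of_set C) s"
    using singular_chain_compact_support[OF s(1)] by (metis compactin_euclidean_iff)
  have "\<exists>r>0. cball x r \<inter> C = {} \<and> (\<forall>y\<in>cball x r. relboundary2 p euclidean (- {y}) c)" if x: "x \<in> K" for x
  proof -
    obtain d e v where d: "singular_chain (Suc p) euclidean d" "singular_chain p (top_of_set (- {x})) e"
        "singular_chain p euclidean v" "c = chain_boundary (Suc p) d + e + (v + v)"
      using null x unfolding relboundary2_def by (auto simp: Compl_eq_Diff_UNIV)
    obtain D where D: "compact D" "D \<subseteq> - {x}" "singular_chain p (top_of_set D) e"
      using singular_chain_compact_support[OF d(2)] by (metis compactin_euclidean_iff)
    have "open (- (C \<union> D))" "x \<in> - (C \<union> D)"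
      using C D x by (auto intro: compact_imp_closed)
    then obtain r where r: "r > 0" "cball x r \<subseteq> - (C \<union> D)" using open_contains_cball by blast
    have "relboundary2 p euclidean (- {y}) c" if "y \<in> cball x r" for y
    proof (rule relboundary2I)
      show "singular_chain p (top_of_set (- {y})) e"
        using D(3) r that by (elim singular_chain_mono) auto
    qed (use d in auto)
    with r show ?thesis by blast
  qed
  then obtain r where r: "\<And>x. x \<in> K \<Longrightarrow> r x > 0" "\<And>x. x \<in> K \<Longrightarrow> cball x (r x) \<inter> C = {}"
    "\<And>x y. x \<in> K \<Longrightarrow> y \<in> cball x (r x) \<Longrightarrow> relboundary2 p euclidean (- {y}) c"
    by metis
  have "K \<subseteq> (\<Union>x\<in>K. ball x (r x))" using r(1) by force
  from compactE_image[OF K _ this] obtain K' where K': "K' \<subseteq> K" "finite K'" "K \<subseteq> (\<Union>x\<in>K'. ball x (r x))"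
    by auto
  define A where "A = (\<Union>x\<in>K'. cball x (r x))"
  have KA: "K \<subseteq> A" using K'(3) unfolding A_def by force
  have "locally_detected n euclidean (\<Union>((\<lambda>x. cball x (r x)) ` K') \<inter> UNIV)"
    using K' fin_dim finite_dim_compact_cball by (intro locally_detected_Union_convex) auto
  then have det: "locally_detected n euclidean A" by (simp add: A_def)
  have "relcycle2 p euclidean (UNIV - A) c"
  proof (rule relcycle2I)
    show "singular_chain (p - 1) (top_of_set (UNIV - A)) s"
      using C(3) r(2) K'(1) by (elim singular_chain_mono) (auto simp: A_def)
  qed (use cX s in auto)
  moreover have "relboundary2 p euclidean (UNIV - {x}) c" if "x \<in> A" for x
    using that r(3) K'(1) by (auto simp: A_def Compl_eq_Diff_UNIV)
  ultimately have "relboundary2 p euclidean (UNIV - A) c"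
    using locally_detectedD[OF det p] by simp
  then show "relboundary2 p euclidean (topspace euclidean - K) c"
    using KA by (auto elim!: relboundary2_mono)
qed

end

section \<open>The fundamental class modulo 2 of a compact manifold\<close>

text \<open>The existence half of Mayer-Vietoris: subdividing the chain \<open>r\<close> that
  connects \<open>z1\<close> and \<open>z2\<close> splits it into a part \<open>a\<close> to be
  removed from \<open>z1\<close> and a part \<open>b\<close> charged to \<open>z2\<close>.\<close>

lemma relcycle2_glue:
  fixes X :: "'a topology"
  assumes U: "openin X U" and V: "openin X V"
    and z1: "relcycle2 p X U z1" and z2: "relcycle2 p X V z2" and z12: "relboundary2 p X (U \<union> V) (z1 - z2)"
  obtains z where "relcycle2 p X (U \<inter> V) z" "relboundary2 p X U (z - z1)" "relboundary2 p X V (z - z2)"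
proof -
  obtain s1 u1 where 1: "singular_chain (p - 1) (subtopology X U) s1" "singular_chain (p - 1) X u1"
    "chain_boundary p z1 = s1 + (u1 + u1)" "p = 0 \<Longrightarrow> s1 = 0 \<and> u1 = 0"
    using relcycle2E[OF z1] by blast
  obtain s2 u2 where 2: "singular_chain (p - 1) (subtopology X V) s2" "singular_chain (p - 1) X u2"
    "chain_boundary p z2 = s2 + (u2 + u2)" "p = 0 \<Longrightarrow> s2 = 0 \<and> u2 = 0"
    using relcycle2E[OF z2] by blast
  obtain w r v where w: "singular_chain (Suc p) X w" "singular_chain p (subtopology X (U \<union> V)) r"
      "singular_chain p X v" "z1 - z2 = chain_boundary (Suc p) w + r + (v + v)"
    using z12 unfolding relboundary2_def by blast
  have zX: "singular_chain p X z1" "singular_chain p X z2" using z1 z2 relcycle2_chain by blast+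
  obtain a b sd h where ab:
    "singular_chain p (subtopology X U) a" "singular_chain p (subtopology X V) b" "sd p r = a + b"
    and ops: "subdivision_ops sd h"
    using small_chain_split[OF U V w(2)] by blast
  note sd = subdivision_opsD(1,2)[OF ops] and h = subdivision_opsD(3-6)[OF ops]
  define y where "y = u1 - u2 - chain_boundary p v"
  have y: "singular_chain (p - 1) X y"
    unfolding y_def using 1 2 w singular_chain_boundary[OF w(3)] by (intro singular_chain_diff) auto
  have y0: "y = 0" if "p = 0" using that 1 2 by (simp add: y_def chain_boundary_def)
  have br: "chain_boundary p r + s2 = s1 + (y + y)"
  proof -
    have "r = z1 - z2 - chain_boundary (Suc p) w - (v + v)" using w(4) by (simp add: algebra_simps)
    then have "chain_boundary p r = chain_boundary p z1 - chain_boundary p z2 - (chain_boundary p v + chain_boundary p v)"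
      using chain_boundary_boundary_alt[OF w(1)] by (simp add: chain_boundary_diff chain_boundary_add)
    then show ?thesis by (simp add: 1(3) 2(3) y_def algebra_simps)
  qed
  have hs: "singular_chain p (subtopology X U) (h (p - 1) s1)" "singular_chain p (subtopology X V) (h (p - 1) s2)"
    "singular_chain p X (h (p - 1) y)"
    using 1 2 y y0 h by (cases p; force)+
  have hbr: "h (p - 1) (chain_boundary p r) + h (p - 1) s2 = h (p - 1) s1 + (h (p - 1) y + h (p - 1) y)"
    using arg_cong[OF br, of "h (p - 1)"] by (simp add: h(2))
  have rX: "singular_chain p X r" using w singular_chain_subI by blast
  have sdr: "r = a + b - chain_boundary (Suc p) (h p r) - h (p - 1) (chain_boundary p r)"
    using h(4)[OF rX] ab(3) by (simp add: algebra_simps)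
  \<comment> \<open>\<open>z\<close> differs from \<open>z1\<close> by chains in \<open>U\<close>,
    and from \<open>z2\<close> by a boundary, chains in \<open>V\<close> and a double.\<close>
  define z where "z = z1 - a + h (p - 1) s1"
  have zz2: "z - z2 = chain_boundary (Suc p) (w - h p r) + (b + h (p - 1) s2) + ((v - h (p - 1) y) + (v - h (p - 1) y))"
  proof -
    have "z - z2 = (z1 - z2) - a + h (p - 1) s1" by (simp add: z_def)
    also have "\<dots> = chain_boundary (Suc p) w + (a + b - chain_boundary (Suc p) (h p r) - h (p - 1) (chain_boundary p r))
        + (v + v) - a + h (p - 1) s1"
      unfolding w(4) using sdr by simp
    also have "h (p - 1) (chain_boundary p r) = h (p - 1) s1 + (h (p - 1) y + h (p - 1) y) - h (p - 1) s2"
      using hbr by (simp add: eq_diff_eq)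
    finally show ?thesis by (simp add: chain_boundary_diff algebra_simps)
  qed
  have bz1: "chain_boundary p z = (s1 - chain_boundary p a + chain_boundary p (h (p - 1) s1)) + (u1 + u1)"
    by (simp add: z_def chain_boundary_add chain_boundary_diff 1(3))
  let ?q = "s1 - chain_boundary p a + chain_boundary p (h (p - 1) s1)"
  let ?\<sigma> = "s2 + chain_boundary p b + chain_boundary p (h (p - 1) s2)"
  let ?k = "u2 + chain_boundary p v - chain_boundary p (h (p - 1) y)"
  have "chain_boundary p (chain_boundary (Suc p) (w - h p r)) = 0"
    using w h(3)[OF rX] by (intro chain_boundary_boundary_alt singular_chain_diff)
  then have "chain_boundary p (z - z2) = chain_boundary p b + chain_boundary p (h (p - 1) s2) +
      ((chain_boundary p v - chain_boundary p (h (p - 1) y)) + (chain_boundary p v - chain_boundary p (h (p - 1) y)))"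
    unfolding zz2 by (simp add: chain_boundary_add chain_boundary_diff)
  then have bz2: "chain_boundary p z = ?\<sigma> + (?k + ?k)"
    unfolding chain_boundary_diff[of p z z2] 2(3) by (simp add: algebra_simps)
  \<comment> \<open>Two expressions for the boundary of \<open>z\<close>, one through
    \<open>U\<close> and one through \<open>V\<close>, agree modulo 2, so the boundary lies in the
    intersection up to doubles.\<close>
  have "?q = chain_boundary p z - (u1 + u1)" using bz1 by simp
  also have "\<dots> = ?\<sigma> + ((?k - u1) + (?k - u1))" unfolding bz2 by (simp add: algebra_simps)
  finally have eq: "?q = ?\<sigma> + ((?k - u1) + (?k - u1))" .
  have q: "singular_chain (p - 1) (subtopology X U) ?q"
    using 1 hs(1) ab(1) singular_chain_boundary[of p "subtopology X U"]
    by (intro singular_chain_add singular_chain_diff) auto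
  have \<sigma>: "singular_chain (p - 1) (subtopology X V) ?\<sigma>"
    using 2 hs(2) ab(2) singular_chain_boundary[of p "subtopology X V"]
    by (intro singular_chain_add singular_chain_diff) auto
  from chain_split_mod2[OF q \<sigma> eq] obtain t t' where t: "singular_chain (p - 1) (subtopology X (U \<inter> V)) t"
      "singular_chain (p - 1) (subtopology X U) t'" "?q = t + (t' + t')" by blast
  show ?thesis
  proof (rule that[of z])
    have aX: "singular_chain p X a" "singular_chain p X (h (p - 1) s1)"
      using ab hs singular_chain_subI by blast+
    show "relcycle2 p X (U \<inter> V) z"
    proof (rule relcycle2I)
      show "singular_chain p X z" unfolding z_def using zX aX by (intro singular_chain_add singular_chain_diff)
      show "singular_chain (p - 1) (subtopology X (U \<inter> V)) t" by (rule t)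
      show "singular_chain (p - 1) X (t' + u1)" using t(2) 1 singular_chain_subI by (blast intro: singular_chain_add)
      show "chain_boundary p z = t + ((t' + u1) + (t' + u1))" unfolding bz1 t(3) by (simp add: algebra_simps)
    qed
    have "singular_chain p (subtopology X U) (h (p - 1) s1 - a)" using ab hs by (intro singular_chain_diff)
    then show "relboundary2 p X U (z - z1)"
      using relboundary2_subchain by (simp add: z_def algebra_simps)
    show "relboundary2 p X V (z - z2)"
    proof (rule relboundary2I[OF _ _ _ zz2])
      show "singular_chain (Suc p) X (w - h p r)" using w h(3)[OF rX] by (intro singular_chain_diff)
      show "singular_chain p (subtopology X V) (b + h (p - 1) s2)" using ab hs by (intro singular_chain_add)
      show "singular_chain p X (v - h (p - 1) y)" using w hs by (intro singular_chain_diff)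
    qed
  qed
qed

section \<open>Transport of local homology through a chart\<close>

locale euclidean_chart = finite_dim_normed ty n
  for ty :: "'e::real_normed_vector itself" and n :: nat +
  fixes X :: "'a topology" and W :: "'a set" and Q :: "'e set" and f :: "'a \<Rightarrow> 'e" and g :: "'e \<Rightarrow> 'a"
  assumes Hausdorff: "Hausdorff_space X" and openW: "openin X W" and openQ: "open Q"
    and fg: "homeomorphic_maps (subtopology X W) (top_of_set Q) f g"
begin

lemma W_sub: "W \<subseteq> topspace X" using openW openin_subset by blast

lemma topspace_W: "topspace (subtopology X W) = W" using W_sub by auto

lemma f_in: "x \<in> W \<Longrightarrow> f x \<in> Q" and g_in: "y \<in> Q \<Longrightarrow> g y \<in> W"
  and gf: "x \<in> W \<Longrightarrow> g (f x) = x" and f_g: "y \<in> Q \<Longrightarrow> f (g y) = y"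
  using fg topspace_W by (auto simp: homeomorphic_maps_def continuous_map_def)

lemma cont_f: "continuous_map (subtopology X W) (top_of_set Q) f"
  and cont_g: "continuous_map (top_of_set Q) (subtopology X W) g"
  using fg by (auto simp: homeomorphic_maps_def)

lemma cont_f': "continuous_map (subtopology X W) euclidean f"
  using cont_f continuous_map_into_fulltopology by blast

lemma compact_image_f:
  assumes "compactin X K" "K \<subseteq> W" shows "compact (f ` K)"
proof -
  have "compactin (subtopology X W) K" using assms by (simp add: compactin_subtopology)
  from image_compactin[OF this cont_f'] show ?thesis by simp
qed

lemma compact_image_g:
  assumes "compact K" "K \<subseteq> Q" shows "compactin X (g ` K)"
proof -
  have "compactin (top_of_set Q) K" using assms by (simp add: compactin_subtopology)
  from image_compactin[OF this cont_g] show ?thesis by (simp add: compactin_subtopology)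
qed

lemma f_compl:
  assumes "K \<subseteq> W"
  shows "f \<in> topspace (subtopology X W) \<inter> (topspace X - K) \<rightarrow> - f ` K"
proof
  fix x assume "x \<in> topspace (subtopology X W) \<inter> (topspace X - K)"
  then have x: "x \<in> W" "x \<notin> K" by auto
  have False if "y \<in> K" "f x = f y" for y
    using gf[OF x(1)] gf[of y] that assms x(2) by auto
  then show "f x \<in> - f ` K" by blast
qed

lemma relcycle2_chart:
  assumes "K \<subseteq> W" "relcycle2 p (subtopology X W) (topspace X - K) c"
  shows "relcycle2 p euclidean (- f ` K) (chain_map p f c)"
    and "relcycle2 p (top_of_set Q) (UNIV - f ` K) (chain_map p f c)"
  using relcycle2_chain_map[OF assms(2) cont_f' f_compl[OF assms(1)]]
    relcycle2_chain_map[OF assms(2) cont_f f_compl[OF assms(1)]]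
  by (simp_all add: Compl_eq_Diff_UNIV)

text \<open>Excision to \<open>W\<close> on one side and to \<open>Q\<close> on the other, joined by
  the homeomorphism. Compactness of \<open>K\<close> makes \<open>K\<close> and its image closed, as
  excision demands.\<close>

lemma relboundary2_chart:
  assumes K: "compactin X K" "K \<subseteq> W" and c: "relcycle2 p (subtopology X W) (topspace X - K) c"
  shows "relboundary2 p X (topspace X - K) c \<longleftrightarrow> relboundary2 p euclidean (- f ` K) (chain_map p f c)"
proof
  assume "relboundary2 p X (topspace X - K) c"
  then have "relboundary2 p (subtopology X W) (topspace X - K) c"
    using K c Hausdorff openW by (intro excise_relboundary2 compactin_imp_closedin)
  then show "relboundary2 p euclidean (- f ` K) (chain_map p f c)"
    by (rule relboundary2_chain_map[OF _ cont_f' f_compl[OF K(2)]])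
next
  assume "relboundary2 p euclidean (- f ` K) (chain_map p f c)"
  then have "relboundary2 p euclidean (topspace euclidean - f ` K) (chain_map p f c)"
    by (simp add: Compl_eq_Diff_UNIV)
  then have "relboundary2 p (top_of_set Q) (topspace euclidean - f ` K) (chain_map p f c)"
    using relcycle2_chart(2)[OF K(2) c] f_in K(2) compact_image_f[OF K] openQ
    by (intro excise_relboundary2) (auto intro: compact_imp_closed)
  then have "relboundary2 p (subtopology X W) (topspace X - K) (chain_map p g (chain_map p f c))"
    by (rule relboundary2_chain_map[OF _ cont_g]) (use f_g g_in W_sub in \<open>force simp: image_iff\<close>)
  then have "relboundary2 p (subtopology X W) (topspace X - K) c"
    using homeomorphic_maps_chain_map[OF fg relcycle2_chain[OF c]] by simp
  then show "relboundary2 p X (topspace X - K) c"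
    by (rule relboundary2_sub_mono) auto
qed

lemma chart_pullback:
  assumes K: "compact K" "K \<subseteq> Q" and e: "relcycle2 p euclidean (- K) e"
  obtains c where "relcycle2 p (subtopology X W) (topspace X - g ` K) c"
    "relboundary2 p euclidean (- K) (e - chain_map p f c)"
proof -
  obtain e' where e': "relcycle2 p (top_of_set Q) (UNIV - K) e'" "relboundary2 p euclidean (- K) (e - e')"
    using excise_relcycle2[of euclidean Q K p e] openQ K e compact_imp_closed
    by (auto simp: Compl_eq_Diff_UNIV)
  have "relcycle2 p (subtopology X W) (topspace X - g ` K) (chain_map p g e')"
    using K g_in W_sub f_g by (intro relcycle2_chain_map[OF e'(1) cont_g]) (auto, metis subsetD)
  moreover have "chain_map p f (chain_map p g e') = e'"
    using homeomorphic_maps_chain_map[OF homeomorphic_maps_sym[THEN iffD1, OF fg] relcycle2_chain[OF e'(1)]] .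
  ultimately show ?thesis using that e' by metis
qed

text \<open>A single excised chain \<open>c'\<close> serves \<open>K\<close> and each of its points,
  so that conditions at points can be moved to the model space together.\<close>

lemma excise_chart:
  assumes K: "compactin X K" "K \<subseteq> W" and c: "relcycle2 p X (topspace X - K) c"
  obtains c' where "relcycle2 p (subtopology X W) (topspace X - K) c'"
    "relboundary2 p X (topspace X - K) c \<longleftrightarrow> relboundary2 p euclidean (- f ` K) (chain_map p f c')"
    "\<forall>x\<in>K. relboundary2 p X (topspace X - {x}) c \<longleftrightarrow> relboundary2 p euclidean (- {f x}) (chain_map p f c')"
    "relboundary2 p X (topspace X - K) (c - c')"
proof -
  obtain c' where c': "relcycle2 p (subtopology X W) (topspace X - K) c'"
    "relboundary2 p X (topspace X - K) (c - c')"
    using excise_relcycle2[OF openW compactin_imp_closedin[OF Hausdorff K(1)] K(2) c] by blast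
  show ?thesis
  proof (rule that[OF c'(1) _ _ c'(2)])
    show "relboundary2 p X (topspace X - K) c \<longleftrightarrow> relboundary2 p euclidean (- f ` K) (chain_map p f c')"
      using relboundary2_congD[OF c'(2)] relboundary2_chart[OF K c'(1)] by simp
    show "\<forall>x\<in>K. relboundary2 p X (topspace X - {x}) c \<longleftrightarrow> relboundary2 p euclidean (- {f x}) (chain_map p f c')"
    proof
      fix x assume x: "x \<in> K"
      have 1: "relcycle2 p (subtopology X W) (topspace X - {x}) c'"
        using c'(1) x by (auto elim: relcycle2_mono)
      have 2: "relboundary2 p X (topspace X - {x}) (c - c')"
        using c'(2) x by (auto elim: relboundary2_mono)
      have 3: "compactin X {x}" "{x} \<subseteq> W" using x K W_sub by auto
      show "relboundary2 p X (topspace X - {x}) c \<longleftrightarrow> relboundary2 p euclidean (- {f x}) (chain_map p f c')"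
        using relboundary2_congD[OF 2] relboundary2_chart[OF 3 1] by simp
    qed
  qed
qed

lemma chart_detected:
  assumes K: "compactin X K" "K \<subseteq> W"
  shows "locally_detected n X K"
  unfolding locally_detected_def
proof (intro allI impI)
  fix p c assume p: "n \<le> p" and c: "relcycle2 p X (topspace X - K) c"
    and null: "\<forall>x\<in>K. relboundary2 p X (topspace X - {x}) c"
  obtain c' where c': "relcycle2 p (subtopology X W) (topspace X - K) c'"
    "relboundary2 p X (topspace X - K) c \<longleftrightarrow> relboundary2 p euclidean (- f ` K) (chain_map p f c')"
    "\<forall>x\<in>K. relboundary2 p X (topspace X - {x}) c \<longleftrightarrow> relboundary2 p euclidean (- {f x}) (chain_map p f c')"
    "relboundary2 p X (topspace X - K) (c - c')"
    by (rule excise_chart[OF K c])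
  have "relboundary2 p euclidean (topspace euclidean - f ` K) (chain_map p f c')"
  proof (rule locally_detectedD[OF locally_detected_compact[OF compact_image_f[OF K]] p])
    show "relcycle2 p euclidean (topspace euclidean - f ` K) (chain_map p f c')"
      using relcycle2_chart(1)[OF K(2) c'(1)] by (simp add: Compl_eq_Diff_UNIV)
    show "relboundary2 p euclidean (topspace euclidean - {y}) (chain_map p f c')" if "y \<in> f ` K" for y
      using that null c'(3) by (auto simp: Compl_eq_Diff_UNIV)
  qed
  then show "relboundary2 p X (topspace X - K) c" using c'(2) by (simp add: Compl_eq_Diff_UNIV)
qed

lemma chart_local_diff:
  assumes x: "x \<in> W" and c: "relcycle2 n X (topspace X - {x}) c1" "relcycle2 n X (topspace X - {x}) c2"
    and nc: "\<not> relboundary2 n X (topspace X - {x}) c1" "\<not> relboundary2 n X (topspace X - {x}) c2"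
  shows "relboundary2 n X (topspace X - {x}) (c1 - c2)"
proof -
  have K: "compactin X {x}" "{x} \<subseteq> W" using x W_sub by auto
  obtain c1' where c1: "relcycle2 n (subtopology X W) (topspace X - {x}) c1'"
    "relboundary2 n X (topspace X - {x}) c1 \<longleftrightarrow> relboundary2 n euclidean (- f ` {x}) (chain_map n f c1')"
    and "\<forall>y\<in>{x}. relboundary2 n X (topspace X - {y}) c1 \<longleftrightarrow> relboundary2 n euclidean (- {f y}) (chain_map n f c1')"
    and c1d: "relboundary2 n X (topspace X - {x}) (c1 - c1')"
    by (rule excise_chart[OF K c(1)])
  obtain c2' where c2: "relcycle2 n (subtopology X W) (topspace X - {x}) c2'"
    "relboundary2 n X (topspace X - {x}) c2 \<longleftrightarrow> relboundary2 n euclidean (- f ` {x}) (chain_map n f c2')"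
    and "\<forall>y\<in>{x}. relboundary2 n X (topspace X - {y}) c2 \<longleftrightarrow> relboundary2 n euclidean (- {f y}) (chain_map n f c2')"
    and c2d: "relboundary2 n X (topspace X - {x}) (c2 - c2')"
    by (rule excise_chart[OF K c(2)])
  have "relboundary2 n euclidean (- {f x}) (chain_map n f c1' - chain_map n f c2')"
    using relcycle2_chart(1)[OF K(2) c1(1)] relcycle2_chart(1)[OF K(2) c2(1)] nc c1(2) c2(2)
    by (intro local_relboundary2_diff) auto
  then have "relboundary2 n euclidean (- f ` {x}) (chain_map n f (c1' - c2'))" by (simp add: chain_map_diff)
  then have "relboundary2 n X (topspace X - {x}) (c1' - c2')"
    using relboundary2_chart[OF K relcycle2_diff[OF c1(1) c2(1)]] by simp
  from relboundary2_diff[OF relboundary2_add[OF this c1d] c2d]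
  show ?thesis by (simp add: algebra_simps)
qed

text \<open>The pullback of a class relative to a closed ball is nonzero at every point of the ball:
  if it vanished at one, it would vanish relative to the whole convex ball, hence at the
  centre.\<close>

lemma chart_local_class:
  assumes x: "x \<in> W"
  obtains V K c where "openin X V" "x \<in> V" "V \<subseteq> K" "K \<subseteq> W" "compactin X K"
    "relcycle2 n X (topspace X - K) c" "\<And>y. y \<in> K \<Longrightarrow> \<not> relboundary2 n X (topspace X - {y}) c"
proof -
  obtain R where R: "R > 0" "cball (f x) R \<subseteq> Q" using openQ f_in[OF x] open_contains_cball by blast
  have comp: "compact (cball (f x) R)" using fin_dim finite_dim_compact_cball by blast
  obtain e where e: "relcycle2 n euclidean (- cball (f x) R) e" "\<not> relboundary2 n euclidean (- {f x}) e"
    using local_class_exists[of "f x" R] by blast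
  obtain c where c: "relcycle2 n (subtopology X W) (topspace X - g ` cball (f x) R) c"
    "relboundary2 n euclidean (- cball (f x) R) (e - chain_map n f c)"
    using chart_pullback[OF comp R(2) e(1)] by blast
  define K where "K = g ` cball (f x) R"
  define V where "V = {w \<in> W. f w \<in> ball (f x) R}"
  have KW: "K \<subseteq> W" using g_in R(2) by (auto simp: K_def)
  have cK: "compactin X K" unfolding K_def using compact_image_g[OF comp R(2)] .
  have fK: "f ` K = cball (f x) R" using f_g R(2) by (force simp: K_def image_image)
  show ?thesis
  proof (rule that[of V K c])
    have "openin (subtopology X W) {w \<in> topspace (subtopology X W). f w \<in> ball (f x) R}"
      by (rule openin_continuous_map_preimage[OF cont_f']) simp
    then show "openin X V"
      unfolding V_def topspace_W by (rule openin_trans_full) (rule openW)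
    show "x \<in> V" using x R(1) by (simp add: V_def)
    show "V \<subseteq> K" 
    proof
      fix w assume "w \<in> V"
      then have "w \<in> W" "f w \<in> cball (f x) R" by (auto simp: V_def)
      then show "w \<in> K" unfolding K_def using gf by (metis imageI)
    qed
    show "K \<subseteq> W" "compactin X K" by fact+
    show "relcycle2 n X (topspace X - K) c"
      using c(1) unfolding K_def by (rule relcycle2_sub_mono) auto
    fix y assume y: "y \<in> K"
    show "\<not> relboundary2 n X (topspace X - {y}) c"
    proof
      assume null: "relboundary2 n X (topspace X - {y}) c"
      have y': "compactin X {y}" "{y} \<subseteq> W" using y KW W_sub by auto
      have "relcycle2 n (subtopology X W) (topspace X - {y}) c"
        using c(1) y unfolding K_def[symmetric] by (auto elim: relcycle2_mono)
      from relboundary2_chart[OF y' this] have "relboundary2 n euclidean (- {f y}) (chain_map n f c)"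
        using null by simp
      moreover have fy: "f y \<in> cball (f x) R" using y fK by blast
      moreover have "relboundary2 n euclidean (- {f y}) (e - chain_map n f c)"
        using c(2) fy by (auto elim: relboundary2_mono)
      ultimately have "relboundary2 n euclidean (- {f y}) e"
        using relboundary2_congD by blast
      then have "relboundary2 n euclidean (- cball (f x) R) e"
        by (rule convex_relboundary2[OF convex_cball bounded_cball fy e(1)])
      then have "relboundary2 n euclidean (- {f x}) e"
        using R(1) by (auto elim: relboundary2_mono)
      with e(2) show False by blast
    qed
  qed
qed

end

text \<open>Induction over a finite cover by chart pieces. On an overlap two partial classes are
  both nonzero at each point, hence equal there; detection on the overlap makes their difference
  bound, and they can be glued. Once the cover is complete, the relative set is empty and the result
  is an absolute cycle modulo 2.\<close>

theorem (in finite_dim_normed) fundamental_class2: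
  fixes X :: "'a topology"
  assumes X: "Hausdorff_space X" "compact_space X"
    and charts: "\<And>x. x \<in> topspace X \<Longrightarrow> \<exists>W Q f g. x \<in> W \<and> openin X W \<and> open (Q :: 'e set) \<and>
        homeomorphic_maps (subtopology X W) (top_of_set Q) f g"
  obtains z where "relcycle2 n X {} z" "\<And>x. x \<in> topspace X \<Longrightarrow> \<not> relboundary2 n X (topspace X - {x}) z"
proof -
  \<comment> \<open>Detection is required on every closed part of \<open>K\<close>, since the
    overlap with the union of the earlier pieces can be any such part.\<close>
  define good where "good = (\<lambda>K. closedin X K \<and> (\<forall>A. closedin X A \<longrightarrow> locally_detected n X (A \<inter> K)) \<and>
      (\<exists>c. relcycle2 n X (topspace X - K) c \<and> (\<forall>y\<in>K. \<not> relboundary2 n X (topspace X - {y}) c)))"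
  have "\<exists>V K. openin X V \<and> x \<in> V \<and> V \<subseteq> K \<and> good K" if x: "x \<in> topspace X" for x
  proof -
    obtain W and Q :: "'e set" and f g where W: "x \<in> W" "openin X W" "open Q"
        "homeomorphic_maps (subtopology X W) (top_of_set Q) f g"
      using charts[OF x] by blast
    interpret euclidean_chart ty n X W Q f g
      by unfold_locales (use X W in auto)
    obtain V K c where K: "openin X V" "x \<in> V" "V \<subseteq> K" "K \<subseteq> W" "compactin X K"
      "relcycle2 n X (topspace X - K) c" "\<And>y. y \<in> K \<Longrightarrow> \<not> relboundary2 n X (topspace X - {y}) c"
      using chart_local_class[OF W(1)] by blast
    have "locally_detected n X (A \<inter> K)" if "closedin X A" for A
      using K that by (intro chart_detected) (auto intro: closed_Int_compactin)
    then have "good K"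
      unfolding good_def using K X by (auto intro: compactin_imp_closedin)
    with K show ?thesis by blast
  qed
  then obtain V K where VK: "\<And>x. x \<in> topspace X \<Longrightarrow> openin X (V x) \<and> x \<in> V x \<and> V x \<subseteq> K x \<and> good (K x)"
    by metis
  have "compactin X (topspace X)" using X by (simp add: compact_space_def)
  then obtain \<F> where \<F>: "finite \<F>" "\<F> \<subseteq> V ` topspace X" "topspace X \<subseteq> \<Union>\<F>"
    unfolding compactin_def using VK
    by (smt (verit, ccfv_threshold) UN_I image_iff subsetI)
  then obtain T where T: "finite T" "T \<subseteq> topspace X" "\<F> = V ` T"
    by (meson finite_subset_image)
  have loc: "relboundary2 n X (topspace X - {x}) (c1 - c2)"
    if loc: "x \<in> topspace X" "relcycle2 n X (topspace X - {x}) c1" "relcycle2 n X (topspace X - {x}) c2"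
      "\<not> relboundary2 n X (topspace X - {x}) c1" "\<not> relboundary2 n X (topspace X - {x}) c2" for x c1 c2
  proof -
    obtain W and Q :: "'e set" and f g where W: "x \<in> W" "openin X W" "open Q"
        "homeomorphic_maps (subtopology X W) (top_of_set Q) f g"
      using charts[OF loc(1)] by blast
    interpret euclidean_chart ty n X W Q f g
      by unfold_locales (use X W in auto)
    show ?thesis using chart_local_diff[OF W(1)] loc by blast
  qed
  have "\<exists>z. relcycle2 n X (topspace X - \<Union>(K ` T)) z \<and> (\<forall>y\<in>\<Union>(K ` T). \<not> relboundary2 n X (topspace X - {y}) z)"
    using T(1,2)
  proof (induction T rule: finite_induct)
    case empty
    show ?case by (rule exI[of _ 0]) (auto intro!: relcycle2I[of n X 0 _ 0 0])
  next
    case (insert x T)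
    let ?A = "\<Union>(K ` T)" and ?K = "K x"
    have A: "closedin X ?A"
      using insert VK by (intro closedin_Union) (auto simp: good_def)
    have g: "good ?K" and clK: "closedin X ?K" using insert VK by (auto simp: good_def)
    have KX: "?K \<subseteq> topspace X" using clK closedin_subset by blast
    obtain z1 where z1: "relcycle2 n X (topspace X - ?A) z1"
        "\<And>y. y \<in> ?A \<Longrightarrow> \<not> relboundary2 n X (topspace X - {y}) z1"
      using insert by auto
    obtain z2 where z2: "relcycle2 n X (topspace X - ?K) z2"
        "\<And>y. y \<in> ?K \<Longrightarrow> \<not> relboundary2 n X (topspace X - {y}) z2"
      using g unfolding good_def by blast
    have "relboundary2 n X (topspace X - (?A \<inter> ?K)) (z1 - z2)"
    proof (rule locally_detectedD[where m = n])
      show "locally_detected n X (?A \<inter> ?K)" using g A by (simp add: good_def)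
      have "relcycle2 n X (topspace X - (?A \<inter> ?K)) z1" "relcycle2 n X (topspace X - (?A \<inter> ?K)) z2"
        using z1(1) z2(1) by (auto elim!: relcycle2_mono)
      then show "relcycle2 n X (topspace X - (?A \<inter> ?K)) (z1 - z2)" by (rule relcycle2_diff)
      fix y assume y: "y \<in> ?A \<inter> ?K"
      show "relboundary2 n X (topspace X - {y}) (z1 - z2)"
        using y KX z1 z2 by (intro loc) (auto elim!: relcycle2_mono)
    qed simp
    moreover have eq: "topspace X - (?A \<inter> ?K) = (topspace X - ?A) \<union> (topspace X - ?K)" by auto
    ultimately have "relboundary2 n X ((topspace X - ?A) \<union> (topspace X - ?K)) (z1 - z2)" by simp
    from relcycle2_glue[OF _ _ z1(1) z2(1) this] A clK
    obtain z where z: "relcycle2 n X ((topspace X - ?A) \<inter> (topspace X - ?K)) z"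
       "relboundary2 n X (topspace X - ?A) (z - z1)" "relboundary2 n X (topspace X - ?K) (z - z2)"
      by blast
    have "\<not> relboundary2 n X (topspace X - {y}) z" if y: "y \<in> \<Union>(K ` insert x T)" for y
    proof (cases "y \<in> ?K")
      case True
      have "relboundary2 n X (topspace X - {y}) (z - z2)" using z(3) True by (auto elim!: relboundary2_mono)
      from relboundary2_congD[OF this] show ?thesis using z2(2)[OF True] by simp
    next
      case False
      then have yA: "y \<in> ?A" using y by auto
      then have "relboundary2 n X (topspace X - {y}) (z - z1)" using z(2) by (auto elim!: relboundary2_mono)
      from relboundary2_congD[OF this] show ?thesis using z1(2)[OF yA] by simp
    qed
    moreover have "relcycle2 n X (topspace X - \<Union>(K ` insert x T)) z"
      using z(1) by (auto elim!: relcycle2_mono)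
    ultimately show ?case by blast
  qed
  moreover have "topspace X \<subseteq> \<Union>(K ` T)"
    using \<F>(3) T VK by blast
  ultimately show ?thesis
    using that by (metis (no_types, lifting) Diff_eq_empty_iff subsetD)
qed

section \<open>Maps of degree one modulo 2 are surjective\<close>

text \<open>A subgroup containing all doubles and maximal among those avoiding \<open>z\<close> has index 2.\<close>

lemma exists_mod2_functional:
  fixes A H0 :: "'z::ab_group_add set"
  assumes A: "0 \<in> A" "\<And>a b. a \<in> A \<Longrightarrow> b \<in> A \<Longrightarrow> a - b \<in> A"
    and H0: "0 \<in> H0" "H0 \<subseteq> A" "\<And>a b. a \<in> H0 \<Longrightarrow> b \<in> H0 \<Longrightarrow> a - b \<in> H0"
    and dbl: "\<And>a. a \<in> A \<Longrightarrow> a + a \<in> H0" and z: "z \<in> A" "z \<notin> H0"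
  shows "\<exists>\<psi>::'z \<Rightarrow> int. (\<forall>c. \<psi> c \<in> {0, 1}) \<and> (\<forall>a\<in>A. \<forall>b\<in>A. \<psi> (a + b) = (\<psi> a + \<psi> b) mod 2) \<and>
     (\<forall>c\<in>H0. \<psi> c = 0) \<and> \<psi> z = 1"
proof -
  define S where "S = {H. H0 \<subseteq> H \<and> H \<subseteq> A \<and> (\<forall>a\<in>H. \<forall>b\<in>H. a - b \<in> H) \<and> z \<notin> H}"
  have "\<exists>M\<in>S. \<forall>X\<in>S. M \<subseteq> X \<longrightarrow> X = M"
  proof (rule subset_Zorn_nonempty)
    show "S \<noteq> {}" using H0 z by (auto simp: S_def)
    fix C assume C: "C \<noteq> {}" "subset.chain S C"
    have CS: "\<And>H. H \<in> C \<Longrightarrow> H \<in> S" using C(2) by (auto simp: subset.chain_def)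
    have "a - b \<in> \<Union>C" if ab: "a \<in> \<Union>C" "b \<in> \<Union>C" for a b
    proof -
      obtain H K where "H \<in> C" "K \<in> C" "a \<in> H" "b \<in> K" using ab by blast
      moreover have "H \<subseteq> K \<or> K \<subseteq> H" using C(2) \<open>H \<in> C\<close> \<open>K \<in> C\<close> by (auto simp: subset.chain_def)
      ultimately obtain L where "L \<in> C" "a \<in> L" "b \<in> L" by blast
      moreover from this have "a - b \<in> L" using CS[of L] by (auto simp: S_def)
      ultimately show ?thesis by blast
    qed
    moreover have "H0 \<subseteq> H \<and> H \<subseteq> A \<and> z \<notin> H" if "H \<in> C" for H using CS[OF that] by (simp add: S_def)
    then have "H0 \<subseteq> \<Union>C" "\<Union>C \<subseteq> A" "z \<notin> \<Union>C" using C(1) by blast+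
    ultimately show "\<Union>C \<in> S" unfolding S_def by blast
  qed
  then obtain M where M: "M \<in> S" and max: "\<And>X. X \<in> S \<Longrightarrow> M \<subseteq> X \<Longrightarrow> X = M" by blast
  have M': "H0 \<subseteq> M" "M \<subseteq> A" "\<And>a b. a \<in> M \<Longrightarrow> b \<in> M \<Longrightarrow> a - b \<in> M" "z \<notin> M"
    using M by (auto simp: S_def)
  have M0: "0 \<in> M" using M' H0 by auto
  have Mneg: "- a \<in> M" if "a \<in> M" for a using M'(3)[OF M0 that] by simp
  have Madd: "a + b \<in> M" if "a \<in> M" "b \<in> M" for a b using M'(3)[OF that(1) Mneg[OF that(2)]] by simp
  have Aadd: "a + b \<in> A" if "a \<in> A" "b \<in> A" for a b
    using A(2)[OF that(1) A(2)[OF A(1) that(2)]] by simp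
  \<comment> \<open>If \<open>z - c\<close> were outside \<open>M\<close>, the union of
    \<open>M\<close> and its coset through \<open>c\<close> would be a larger subgroup avoiding
    \<open>z\<close>; it is a subgroup because \<open>c + c\<close> lies in \<open>M\<close>. Hence
    all elements of \<open>A\<close> outside \<open>M\<close> lie in the coset of
    \<open>z\<close>.\<close>
  have key: "z - c \<in> M" if c: "c \<in> A" "c \<notin> M" for c
  proof (rule ccontr)
    assume nz: "z - c \<notin> M"
    define X where "X = {x. x \<in> M \<or> x - c \<in> M}"
    have cc: "c + c \<in> M" using dbl[OF c(1)] M' by blast
    have "X \<in> S"
      unfolding S_def
    proof (intro CollectI conjI ballI)
      show "H0 \<subseteq> X" using M' by (auto simp: X_def)
      show "X \<subseteq> A"
      proof
        fix x assume "x \<in> X"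
        then show "x \<in> A" using M'(2) Aadd[of "x - c" c] c(1) by (auto simp: X_def)
      qed
      show "z \<notin> X" using M' nz by (auto simp: X_def)
      fix a b assume ab: "a \<in> X" "b \<in> X"
      have e1: "a - b - c = (a - c) - b" "a - b = (a - c) - (b - c)" "a - b - c = (a - (b - c)) - (c + c)"
        by (auto simp: algebra_simps)
      show "a - b \<in> X"
        using ab unfolding X_def mem_Collect_eq using M'(3) cc e1 by metis
    qed
    moreover have "M \<subseteq> X" "c \<in> X" using M0 by (auto simp: X_def)
    ultimately show False using max c(2) by blast
  qed
  define \<psi> where "\<psi> = (\<lambda>c. if c \<in> M then 0 else 1 :: int)"
  have "\<psi> (a + b) = (\<psi> a + \<psi> b) mod 2" if ab: "a \<in> A" "b \<in> A" for a b
  proof -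
    consider "a \<in> M" "b \<in> M" | "a \<in> M" "b \<notin> M" | "a \<notin> M" "b \<in> M" | "a \<notin> M" "b \<notin> M" by blast
    then show ?thesis
    proof cases
      case 1 then show ?thesis using Madd by (simp add: \<psi>_def)
    next
      case 2
      then have "a + b \<notin> M" using M'(3)[of "a + b" a] by auto
      with 2 show ?thesis by (simp add: \<psi>_def)
    next
      case 3
      then have "a + b \<notin> M" using M'(3)[of "a + b" b] by auto
      with 3 show ?thesis by (simp add: \<psi>_def)
    next
      case 4
      have "(z + z) - ((z - a) + (z - b)) \<in> M"
        using dbl[OF z(1)] M' key[OF ab(1)] key[OF ab(2)] 4 Madd by blast
      then have "a + b \<in> M" by (simp add: algebra_simps)
      with 4 show ?thesis by (simp add: \<psi>_def)
    qed
  qed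
  then show ?thesis
    using M' by (intro exI[of _ \<psi>]) (auto simp: \<psi>_def)
qed

section \<open>Cochains modulo 2 and the surjectivity argument\<close>

abbreviation Z2 :: "int monoid" where "Z2 \<equiv> integer_mod_group 2"

lemma carrier_Z2: "carrier Z2 = {0, 1}"
  by (auto simp: carrier_integer_mod_group)

lemma mult_Z2: "a \<otimes>\<^bsub>Z2\<^esub> b = (a + b) mod 2" and one_Z2: "\<one>\<^bsub>Z2\<^esub> = 0"
  by (auto simp: integer_mod_group_def)

lemma carrier_cochain_group_Z2:
  "\<phi> \<in> carrier (cochain_group Z2 p X) \<longleftrightarrow>
     (\<forall>c. singular_chain p X c \<longrightarrow> \<phi> c \<in> {0, 1}) \<and>
     (\<forall>a b. singular_chain p X a \<longrightarrow> singular_chain p X b \<longrightarrow> \<phi> (a + b) = (\<phi> a + \<phi> b) mod 2) \<and>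
     \<phi> \<in> extensional (singular_chain_set p X)"
  by (auto simp: cochain_group_def hom_def carrier_Z2 mult_Z2 Pi_iff)

lemma cochain_double:
  assumes "\<phi> \<in> carrier (cochain_group Z2 p X)" "singular_chain p X c"
  shows "\<phi> (c + c) = 0"
  using assms unfolding carrier_cochain_group_Z2 by (auto simp: mod_eq_0_iff_dvd)

lemma cocycles_Z2:
  "\<phi> \<in> cocycles Z2 p X \<longleftrightarrow> \<phi> \<in> carrier (cochain_group Z2 p X) \<and>
     (\<forall>c. singular_chain (Suc p) X c \<longrightarrow> \<phi> (chain_boundary (Suc p) c) = 0)"
  by (auto simp: cocycles_def coboundary_def cochain_group_def one_Z2 fun_eq_iff restrict_def)

text \<open>A coboundary sees the boundary of \<open>e\<close> alone, which is a double when the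
  relative set is empty; in degree 0 the coboundaries are zero.\<close>

lemma coboundary_Z2_cycle:
  assumes b: "b \<in> coboundaries Z2 p X" and e: "relcycle2 p X {} e"
  shows "b e = 0"
proof (cases p)
  case 0
  then show ?thesis using b relcycle2_chain[OF e]
    by (simp add: coboundaries_def cochain_group_def one_Z2)
next
  case (Suc q)
  obtain \<eta> where \<eta>: "\<eta> \<in> carrier (cochain_group Z2 q X)" "b = coboundary q X \<eta>"
    using b Suc by (auto simp: coboundaries_def)
  obtain s u where "singular_chain q (subtopology X {}) s" "singular_chain q X u"
    "chain_boundary p e = s + (u + u)"
    using relcycle2E[OF e] Suc by (metis diff_Suc_1)
  then show ?thesis
    using \<eta> cochain_double[OF \<eta>(1)] relcycle2_chain[OF e] Suc
    by (simp add: coboundary_def singular_chain_empty)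
qed

text \<open>With it, the coset of a cocycle contains that cocycle.\<close>

lemma one_cochain_coboundary: "\<one>\<^bsub>cochain_group Z2 p X\<^esub> \<in> coboundaries Z2 p X"
proof (cases p)
  case (Suc q)
  have "(\<lambda>c\<in>singular_chain_set q X. 0) \<in> carrier (cochain_group Z2 q X)"
    by (auto simp: carrier_cochain_group_Z2 singular_chain_add)
  moreover have "\<one>\<^bsub>cochain_group Z2 p X\<^esub> = coboundary q X (\<lambda>c\<in>singular_chain_set q X. 0)"
    using singular_chain_boundary_alt Suc
    by (auto simp: cochain_group_def coboundary_def one_Z2 fun_eq_iff restrict_def)
  ultimately show ?thesis using Suc by (auto simp: coboundaries_def)
qed (simp add: coboundaries_def)

text \<open>The product enters through a projection \<pi> with section \<open>i\<close>, the
  isometry through a self-homeomorphism \<open>F\<close> of \<open>P\<close>. The same cochain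
  identity is evaluated on cycles moved by \<open>i\<close> and on the fundamental class moved back
  by \<open>F'\<close>, with contradictory results if a point is missed.\<close>

theorem (in finite_dim_normed) star_imp_surjective:
  fixes X :: "'a topology" and P :: "'b topology"
  assumes X: "Hausdorff_space X" "compact_space X"
    and charts: "\<And>x. x \<in> topspace X \<Longrightarrow> \<exists>W Q f g. x \<in> W \<and> openin X W \<and> open (Q :: 'e set) \<and>
        homeomorphic_maps (subtopology X W) (top_of_set Q) f g"
    and pi: "continuous_map P X \<pi>" and i: "continuous_map X P i" and pii: "\<And>x. x \<in> topspace X \<Longrightarrow> \<pi> (i x) = x"
    and F: "homeomorphic_maps P P F F'"
    and star: "carrier (cohomology_group Z2 n P) \<subseteq>
       cohomology_map Z2 n P \<pi> ` carrier (cohomology_group Z2 n X)"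
  shows "(\<pi> \<circ> F \<circ> i) ` topspace X = topspace X"
proof (rule ccontr)
  let ?g = "\<pi> \<circ> F \<circ> i" and ?G = "\<pi> \<circ> F"
  have cF: "continuous_map P P F" "continuous_map P P F'" using F by (auto simp: homeomorphic_maps_def)
  have cG: "continuous_map P X ?G" using cF pi continuous_map_compose by blast
  have cg: "continuous_map X X ?g" using i cG continuous_map_compose by blast
  assume "?g ` topspace X \<noteq> topspace X"
  then obtain x where x: "x \<in> topspace X" "x \<notin> ?g ` topspace X"
    using cg by (auto simp: continuous_map_def)
  obtain z where z: "relcycle2 n X {} z" "\<And>x. x \<in> topspace X \<Longrightarrow> \<not> relboundary2 n X (topspace X - {x}) z"
    using fundamental_class2[OF X charts] by blast
  let ?S = "topspace X - {x}"
  have zc: "singular_chain n X z" using z(1) relcycle2_chain by blast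
  \<comment> \<open>The subgroup to be killed consists of the boundaries modulo 2 relative to the
    complement of \<open>x\<close>; \<open>z\<close> is not among them.\<close>
  have "\<exists>\<psi>::'a chain \<Rightarrow> int. (\<forall>c. \<psi> c \<in> {0, 1}) \<and>
     (\<forall>a\<in>singular_chain_set n X. \<forall>b\<in>singular_chain_set n X. \<psi> (a + b) = (\<psi> a + \<psi> b) mod 2) \<and>
     (\<forall>c\<in>Collect (relboundary2 n X ?S). \<psi> c = 0) \<and> \<psi> z = 1"
  proof (rule exists_mod2_functional)
    show "Collect (relboundary2 n X ?S) \<subseteq> singular_chain_set n X"
      by (auto intro: relboundary2_imp_chain)
  qed (use z(2)[OF x(1)] zc in \<open>auto intro: singular_chain_diff relboundary2_diff relboundary2_double relboundary2_subchain\<close>)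
  then obtain \<psi> :: "'a chain \<Rightarrow> int" where \<psi>: "\<And>c. \<psi> c \<in> {0, 1}"
     "\<And>a b. singular_chain n X a \<Longrightarrow> singular_chain n X b \<Longrightarrow> \<psi> (a + b) = (\<psi> a + \<psi> b) mod 2"
     "\<And>c. relboundary2 n X ?S c \<Longrightarrow> \<psi> c = 0" "\<psi> z = 1"
    by (metis mem_Collect_eq)
  define \<Phi> where "\<Phi> = (\<lambda>c\<in>singular_chain_set n P. \<psi> (chain_map n ?G c))"
  have chG: "singular_chain n X (chain_map n ?G c)" if "singular_chain n P c" for c
    using that cG singular_chain_chain_map by blast
  have \<Phi>: "\<Phi> \<in> cocycles Z2 n P"
    unfolding cocycles_Z2 carrier_cochain_group_Z2
  proof (intro conjI allI impI)
    fix c assume c: "singular_chain (Suc n) P c"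
    have "chain_map n ?G (chain_boundary (Suc n) c) = chain_boundary (Suc n) (chain_map (Suc n) ?G c)"
      using chain_boundary_chain_map[OF c, of ?G] by simp
    moreover have "relboundary2 n X ?S (chain_boundary (Suc n) (chain_map (Suc n) ?G c))"
      using c cG singular_chain_chain_map by (blast intro: relboundary2_boundary)
    ultimately show "\<Phi> (chain_boundary (Suc n) c) = 0"
      using \<psi>(3) singular_chain_boundary_alt[OF c] by (simp add: \<Phi>_def)
  qed (use \<psi>(1) in \<open>auto simp: \<Phi>_def chain_map_add singular_chain_add \<psi>(2) chG\<close>)
  let ?ZP = "cocycle_group Z2 n P" and ?ZX = "cocycle_group Z2 n X"
  let ?BP = "coboundaries Z2 n P" and ?BX = "coboundaries Z2 n X"
  have multP: "(a \<otimes>\<^bsub>?ZP\<^esub> b) c = (a c + b c) mod 2" if "singular_chain n P c" for a b c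
    using that by (simp add: cocycle_group_def cochain_group_def mult_Z2)
  have multX: "\<one>\<^bsub>cochain_group Z2 n X\<^esub> \<otimes>\<^bsub>?ZX\<^esub> b = b" if "b \<in> cocycles Z2 n X" for b
    using that unfolding cocycles_Z2 carrier_cochain_group_Z2
    by (auto simp: cocycle_group_def cochain_group_def mult_Z2 one_Z2 fun_eq_iff restrict_def extensional_def)
  have "?BP #>\<^bsub>?ZP\<^esub> \<Phi> \<in> carrier (cohomology_group Z2 n P)"
    using \<Phi> by (auto simp: cohomology_group_def FactGroup_def RCOSETS_def cocycle_group_def)
  then obtain a where a: "a \<in> carrier (cohomology_group Z2 n X)" "?BP #>\<^bsub>?ZP\<^esub> \<Phi> = cohomology_map Z2 n P \<pi> a"
    using star by blast
  then obtain \<xi> where \<xi>: "\<xi> \<in> cocycles Z2 n X" "a = ?BX #>\<^bsub>?ZX\<^esub> \<xi>"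
    by (auto simp: cohomology_group_def FactGroup_def RCOSETS_def cocycle_group_def)
  \<comment> \<open>The equality of cosets is turned into an equation between cochains: the pullback
    of \<xi> differs from \<Phi> by the coboundary \<open>b\<close>.\<close>
  have "\<xi> \<in> a"
    unfolding \<xi>(2) r_coset_def using one_cochain_coboundary multX[OF \<xi>(1)] by (metis (mono_tags, lifting) UN_I singletonI)
  then have "\<one>\<^bsub>cochain_group Z2 n P\<^esub> \<otimes>\<^bsub>?ZP\<^esub> cochain_map n P \<pi> \<xi> \<in> cohomology_map Z2 n P \<pi> a"
    unfolding cohomology_map_def set_mult_def using one_cochain_coboundary by blast
  then obtain b where b: "b \<in> ?BP" "\<one>\<^bsub>cochain_group Z2 n P\<^esub> \<otimes>\<^bsub>?ZP\<^esub> cochain_map n P \<pi> \<xi> = b \<otimes>\<^bsub>?ZP\<^esub> \<Phi>"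
    unfolding a(2)[symmetric] r_coset_def by blast
  have \<xi>01: "\<xi> c \<in> {0, 1}" if "singular_chain n X c" for c
    using \<xi>(1) that unfolding cocycles_Z2 carrier_cochain_group_Z2 by blast
  have rel: "\<xi> (chain_map n \<pi> c) = (b c + \<psi> (chain_map n ?G c)) mod 2" if c: "singular_chain n P c" for c
  proof -
    have "(\<one>\<^bsub>cochain_group Z2 n P\<^esub> \<otimes>\<^bsub>?ZP\<^esub> cochain_map n P \<pi> \<xi>) c = \<xi> (chain_map n \<pi> c)"
      unfolding multP[OF c] using c \<xi>01[OF singular_chain_chain_map[OF c pi]]
      by (auto simp: cochain_group_def one_Z2 cochain_map_def)
    then show ?thesis
      using arg_cong[OF b(2), of "\<lambda>h. h c"] by (simp add: multP[OF c] \<Phi>_def c)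
  qed
  have \<xi>0: "\<xi> y = 0" if y: "relcycle2 n X {} y" for y
  proof -
    have yc: "singular_chain n X y" using y relcycle2_chain by blast
    have iy: "relcycle2 n P {} (chain_map n i y)" using relcycle2_chain_map[OF y i] by auto
    have "chain_map n \<pi> (chain_map n i y) = y"
      using chain_map_id_gen[OF yc, of "\<pi> \<circ> i"] pii by (simp add: chain_map_compose)
    \<comment> \<open>\<open>?g\<close> misses \<open>x\<close>, so the image chain lies in the
      complement of \<open>x\<close> and is killed.\<close>
    moreover have "\<psi> (chain_map n ?G (chain_map n i y)) = 0"
    proof -
      have "continuous_map X (subtopology X ?S) ?g"
        using cg x(2) continuous_map_image_subset_topspace[OF cg]
        by (auto simp: continuous_map_in_subtopology)
      then have "singular_chain n (subtopology X ?S) (chain_map n ?g y)"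
        using yc singular_chain_chain_map by blast
      then show ?thesis
        using \<psi>(3)[OF relboundary2_subchain] by (simp add: chain_map_compose)
    qed
    ultimately show ?thesis
      using rel[OF relcycle2_chain[OF iy]] coboundary_Z2_cycle[OF b(1) iy] by simp
  qed
  \<comment> \<open>\<open>e\<close> is the cycle that \<open>F\<close> carries to the slice copy of
    \<open>z\<close>, so that \<open>?G\<close> carries it to \<open>z\<close>.\<close>
  define e where "e = chain_map n F' (chain_map n i z)"
  have e: "relcycle2 n P {} e"
    unfolding e_def using relcycle2_chain_map[OF relcycle2_chain_map[OF z(1) i] cF(2)] by auto
  have ec: "singular_chain n P e" using e relcycle2_chain by blast
  have "relcycle2 n X {} (chain_map n \<pi> e)"
    using relcycle2_chain_map[OF e pi] by auto
  then have "\<xi> (chain_map n \<pi> e) = 0" by (rule \<xi>0)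
  then have "\<psi> (chain_map n ?G e) = 0"
    using rel[OF ec] coboundary_Z2_cycle[OF b(1) e] \<psi>(1)[of "chain_map n ?G e"] by auto
  moreover have "chain_map n ?G e = z"
  proof -
    have iz: "singular_chain n P (chain_map n i z)" using singular_chain_chain_map[OF zc i] .
    have "chain_map n F e = chain_map n i z"
      unfolding e_def using homeomorphic_maps_chain_map[OF homeomorphic_maps_sym[THEN iffD1, OF F] iz] .
    then have "chain_map n ?G e = chain_map n (\<pi> \<circ> i) z" by (simp add: chain_map_compose)
    also have "\<dots> = z" using pii by (intro chain_map_id_gen[OF zc]) auto
    finally show ?thesis .
  qed
  ultimately show False using \<psi>(4) by simp
qed

section \<open>Charts and the Riemannian norm\<close>

definition chart_norm :: "('a, 'e::real_normed_vector, 'i) riemannian \<Rightarrow> 'i \<Rightarrow> 'a \<Rightarrow> 'e \<Rightarrow> real" where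
  "chart_norm M i p v = sqrt (metric M i p v v)"

locale riemannian =
  fixes M :: "('a, 'e::real_normed_vector, 'i) riemannian"
  assumes riem: "riemannian_manifold M"
begin

abbreviation "D \<equiv> chart_dom M"
abbreviation "\<phi> \<equiv> chart_coord M"
abbreviation "\<psi> \<equiv> chart_inv M"
abbreviation "G \<equiv> metric M"
abbreviation "N \<equiv> chart_norm M"
abbreviation "U i \<equiv> \<phi> i ` D i"

lemma finite_basis: "\<exists>B::'e set. finite B \<and> span B = UNIV"
  and Hausdorff: "Hausdorff_space (topo M)"
  and smooth_atlas: "smooth_atlas M" and riemannian_metric: "riemannian_metric M"
  using riem by (auto simp: riemannian_manifold_def)

lemma chart_cover: "p \<in> points M \<Longrightarrow> \<exists>i\<in>charts M. p \<in> D i"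
  using smooth_atlas by (auto simp: smooth_atlas_def)

context
  fixes i assumes i: "i \<in> charts M"
begin

lemma openin_dom: "openin (topo M) (D i)"
  and open_U: "open (U i)"
  and chart_homeo: "homeomorphic_map (subtopology (topo M) (D i)) (top_of_set (U i)) (\<phi> i)"
  using smooth_atlas i by (auto simp: smooth_atlas_def)

lemma dom_points: "p \<in> D i \<Longrightarrow> p \<in> points M"
  using openin_dom openin_subset by blast

lemma topspace_dom: "topspace (subtopology (topo M) (D i)) = D i"
  using openin_dom openin_subset by auto

lemma inj_chart: "inj_on (\<phi> i) (D i)"
  using chart_homeo unfolding homeomorphic_eq_everything_map topspace_dom by blast

lemma psi_phi [simp]: "p \<in> D i \<Longrightarrow> \<psi> i (\<phi> i p) = p"
  by (simp add: chart_inv_def inj_chart)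

lemma psi_in: "x \<in> U i \<Longrightarrow> \<psi> i x \<in> D i"
  by (simp add: chart_inv_def inv_into_into)

lemma phi_psi: "x \<in> U i \<Longrightarrow> \<phi> i (\<psi> i x) = x"
  by (simp add: chart_inv_def f_inv_into_f)

text \<open>The inverse chosen by \<open>inv_into\<close> coincides on the image of the chart with
  the continuous inverse.\<close>

lemma chart_homeo_maps: "homeomorphic_maps (subtopology (topo M) (D i)) (top_of_set (U i)) (\<phi> i) (\<psi> i)"
proof -
  obtain g where g: "homeomorphic_maps (subtopology (topo M) (D i)) (top_of_set (U i)) (\<phi> i) g"
    using chart_homeo homeomorphic_map_maps by blast
  have "\<psi> i x = g x" if "x \<in> U i" for x
  proof -
    have "g x \<in> D i" "\<phi> i (g x) = x"
      using g that topspace_dom by (auto simp: homeomorphic_maps_def continuous_map_def)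
    then show ?thesis using psi_phi by metis
  qed
  then have "continuous_map (top_of_set (U i)) (subtopology (topo M) (D i)) (\<psi> i)"
    using g continuous_map_eq[of "top_of_set (U i)" _ g] by (simp add: homeomorphic_maps_def)
  then show ?thesis
    using g by (simp add: homeomorphic_maps_def phi_psi topspace_dom)
qed

lemma cont_phi: "continuous_map (subtopology (topo M) (D i)) euclidean (\<phi> i)"
  using chart_homeo_maps continuous_map_into_fulltopology by (auto simp: homeomorphic_maps_def)

lemma cont_psi: "continuous_map (top_of_set (U i)) (topo M) (\<psi> i)"
  using chart_homeo_maps continuous_map_into_fulltopology by (auto simp: homeomorphic_maps_def)

lemma openin_chart_preimage:
  assumes "open V" shows "openin (topo M) {p \<in> D i. \<phi> i p \<in> V}"
proof -
  have "openin (subtopology (topo M) (D i)) {p \<in> topspace (subtopology (topo M) (D i)). \<phi> i p \<in> V}"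
    by (rule openin_continuous_map_preimage[OF cont_phi]) (simp add: assms)
  then show ?thesis unfolding topspace_dom by (rule openin_trans_full) (rule openin_dom)
qed

lemma open_psi_preimage:
  assumes "openin (topo M) V" shows "open {x \<in> U i. \<psi> i x \<in> V}"
proof -
  have "openin (top_of_set (U i)) {x \<in> topspace (top_of_set (U i)). \<psi> i x \<in> V}"
    by (rule openin_continuous_map_preimage[OF cont_psi assms])
  then show ?thesis using open_U openin_open_trans by auto
qed

lemma chart_ball:
  assumes "p \<in> D i" "openin (topo M) V" "p \<in> V"
  shows "\<exists>\<delta>>0. \<forall>x. norm (x - \<phi> i p) < \<delta> \<longrightarrow> x \<in> U i \<and> \<psi> i x \<in> V"
proof -
  have "\<phi> i p \<in> {x \<in> U i. \<psi> i x \<in> V}" using assms by simp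
  then obtain \<delta> where "\<delta> > 0" "ball (\<phi> i p) \<delta> \<subseteq> {x \<in> U i. \<psi> i x \<in> V}"
    using open_psi_preimage[OF assms(2)] open_contains_ball by blast
  then show ?thesis by (intro exI[of _ \<delta>]) (auto simp: subset_iff dist_norm norm_minus_commute)
qed

lemma metric_bilinear: "p \<in> D i \<Longrightarrow> bilinear (G i p)"
  and metric_sym: "p \<in> D i \<Longrightarrow> G i p u v = G i p v u"
  and metric_pos: "p \<in> D i \<Longrightarrow> v \<noteq> 0 \<Longrightarrow> 0 < G i p v v"
  and metric_smooth: "smooth_on (U i) (\<lambda>x. G i (\<psi> i x) u v)"
  using riemannian_metric i by (auto simp: riemannian_metric_def)

lemma metric_zero: "p \<in> D i \<Longrightarrow> G i p 0 v = 0" "p \<in> D i \<Longrightarrow> G i p v 0 = 0"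
  using metric_bilinear bilinear_lzero bilinear_rzero by blast+

lemma metric_nonneg: "p \<in> D i \<Longrightarrow> 0 \<le> G i p v v"
  using metric_pos[of p v] metric_zero by (cases "v = 0") auto

lemma chart_norm_nonneg: "p \<in> D i \<Longrightarrow> 0 \<le> N i p v"
  by (simp add: chart_norm_def metric_nonneg)

lemma chart_norm_sq: "p \<in> D i \<Longrightarrow> (N i p v)\<^sup>2 = G i p v v"
  by (simp add: chart_norm_def metric_nonneg)

lemma chart_norm_zero: "p \<in> D i \<Longrightarrow> N i p v = 0 \<longleftrightarrow> v = 0"
  using metric_pos[of p v] metric_zero(1)[of p v] by (cases "v = 0") (auto simp: chart_norm_def)

lemma chart_norm_scale: "p \<in> D i \<Longrightarrow> N i p (t *\<^sub>R v) = \<bar>t\<bar> * N i p v"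
  by (simp add: chart_norm_def bilinear_lmul[OF metric_bilinear] bilinear_rmul[OF metric_bilinear]
      real_sqrt_mult flip: mult.assoc)

lemma metric_Cauchy_Schwarz:
  assumes p: "p \<in> D i" shows "G i p u v \<le> N i p u * N i p v"
proof (cases "v = 0")
  case True then show ?thesis using p by (simp add: metric_zero chart_norm_def)
next
  case False
  note bil = metric_bilinear[OF p]
  define a where "a = G i p v v"
  define b where "b = G i p u v"
  have a: "a > 0" using metric_pos[OF p False] by (simp add: a_def)
  have "0 \<le> G i p (a *\<^sub>R u - b *\<^sub>R v) (a *\<^sub>R u - b *\<^sub>R v)" by (rule metric_nonneg[OF p])
  also have "\<dots> = a * (a * G i p u u - b\<^sup>2)"
    by (simp add: bilinear_lsub[OF bil] bilinear_rsub[OF bil] bilinear_lmul[OF bil] bilinear_rmul[OF bil]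
       metric_sym[OF p, of v u] a_def b_def power2_eq_square algebra_simps)
  finally have "b\<^sup>2 \<le> a * G i p u u" using a by (simp add: zero_le_mult_iff)
  then have "\<bar>b\<bar> \<le> sqrt (a * G i p u u)" by (simp add: real_le_rsqrt)
  then show ?thesis by (simp add: a_def b_def chart_norm_def real_sqrt_mult mult.commute)
qed

lemma chart_norm_triangle:
  assumes p: "p \<in> D i" shows "N i p (u + v) \<le> N i p u + N i p v"
proof -
  note bil = metric_bilinear[OF p]
  have "G i p (u + v) (u + v) = G i p u u + 2 * G i p u v + G i p v v"
    by (simp add: bilinear_ladd[OF bil] bilinear_radd[OF bil] metric_sym[OF p, of v u])
  also have "\<dots> \<le> (N i p u)\<^sup>2 + 2 * (N i p u * N i p v) + (N i p v)\<^sup>2"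
    using metric_Cauchy_Schwarz[OF p, of u v] chart_norm_sq[OF p] by simp
  also have "\<dots> = (N i p u + N i p v)\<^sup>2" by (simp add: power2_eq_square algebra_simps)
  finally have "sqrt (G i p (u + v) (u + v)) \<le> sqrt ((N i p u + N i p v)\<^sup>2)"
    by (rule real_sqrt_le_mono)
  then show ?thesis using chart_norm_nonneg[OF p] by (simp add: chart_norm_def)
qed

lemma chart_norm_diff:
  assumes p: "p \<in> D i" shows "N i p u - N i p v \<le> N i p (u - v)"
  using chart_norm_triangle[OF p, of "u - v" v] by simp

lemma chart_norm_minus: "p \<in> D i \<Longrightarrow> N i p (- v) = N i p v"
  using chart_norm_scale[of p "-1" v] by simp

text \<open>Expanding in a basis reduces the estimate to finitely many coefficient functions, which
  makes it uniform in \<open>v\<close>.\<close>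

lemma metric_close:
  assumes p: "p \<in> D i" and e: "e > 0"
  shows "\<exists>\<delta>>0. \<forall>x. norm (x - \<phi> i p) < \<delta> \<longrightarrow> x \<in> U i \<and>
           (\<forall>v. \<bar>G i (\<psi> i x) v v - G i p v v\<bar> \<le> e * (norm v)\<^sup>2)"
proof -
  let ?n = "dim (UNIV :: 'e set)"
  obtain B0 where B0: "finite B0" "span B0 = (UNIV :: 'e set)" using finite_basis by blast
  obtain b :: "nat \<Rightarrow> 'e" and k :: "nat \<Rightarrow> 'e \<Rightarrow> real" and C :: real where
    "C > 0" "\<forall>i. linear (k i)" "\<forall>i x. \<bar>k i x\<bar> \<le> C * norm x"
    "\<forall>x. x = (\<Sum>i<dim (UNIV :: 'e set). k i x *\<^sub>R b i)"
    "\<forall>c i. i < dim (UNIV :: 'e set) \<longrightarrow> k i (\<Sum>j<dim (UNIV :: 'e set). c j *\<^sub>R b j) = c i"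
    by (rule finite_dim_coordinates[OF B0])
  note C = this(1) and kC = this(3)[rule_format] and kb = this(4)[rule_format]
  have expand: "G i q v v = (\<Sum>a<?n. \<Sum>c<?n. k a v * k c v * G i q (b a) (b c))" if q: "q \<in> D i" for q v
  proof -
    note bil = metric_bilinear[OF q]
    have "G i q v v = G i q (\<Sum>a<?n. k a v *\<^sub>R b a) (\<Sum>c<?n. k c v *\<^sub>R b c)" using kb[of v] by simp
    also have "\<dots> = (\<Sum>(a, c)\<in>{..<?n} \<times> {..<?n}. G i q (k a v *\<^sub>R b a) (k c v *\<^sub>R b c))"
      by (rule bilinear_sum[OF bil]) 
    also have "\<dots> = (\<Sum>a<?n. \<Sum>c<?n. k a v * k c v * G i q (b a) (b c))"
      by (simp add: bilinear_lmul[OF bil] bilinear_rmul[OF bil] sum.cartesian_product mult.assoc mult.left_commute)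
    finally show ?thesis .
  qed
  \<comment> \<open>There are \<open>?n * ?n\<close> terms, each at most \<eta> times
    \<open>(C * norm v)\<^sup>2\<close>; the added 1 keeps the denominator positive in dimension
    0.\<close>
  define \<eta> where "\<eta> = e / (C\<^sup>2 * (real ?n * real ?n + 1))"
  have \<eta>: "\<eta> > 0" using e C by (simp add: \<eta>_def add_nonneg_pos)
  have "\<forall>\<^sub>F x in at (\<phi> i p). \<forall>a<?n. \<forall>c<?n. \<bar>G i (\<psi> i x) (b a) (b c) - G i p (b a) (b c)\<bar> < \<eta>"
  proof -
    have "\<forall>\<^sub>F x in at (\<phi> i p). \<bar>G i (\<psi> i x) u v - G i p u v\<bar> < \<eta>" for u v
    proof -
      have "continuous_on (U i) (\<lambda>x. G i (\<psi> i x) u v)"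
        using metric_smooth[of u v] unfolding smooth_on_def by (metis Ck_on.simps(1))
      then have "isCont (\<lambda>x. G i (\<psi> i x) u v) (\<phi> i p)"
        using open_U p continuous_on_eq_continuous_at by blast
      then have "((\<lambda>x. G i (\<psi> i x) u v) \<longlongrightarrow> G i p u v) (at (\<phi> i p))"
        using p by (simp add: isCont_def)
      from tendstoD[OF this \<eta>] show ?thesis by (simp add: dist_real_def)
    qed
    then have "\<forall>\<^sub>F x in at (\<phi> i p). \<forall>a\<in>{..<?n}. \<forall>c\<in>{..<?n}. \<bar>G i (\<psi> i x) (b a) (b c) - G i p (b a) (b c)\<bar> < \<eta>"
      by (intro eventually_ball_finite ballI finite_lessThan)
    then show ?thesis by (simp add: Ball_def)
  qed
  then obtain \<delta>1 where \<delta>1: "\<delta>1 > 0" "\<And>x a c. \<lbrakk>x \<noteq> \<phi> i p; dist x (\<phi> i p) < \<delta>1; a < ?n; c < ?n\<rbrakk> \<Longrightarrow>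
      \<bar>G i (\<psi> i x) (b a) (b c) - G i p (b a) (b c)\<bar> < \<eta>"
    unfolding eventually_at by blast
  obtain \<delta>2 where \<delta>2: "\<delta>2 > 0" "\<And>x. norm (x - \<phi> i p) < \<delta>2 \<Longrightarrow> x \<in> U i"
    using chart_ball[OF p openin_topspace dom_points[OF p]] by blast
  show ?thesis
  proof (intro exI[of _ "min \<delta>1 \<delta>2"] conjI allI impI)
    show "min \<delta>1 \<delta>2 > 0" using \<delta>1 \<delta>2 by simp
    fix x assume x: "norm (x - \<phi> i p) < min \<delta>1 \<delta>2"
    then show xU: "x \<in> U i" using \<delta>2 by simp
    fix v
    have q: "\<psi> i x \<in> D i" using psi_in[OF xU] .
    have cl: "\<bar>G i (\<psi> i x) (b a) (b c) - G i p (b a) (b c)\<bar> \<le> \<eta>" if "a < ?n" "c < ?n" for a c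
    proof (cases "x = \<phi> i p")
      case True then show ?thesis using p \<eta> by simp
    next
      case False
      have "dist x (\<phi> i p) < \<delta>1" using x by (simp add: dist_norm)
      from \<delta>1(2)[OF False this that] show ?thesis by simp
    qed
    have "\<bar>G i (\<psi> i x) v v - G i p v v\<bar> =
        \<bar>\<Sum>a<?n. \<Sum>c<?n. k a v * k c v * (G i (\<psi> i x) (b a) (b c) - G i p (b a) (b c))\<bar>"
      unfolding expand[OF q] expand[OF p] by (simp add: sum_subtractf right_diff_distrib)
    also have "\<dots> \<le> (\<Sum>a<?n. \<Sum>c<?n. (C * norm v) * (C * norm v) * \<eta>)"
    proof (rule order_trans[OF sum_abs], intro sum_mono, rule order_trans[OF sum_abs], intro sum_mono)
      fix a c assume "a \<in> {..<?n}" "c \<in> {..<?n}"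
      then show "\<bar>k a v * k c v * (G i (\<psi> i x) (b a) (b c) - G i p (b a) (b c))\<bar> \<le> (C * norm v) * (C * norm v) * \<eta>"
        unfolding abs_mult using kC cl C by (intro mult_mono) auto
    qed
    also have "\<dots> = (real ?n * real ?n) * (C\<^sup>2 * \<eta>) * (norm v)\<^sup>2" by (simp add: power2_eq_square)
    also have "\<dots> \<le> (real ?n * real ?n + 1) * (C\<^sup>2 * \<eta>) * (norm v)\<^sup>2"
      using C \<eta> by (intro mult_right_mono) auto
    also have "(real ?n * real ?n + 1) * (C\<^sup>2 * \<eta>) = e"
    proof -
      have "m * (c * (e / (c * m))) = e" if "m \<noteq> 0" "c \<noteq> 0" for m c :: real using that by simp
      moreover have "real ?n * real ?n + 1 \<noteq> 0" using add_nonneg_pos[of "real ?n * real ?n" 1] by simp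
      ultimately show ?thesis using C unfolding \<eta>_def by simp
    qed
    finally show "\<bar>G i (\<psi> i x) v v - G i p v v\<bar> \<le> e * (norm v)\<^sup>2" .
  qed
qed

text \<open>Square roots are taken in \<open>metric_close\<close> with error
  \<open>e\<^sup>2\<close>; subadditivity of the square root gives both inequalities.\<close>

lemma chart_norm_close:
  assumes p: "p \<in> D i" and e: "e > 0"
  shows "\<exists>\<delta>>0. \<forall>x. norm (x - \<phi> i p) < \<delta> \<longrightarrow> x \<in> U i \<and>
           (\<forall>v. N i (\<psi> i x) v \<le> N i p v + e * norm v \<and> N i p v \<le> N i (\<psi> i x) v + e * norm v)"
proof -
  obtain \<delta> where \<delta>: "\<delta> > 0" "\<And>x. norm (x - \<phi> i p) < \<delta> \<Longrightarrow> x \<in> U i \<and>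
           (\<forall>v. \<bar>G i (\<psi> i x) v v - G i p v v\<bar> \<le> e\<^sup>2 * (norm v)\<^sup>2)"
    using metric_close[OF p, of "e\<^sup>2"] e by auto
  have sq: "sqrt a \<le> sqrt b + e * norm v" if "\<bar>a - b\<bar> \<le> e\<^sup>2 * (norm v)\<^sup>2" "a \<ge> 0" "b \<ge> 0" for a b and v :: 'e
  proof -
    have "sqrt a \<le> sqrt (b + (e * norm v)\<^sup>2)" using that by (simp add: power_mult_distrib)
    also have "\<dots> \<le> sqrt b + sqrt ((e * norm v)\<^sup>2)" using that by (intro sqrt_add_le_add_sqrt) auto
    finally show ?thesis using e by simp
  qed
  show ?thesis
    using \<delta> sq metric_nonneg[OF p] metric_nonneg[OF psi_in]
    unfolding chart_norm_def by (intro exI[of _ \<delta>]) (auto simp: abs_minus_commute)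
qed

text \<open>The upper bound comes from a basis expansion, the lower one from the minimum over the
  compact unit sphere.\<close>

lemma chart_norm_bounds:
  assumes p: "p \<in> D i"
  shows "\<exists>c>0. \<exists>C>0. \<forall>v. c * norm v \<le> N i p v \<and> N i p v \<le> C * norm v"
proof -
  let ?n = "dim (UNIV :: 'e set)"
  obtain B0 where B0: "finite B0" "span B0 = (UNIV :: 'e set)" using finite_basis by blast
  obtain b :: "nat \<Rightarrow> 'e" and k :: "nat \<Rightarrow> 'e \<Rightarrow> real" and C :: real where
    "C > 0" "\<forall>i. linear (k i)" "\<forall>i x. \<bar>k i x\<bar> \<le> C * norm x"
    "\<forall>x. x = (\<Sum>i<dim (UNIV :: 'e set). k i x *\<^sub>R b i)"
    "\<forall>c i. i < dim (UNIV :: 'e set) \<longrightarrow> k i (\<Sum>j<dim (UNIV :: 'e set). c j *\<^sub>R b j) = c i"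
    by (rule finite_dim_coordinates[OF B0])
  note C = this(1) and kC = this(3)[rule_format] and kb = this(4)[rule_format]
  define K where "K = C * (\<Sum>a<?n. N i p (b a)) + 1"
  have K: "K > 0" unfolding K_def using C chart_norm_nonneg[OF p]
    by (intro add_nonneg_pos mult_nonneg_nonneg sum_nonneg) auto
  have N_sum: "N i p (\<Sum>a\<in>A. h a) \<le> (\<Sum>a\<in>A. N i p (h a))" if "finite A" for A :: "nat set" and h
    using that
  proof (induction A rule: finite_induct)
    case empty then show ?case using chart_norm_zero[OF p, of 0] by simp
  next
    case (insert x F)
    then show ?case using chart_norm_triangle[OF p, of "h x" "\<Sum>a\<in>F. h a"] by simp
  qed
  have upper: "N i p v \<le> K * norm v" for v
  proof -
    have "N i p v = N i p (\<Sum>a<?n. k a v *\<^sub>R b a)" using kb[of v] by simp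
    also have "\<dots> \<le> (\<Sum>a<?n. N i p (k a v *\<^sub>R b a))" by (rule N_sum) simp
    also have "\<dots> \<le> (\<Sum>a<?n. (C * norm v) * N i p (b a))"
      using kC chart_norm_nonneg[OF p] by (intro sum_mono) (auto simp: chart_norm_scale[OF p] intro: mult_right_mono)
    also have "\<dots> = (C * (\<Sum>a<?n. N i p (b a))) * norm v" by (simp add: sum_distrib_left mult_ac)
    also have "\<dots> \<le> K * norm v" unfolding K_def by (intro mult_right_mono) auto
    finally show ?thesis .
  qed
  have cont: "continuous_on UNIV (N i p)"
  proof (rule continuous_on_real_range[THEN iffD2], intro ballI allI impI)
    fix x :: 'e and e :: real assume e: "e > 0"
    have "\<bar>N i p y - N i p x\<bar> < e" if "norm (y - x) < e / K" for y
    proof -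
      have "\<bar>N i p y - N i p x\<bar> \<le> N i p (y - x)"
        using chart_norm_diff[OF p, of y x] chart_norm_diff[OF p, of x y] chart_norm_minus[OF p, of "y - x"] by simp
      also have "\<dots> \<le> K * norm (y - x)" by (rule upper)
      also have "\<dots> < e" using that K by (simp add: pos_less_divide_eq mult.commute)
      finally show ?thesis .
    qed
    then show "\<exists>d>0. \<forall>x'\<in>UNIV. norm (x' - x) < d \<longrightarrow> \<bar>N i p x' - N i p x\<bar> < e"
      using e K by (intro exI[of _ "e / K"]) auto
  qed
  have "\<exists>c>0. \<forall>v. c * norm v \<le> N i p v"
  proof (cases "\<exists>v::'e. norm v = 1")
    \<comment> \<open>In dimension 0 the unit sphere is empty and has no minimum, but all vectors
      vanish.\<close>
    case False
    have "v = 0" for v :: 'e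
    proof (rule ccontr)
      assume "v \<noteq> 0"
      then have "norm ((1 / norm v) *\<^sub>R v) = 1" by simp
      with False show False by blast
    qed
    then have "norm v = 0" for v :: 'e by simp
    then have "1 * norm v \<le> N i p v" for v
      using chart_norm_nonneg[OF p, of v] by (metis mult_zero_right)
    then show ?thesis using zero_less_one by blast
  next
    case True
    have "compact (sphere (0::'e) 1)"
    proof -
      have "compact (cball (0::'e) 1 \<inter> {v. norm v = 1})"
        by (intro compact_Int_closed finite_dim_compact_cball[OF B0] closed_Collect_eq continuous_intros)
      moreover have "sphere (0::'e) 1 = cball 0 1 \<inter> {v. norm v = 1}" by auto
      ultimately show ?thesis by simp
    qed
    moreover have "sphere (0::'e) 1 \<noteq> {}" using True by auto
    ultimately obtain w where w: "w \<in> sphere (0::'e) 1" "\<And>v. v \<in> sphere 0 1 \<Longrightarrow> N i p w \<le> N i p v"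
      using continuous_attains_inf[of "sphere (0::'e) 1" "N i p"] cont continuous_on_subset by blast
    have "w \<noteq> 0" using w(1) by auto
    then have pos: "N i p w > 0" using chart_norm_nonneg[OF p, of w] chart_norm_zero[OF p, of w] by linarith
    have "N i p w * norm v \<le> N i p v" for v
    proof (cases "v = 0")
      case True then show ?thesis using chart_norm_nonneg[OF p] by simp
    next
      case False
      then have "N i p w \<le> N i p ((1 / norm v) *\<^sub>R v)" by (intro w(2)) simp
      then show ?thesis using False by (simp add: chart_norm_scale[OF p] field_simps)
    qed
    with pos show ?thesis by blast
  qed
  with upper K show ?thesis by blast
qed

end
end

section \<open>Short maps of compact Riemannian manifolds\<close>

definition pointwise_short :: "('a, 'e::real_normed_vector, 'i) riemannian \<Rightarrow> 'i \<Rightarrow> 'a \<Rightarrow> ('a \<Rightarrow> real) \<Rightarrow> bool" where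
  "pointwise_short M i p u \<longleftrightarrow> (\<forall>e>0. \<exists>\<delta>>0. \<forall>x. norm (x - chart_coord M i p) < \<delta> \<longrightarrow>
     \<bar>u (chart_inv M i x) - u p\<bar> \<le> chart_norm M i p (x - chart_coord M i p) + e * norm (x - chart_coord M i p))"

text \<open>Values in the unit interval keep the supremum in \<open>test_dist\<close> finite. One
  chart at each point suffices, since \<open>pointwise_short_chart\<close> gives independence of the
  chart.\<close>

definition test_function :: "('a, 'e::real_normed_vector, 'i) riemannian \<Rightarrow> ('a \<Rightarrow> real) \<Rightarrow> bool" where
  "test_function M u \<longleftrightarrow> (\<forall>p\<in>points M. 0 \<le> u p \<and> u p \<le> 1 \<and> (\<exists>i\<in>charts M. p \<in> chart_dom M i \<and> pointwise_short M i p u))"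

text \<open>Taking the supremum over functions of pointwise Lipschitz constant at most 1 gives a truncated
  version of the Riemannian distance without integrating along curves.\<close>

definition test_dist :: "('a, 'e::real_normed_vector, 'i) riemannian \<Rightarrow> 'a \<Rightarrow> 'a \<Rightarrow> real" where
  "test_dist M p q = Sup ((\<lambda>u. \<bar>u p - u q\<bar>) ` Collect (test_function M))"

definition short_at ::
    "('a, 'e::real_normed_vector, 'i) riemannian \<Rightarrow> ('b, 'f::real_normed_vector, 'j) riemannian \<Rightarrow>
      'i \<Rightarrow> 'j \<Rightarrow> ('a \<Rightarrow> 'b) \<Rightarrow> ('e \<Rightarrow> 'f) \<Rightarrow> 'a \<Rightarrow> bool" where
  "short_at M M' i j g A p \<longleftrightarrow> i \<in> charts M \<and> p \<in> chart_dom M i \<and> j \<in> charts M' \<and> g p \<in> chart_dom M' j \<and>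
     (local_expr M M' i j g has_derivative A) (at (chart_coord M i p)) \<and>
     (\<forall>v. chart_norm M' j (g p) (A v) \<le> chart_norm M i p v)"

locale two_riemannian = src: riemannian M + tgt: riemannian M'
  for M :: "('a, 'e::real_normed_vector, 'i) riemannian" and M' :: "('b, 'f::real_normed_vector, 'j) riemannian"
begin

lemma local_expansion:
  assumes i: "i \<in> charts M" "p \<in> chart_dom M i" and j: "j \<in> charts M'" "g p \<in> chart_dom M' j"
    and g: "continuous_map (topo M) (topo M') g"
    and A: "(local_expr M M' i j g has_derivative A) (at (chart_coord M i p))" and e: "e > 0"
  shows "\<exists>\<delta>>0. \<forall>x. norm (x - chart_coord M i p) < \<delta> \<longrightarrow>
     g (chart_inv M i x) = chart_inv M' j (local_expr M M' i j g x) \<and>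
     norm (local_expr M M' i j g x - chart_coord M' j (g p) - A (x - chart_coord M i p))
       \<le> e * norm (x - chart_coord M i p)"
proof -
  let ?x0 = "chart_coord M i p" and ?L = "local_expr M M' i j g"
  have L0: "?L ?x0 = chart_coord M' j (g p)" using i by (simp add: local_expr_def src.psi_phi)
  have V: "openin (topo M) {q \<in> topspace (topo M). g q \<in> chart_dom M' j}"
    by (rule openin_continuous_map_preimage[OF g tgt.openin_dom[OF j(1)]])
  then obtain \<delta>1 where \<delta>1: "\<delta>1 > 0" "\<And>x. norm (x - ?x0) < \<delta>1 \<Longrightarrow> g (chart_inv M i x) \<in> chart_dom M' j"
    using src.chart_ball[OF i V] j(2) src.dom_points[OF i] by auto
  obtain \<delta>2 where \<delta>2: "\<delta>2 > 0" "\<And>x. norm (x - ?x0) < \<delta>2 \<Longrightarrow>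
      norm (?L x - ?L ?x0 - A (x - ?x0)) \<le> e * norm (x - ?x0)"
    using A e unfolding has_derivative_at_alt by blast
  show ?thesis
    using \<delta>1 \<delta>2 L0 tgt.psi_phi[OF j(1)]
    by (intro exI[of _ "min \<delta>1 \<delta>2"]) (auto simp: local_expr_def)
qed

text \<open>Chain rule for slopes: the linear part is no longer than its argument, and the remainder
  and the slack of \<open>u\<close> are absorbed by \<open>e\<close>.\<close>

lemma pointwise_short_pull:
  assumes s: "short_at M M' i j g A p" and g: "continuous_map (topo M) (topo M') g"
    and u: "pointwise_short M' j (g p) u"
  shows "pointwise_short M i p (u \<circ> g)"
  unfolding pointwise_short_def
proof (intro allI impI)
  fix e :: real assume e: "e > 0"
  have i: "i \<in> charts M" "p \<in> chart_dom M i" and j: "j \<in> charts M'" "g p \<in> chart_dom M' j"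
    and A: "(local_expr M M' i j g has_derivative A) (at (chart_coord M i p))"
    and le: "\<And>v. chart_norm M' j (g p) (A v) \<le> chart_norm M i p v"
    using s by (auto simp: short_at_def)
  let ?x0 = "chart_coord M i p" and ?L = "local_expr M M' i j g" and ?y0 = "chart_coord M' j (g p)"
  obtain C where C: "C > 0" "\<And>v. chart_norm M' j (g p) v \<le> C * norm v"
    using tgt.chart_norm_bounds[OF j] by blast
  obtain K where K: "K > 0" "\<And>v. norm (A v) \<le> norm v * K"
    using bounded_linear.pos_bounded[OF has_derivative_bounded_linear[OF A]] by blast
  \<comment> \<open>\<open>e3\<close> pays for the remainder of the expansion, measured in the
    target norm with constant \<open>C\<close>, and \<open>e2\<close> for the slack of
    \<open>u\<close> over a displacement at most \<open>K + 1\<close> times as long. Each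
    contributes at most half of \<open>e\<close>.\<close>
  define e3 where "e3 = min 1 (e / (2 * C))"
  define e2 where "e2 = e / (2 * (K + 1))"
  have e3: "e3 > 0" "e3 \<le> 1" "C * e3 \<le> e / 2" and e2: "e2 > 0" "e2 * (K + 1) = e / 2"
    using e C K by (auto simp: e3_def e2_def min_def field_simps)
  obtain \<delta>' where \<delta>': "\<delta>' > 0" "\<And>y. norm (y - ?y0) < \<delta>' \<Longrightarrow>
      \<bar>u (chart_inv M' j y) - u (g p)\<bar> \<le> chart_norm M' j (g p) (y - ?y0) + e2 * norm (y - ?y0)"
    using u e2(1) unfolding pointwise_short_def by blast
  obtain \<delta> where \<delta>: "\<delta> > 0" "\<And>x. norm (x - ?x0) < \<delta> \<Longrightarrow> g (chart_inv M i x) = chart_inv M' j (?L x) \<and>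
     norm (?L x - ?y0 - A (x - ?x0)) \<le> e3 * norm (x - ?x0)"
    using local_expansion[OF i j g A e3(1)] by blast
  show "\<exists>\<delta>>0. \<forall>x. norm (x - ?x0) < \<delta> \<longrightarrow>
      \<bar>(u \<circ> g) (chart_inv M i x) - (u \<circ> g) p\<bar> \<le> chart_norm M i p (x - ?x0) + e * norm (x - ?x0)"
  proof (intro exI[of _ "min \<delta> (\<delta>' / (K + 1))"] conjI allI impI)
    show "0 < min \<delta> (\<delta>' / (K + 1))" using \<delta> \<delta>' K by simp
    fix x assume x: "norm (x - ?x0) < min \<delta> (\<delta>' / (K + 1))"
    define h where "h = x - ?x0"
    define r where "r = ?L x - ?y0 - A h"
    have gx: "g (chart_inv M i x) = chart_inv M' j (?L x)" and r: "norm r \<le> e3 * norm h"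
      using \<delta>(2)[of x] x by (auto simp: h_def r_def)
    have y: "?L x - ?y0 = A h + r" by (simp add: r_def)
    have "norm (A h + r) \<le> norm h * K + e3 * norm h"
      using norm_triangle_ineq[of "A h" r] K(2)[of h] r by linarith
    also have "\<dots> \<le> norm h * K + 1 * norm h"
      using e3(2) by (intro add_left_mono mult_right_mono) auto
    finally have ny: "norm (?L x - ?y0) \<le> (K + 1) * norm h" by (simp add: y algebra_simps)
    also have "\<dots> < \<delta>'" using x K by (simp add: h_def pos_less_divide_eq mult.commute)
    finally have "\<bar>u (chart_inv M' j (?L x)) - u (g p)\<bar> \<le> chart_norm M' j (g p) (?L x - ?y0) + e2 * norm (?L x - ?y0)"
      by (rule \<delta>'(2))
    also have "e2 * norm (?L x - ?y0) \<le> e2 * ((K + 1) * norm h)"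
      using ny e2(1) by (intro mult_left_mono) auto
    also have "e2 * ((K + 1) * norm h) = e / 2 * norm h"
      unfolding mult.assoc[symmetric] e2(2) ..
    also have "chart_norm M' j (g p) (?L x - ?y0) \<le> chart_norm M' j (g p) (A h) + chart_norm M' j (g p) r"
      unfolding y by (rule tgt.chart_norm_triangle[OF j])
    also have "chart_norm M' j (g p) (A h) \<le> chart_norm M i p h" by (rule le)
    also have "chart_norm M' j (g p) r \<le> C * (e3 * norm h)"
      using C(2)[of r] mult_left_mono[OF r, of C] C(1) by linarith
    also have "C * (e3 * norm h) \<le> e / 2 * norm h"
      using mult_right_mono[OF e3(3), of "norm h"] by (simp add: mult.assoc)
    finally have "\<bar>u (chart_inv M' j (?L x)) - u (g p)\<bar> \<le> chart_norm M i p h + e / 2 * norm h + e / 2 * norm h"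
      by simp
    then show "\<bar>(u \<circ> g) (chart_inv M i x) - (u \<circ> g) p\<bar> \<le> chart_norm M i p (x - ?x0) + e * norm (x - ?x0)"
      by (simp add: gx h_def)
  qed
qed

lemma test_function_pull:
  assumes g: "continuous_map (topo M) (topo M') g"
    and s: "\<And>p j. p \<in> points M \<Longrightarrow> j \<in> charts M' \<Longrightarrow> g p \<in> chart_dom M' j \<Longrightarrow> \<exists>i A. short_at M M' i j g A p"
    and u: "test_function M' u"
  shows "test_function M (u \<circ> g)"
  unfolding test_function_def
proof
  fix p assume p: "p \<in> points M"
  have gp: "g p \<in> points M'" using g p by (auto simp: continuous_map_def)
  then obtain j where j: "j \<in> charts M'" "g p \<in> chart_dom M' j" "pointwise_short M' j (g p) u"
    using u by (auto simp: test_function_def)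
  obtain i A where iA: "short_at M M' i j g A p" using s[OF p j(1,2)] by blast
  have "pointwise_short M i p (u \<circ> g)" using pointwise_short_pull[OF iA g j(3)] .
  moreover have "i \<in> charts M" "p \<in> chart_dom M i" using iA by (auto simp: short_at_def)
  ultimately show "0 \<le> (u \<circ> g) p \<and> (u \<circ> g) p \<le> 1 \<and> (\<exists>i\<in>charts M. p \<in> chart_dom M i \<and> pointwise_short M i p (u \<circ> g))"
    using u gp by (auto simp: test_function_def)
qed

end

context riemannian
begin

text \<open>The identity read in two charts preserves the metric, so the claim is a pullback along
  the identity.\<close>

lemma pointwise_short_chart:
  assumes i: "i \<in> charts M" "p \<in> D i" and j: "j \<in> charts M" "p \<in> D j" and u: "pointwise_short M j p u"
  shows "pointwise_short M i p u"
proof -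
  interpret two_riemannian M M by unfold_locales
  have sm: "smooth_on (\<phi> i ` (D i \<inter> D j)) (local_expr M M i j (\<lambda>p. p))"
    using smooth_atlas i j by (auto simp: smooth_atlas_def)
  then have "local_expr M M i j (\<lambda>p. p) differentiable (at (\<phi> i p))"
    unfolding smooth_on_def using i j by (metis Ck_on.simps(2) IntI imageI)
  then have A: "(local_expr M M i j (\<lambda>p. p) has_derivative local_deriv M M i j (\<lambda>p. p) p) (at (\<phi> i p))"
    unfolding local_deriv_def using frechet_derivative_works by blast
  have "metric_preserving M M (\<lambda>p. p)" using riemannian_metric by (simp add: riemannian_metric_def)
  then have "short_at M M i j (\<lambda>p. p) (local_deriv M M i j (\<lambda>p. p) p) p"
    using i j A by (auto simp: short_at_def metric_preserving_def chart_norm_def)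
  from pointwise_short_pull[OF this continuous_map_id[unfolded id_def] u] show ?thesis by (simp add: o_def)
qed

lemma test_function_pointwise_short: "\<lbrakk>test_function M u; i \<in> charts M; p \<in> D i\<rbrakk> \<Longrightarrow> pointwise_short M i p u"
  using pointwise_short_chart dom_points unfolding test_function_def by meson

text \<open>The slope bound is added up along the straight coordinate segment from \<open>p\<close>
  to \<open>x\<close>, where the norm changes little. The radius does not depend on the test
  function, which makes the bound pass to the supremum.\<close>

lemma test_function_upper:
  assumes i: "i \<in> charts M" "p \<in> D i" and e: "e > 0"
  shows "\<exists>\<delta>>0. \<forall>x. norm (x - \<phi> i p) < \<delta> \<longrightarrow> x \<in> U i \<and>
     (\<forall>u. test_function M u \<longrightarrow> \<bar>u (\<psi> i x) - u p\<bar> \<le> N i p (x - \<phi> i p) + e * norm (x - \<phi> i p))"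
proof -
  obtain \<delta> where \<delta>: "\<delta> > 0" "\<And>x. norm (x - \<phi> i p) < \<delta> \<Longrightarrow> x \<in> U i \<and>
           (\<forall>v. N i (\<psi> i x) v \<le> N i p v + e/2 * norm v \<and> N i p v \<le> N i (\<psi> i x) v + e/2 * norm v)"
    using chart_norm_close[OF i, of "e/2"] e by auto
  have "\<bar>u (\<psi> i x) - u p\<bar> \<le> N i p (x - \<phi> i p) + e * norm (x - \<phi> i p)"
    if x: "norm (x - \<phi> i p) < \<delta>" and u: "test_function M u" for x u
  proof -
    define h where "h = x - \<phi> i p"
    define y where "y = (\<lambda>t::real. \<phi> i p + t *\<^sub>R h)"
    define s where "s = (\<lambda>t. u (\<psi> i (y t)))"
    define L where "L = N i p h + e * norm h"
    \<comment> \<open>Bisection instead of integration: the increment bound is additive over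
      adjacent intervals and holds on short intervals around each time \<open>t\<close>. The
      premises on the endpoints confine the principle to the unit interval.\<close>
    have "0 \<le> (0::real) \<and> (1::real) \<le> 1 \<longrightarrow> \<bar>s 1 - s 0\<bar> \<le> L * (1 - 0)"
    proof (rule Bolzano[of 0 1 "\<lambda>a b. 0 \<le> a \<and> b \<le> 1 \<longrightarrow> \<bar>s b - s a\<bar> \<le> L * (b - a)"])
      fix a b c :: real
      assume *: "0 \<le> a \<and> b \<le> 1 \<longrightarrow> \<bar>s b - s a\<bar> \<le> L * (b - a)" "0 \<le> b \<and> c \<le> 1 \<longrightarrow> \<bar>s c - s b\<bar> \<le> L * (c - b)"
        "a \<le> b" "b \<le> c"
      show "0 \<le> a \<and> c \<le> 1 \<longrightarrow> \<bar>s c - s a\<bar> \<le> L * (c - a)"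
      proof
        assume "0 \<le> a \<and> c \<le> 1"
        with * have "\<bar>s b - s a\<bar> \<le> L * (b - a)" "\<bar>s c - s b\<bar> \<le> L * (c - b)" by auto
        then show "\<bar>s c - s a\<bar> \<le> L * (c - a)" by (simp add: right_diff_distrib)
      qed
    next
      fix t :: real assume t: "0 \<le> t" "t \<le> 1"
      have "norm (y t - \<phi> i p) \<le> norm h" using t by (simp add: y_def mult_left_le_one_le)
      then have yt: "norm (y t - \<phi> i p) < \<delta>" using x by (simp add: h_def)
      let ?q = "\<psi> i (y t)"
      have yU: "y t \<in> U i" using \<delta>(2)[OF yt] by blast
      have q: "?q \<in> D i" "\<phi> i ?q = y t" using psi_in[OF i(1) yU] phi_psi[OF i(1) yU] by auto
      obtain \<eta> where \<eta>: "\<eta> > 0" "\<And>x'. norm (x' - y t) < \<eta> \<Longrightarrow>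
          \<bar>u (\<psi> i x') - u ?q\<bar> \<le> N i ?q (x' - y t) + e/2 * norm (x' - y t)"
        using test_function_pointwise_short[OF u i(1) q(1)] e unfolding pointwise_short_def q(2) by (metis half_gt_zero)
      have loc: "\<bar>s t' - s t\<bar> \<le> L * \<bar>t' - t\<bar>" if t': "\<bar>t' - t\<bar> < \<eta> / (norm h + 1)" for t'
      proof -
        have d: "y t' - y t = (t' - t) *\<^sub>R h" by (simp add: y_def algebra_simps)
        have "norm (y t' - y t) \<le> \<bar>t' - t\<bar> * (norm h + 1)" unfolding d by (simp add: mult_left_mono)
        also have "\<dots> < \<eta>" using t' by (simp add: pos_less_divide_eq add_nonneg_pos)
        finally have "\<bar>s t' - s t\<bar> \<le> N i ?q (y t' - y t) + e/2 * norm (y t' - y t)"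
          unfolding s_def by (rule \<eta>(2))
        also have "\<dots> = \<bar>t' - t\<bar> * (N i ?q h + e/2 * norm h)"
          unfolding d chart_norm_scale[OF i(1) q(1)] by (simp add: distrib_left)
        also have "\<dots> \<le> \<bar>t' - t\<bar> * L"
          using \<delta>(2)[OF yt] by (intro mult_left_mono) (auto simp: L_def field_simps dest!: spec[of _ h])
        finally show ?thesis by (simp add: mult.commute)
      qed
      show "\<exists>d>0. \<forall>a b. a \<le> t \<and> t \<le> b \<and> b - a < d \<longrightarrow> 0 \<le> a \<and> b \<le> 1 \<longrightarrow> \<bar>s b - s a\<bar> \<le> L * (b - a)"
      proof (intro exI[of _ "\<eta> / (norm h + 1)"] conjI allI impI)
        show "0 < \<eta> / (norm h + 1)" using \<eta>(1) by (simp add: add_nonneg_pos)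
        fix a b assume ab: "a \<le> t \<and> t \<le> b \<and> b - a < \<eta> / (norm h + 1)"
        have "\<bar>s a - s t\<bar> \<le> L * (t - a)" "\<bar>s b - s t\<bar> \<le> L * (b - t)"
          using loc[of a] loc[of b] ab by auto
        then show "\<bar>s b - s a\<bar> \<le> L * (b - a)" by (simp add: right_diff_distrib)
      qed
    qed simp
    then have "\<bar>s 1 - s 0\<bar> \<le> L" by simp
    then show ?thesis using psi_phi[OF i] by (simp add: s_def y_def L_def h_def)
  qed
  with \<delta> show ?thesis by blast
qed

text \<open>The witness is a cone with apex over \<open>p\<close>, of slope \<open>1 - e\<close> in
  the norm at \<open>p\<close>, cut off at height 0 and extended by 0. The factor leaves room for
  the change of the metric near \<open>p\<close>.\<close>

lemma test_function_lower:
  assumes i: "i \<in> charts M" "p \<in> D i" and e: "0 < e" "e < 1"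
  shows "\<exists>\<delta>>0. \<forall>x. norm (x - \<phi> i p) < \<delta> \<longrightarrow>
     (\<exists>u. test_function M u \<and> (1 - e) * N i p (x - \<phi> i p) \<le> u p - u (\<psi> i x))"
proof -
  let ?x0 = "\<phi> i p"
  obtain c C where c: "c > 0" "\<And>v. c * norm v \<le> N i p v" and C: "C > 0" "\<And>v. N i p v \<le> C * norm v"
    using chart_norm_bounds[OF i] by blast
  \<comment> \<open>An error \<open>e * c * norm v\<close> is at most the fraction \<open>e\<close>
    of the norm of \<open>v\<close> at \<open>p\<close>, by the choice of \<open>c\<close>.\<close>
  obtain \<delta>0 where \<delta>0: "\<delta>0 > 0" "\<And>x. norm (x - ?x0) < \<delta>0 \<Longrightarrow> x \<in> U i \<and>
           (\<forall>v. N i (\<psi> i x) v \<le> N i p v + e * c * norm v \<and> N i p v \<le> N i (\<psi> i x) v + e * c * norm v)"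
    using chart_norm_close[OF i, of "e * c"] e c by auto
  have cmp: "(1 - e) * N i p v \<le> N i (\<psi> i x) v" if "norm (x - ?x0) < \<delta>0" for x v
  proof -
    have "N i p v \<le> N i (\<psi> i x) v + e * (c * norm v)" using \<delta>0(2)[OF that] by (simp add: mult.assoc)
    also have "\<dots> \<le> N i (\<psi> i x) v + e * N i p v" using c(2) e by (intro add_left_mono mult_left_mono) auto
    finally show ?thesis by (simp add: algebra_simps)
  qed
  \<comment> \<open>The height is at most 1, as a test function demands, and low enough for the cone
    to vanish outside the ball of radius \<open>\<delta>0 / 2\<close>.\<close>
  define R where "R = min 1 ((1 - e) * c * \<delta>0 / 2)"
  have R: "R > 0" "R \<le> 1" "R \<le> (1 - e) * c * \<delta>0 / 2" using e c \<delta>0 by (auto simp: R_def)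
  define b where "b = (\<lambda>x. max 0 (R - (1 - e) * N i p (x - ?x0)))"
  define u where "u = (\<lambda>q. if q \<in> D i \<and> norm (\<phi> i q - ?x0) < \<delta>0 then b (\<phi> i q) else 0)"
  have b0: "b x = 0" if "norm (x - ?x0) \<ge> \<delta>0 / 2" for x
  proof -
    have "R \<le> (1 - e) * (c * (\<delta>0 / 2))" using R(3) by (simp add: algebra_simps)
    also have "\<dots> \<le> (1 - e) * (c * norm (x - ?x0))" using that e c by (intro mult_left_mono) auto
    also have "\<dots> \<le> (1 - e) * N i p (x - ?x0)" using c(2) e by (intro mult_left_mono) auto
    finally show ?thesis by (simp add: b_def)
  qed
  have b_lip: "\<bar>b x - b y\<bar> \<le> (1 - e) * N i p (x - y)" for x y
  proof -
    have "\<bar>b x - b y\<bar> \<le> \<bar>(1 - e) * (N i p (y - ?x0) - N i p (x - ?x0))\<bar>"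
      by (simp add: b_def max_def abs_if right_diff_distrib)
    also have "\<dots> = (1 - e) * \<bar>N i p (y - ?x0) - N i p (x - ?x0)\<bar>" using e by (simp add: abs_mult)
    also have "\<bar>N i p (y - ?x0) - N i p (x - ?x0)\<bar> \<le> N i p (x - y)"
      using chart_norm_diff[OF i, of "y - ?x0" "x - ?x0"] chart_norm_diff[OF i, of "x - ?x0" "y - ?x0"]
        chart_norm_minus[OF i, of "x - y"] by simp
    finally show ?thesis using e by (simp add: mult_left_mono)
  qed
  have u01: "0 \<le> u q \<and> u q \<le> 1" for q
    using R chart_norm_nonneg[OF i] e by (auto simp: u_def b_def max_def) (smt (verit) mult_nonneg_nonneg)
  have tf: "test_function M u"
    unfolding test_function_def
  proof (intro ballI conjI)
    fix q assume q: "q \<in> points M"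
    show "0 \<le> u q" "u q \<le> 1" using u01 by auto
    show "\<exists>j\<in>charts M. q \<in> D j \<and> pointwise_short M j q u"
    proof (cases "q \<in> D i \<and> norm (\<phi> i q - ?x0) < \<delta>0")
      case True
      then have qi: "q \<in> D i" and qd: "norm (\<phi> i q - ?x0) < \<delta>0" by auto
      have "pointwise_short M i q u"
        unfolding pointwise_short_def
      proof (intro allI impI)
        fix \<epsilon> :: real assume "\<epsilon> > 0"
        show "\<exists>\<delta>>0. \<forall>x. norm (x - \<phi> i q) < \<delta> \<longrightarrow>
            \<bar>u (\<psi> i x) - u q\<bar> \<le> N i q (x - \<phi> i q) + \<epsilon> * norm (x - \<phi> i q)"
        proof (intro exI[of _ "\<delta>0 - norm (\<phi> i q - ?x0)"] conjI allI impI)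
          show "0 < \<delta>0 - norm (\<phi> i q - ?x0)" using qd by simp
          fix x assume x: "norm (x - \<phi> i q) < \<delta>0 - norm (\<phi> i q - ?x0)"
          have "norm (x - ?x0) < \<delta>0"
            using norm_triangle_ineq[of "x - \<phi> i q" "\<phi> i q - ?x0"] x by simp
          then have "x \<in> U i" "u (\<psi> i x) = b x"
            using \<delta>0(2) psi_in[OF i(1)] phi_psi[OF i(1)] by (auto simp: u_def)
          then have "\<bar>u (\<psi> i x) - u q\<bar> = \<bar>b x - b (\<phi> i q)\<bar>" using True by (simp add: u_def)
          also have "\<dots> \<le> (1 - e) * N i p (x - \<phi> i q)" by (rule b_lip)
          also have "\<dots> \<le> N i (\<psi> i (\<phi> i q)) (x - \<phi> i q)" by (rule cmp[OF qd])
          also have "\<psi> i (\<phi> i q) = q" using psi_phi[OF i(1) qi] .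
          finally show "\<bar>u (\<psi> i x) - u q\<bar> \<le> N i q (x - \<phi> i q) + \<epsilon> * norm (x - \<phi> i q)"
            using \<open>\<epsilon> > 0\<close> by (smt (verit) mult_nonneg_nonneg norm_ge_zero)
        qed
      qed
      then show ?thesis using i(1) qi by blast
    next
      case False
      \<comment> \<open>\<open>u\<close> vanishes off the compact set \<open>K\<close>, which does
        not contain \<open>q\<close>; so \<open>u\<close> is zero on an open neighbourhood of
        \<open>q\<close>, and any chart there will do.\<close>
      define K where "K = \<psi> i ` cball ?x0 (\<delta>0 / 2)"
      obtain B0 where B0: "finite B0" "span B0 = (UNIV :: 'e set)" using finite_basis by blast
      have cU: "cball ?x0 (\<delta>0 / 2) \<subseteq> U i"
      proof
        fix x assume "x \<in> cball ?x0 (\<delta>0 / 2)"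
        then have "norm (x - ?x0) < \<delta>0" using \<delta>0(1) by (simp add: dist_norm norm_minus_commute)
        then show "x \<in> U i" using \<delta>0(2) by blast
      qed
      have "compactin (top_of_set (U i)) (cball ?x0 (\<delta>0 / 2))"
        using finite_dim_compact_cball[OF B0] cU by (simp add: compactin_subtopology)
      from image_compactin[OF this cont_psi[OF i(1)]] have "closedin (topo M) K"
        unfolding K_def using Hausdorff compactin_imp_closedin by blast
      then have opK: "openin (topo M) (points M - K)" by blast
      have u0: "u q' = 0" if "q' \<notin> K" for q'
      proof (cases "q' \<in> D i")
        case True
        then have "\<phi> i q' \<notin> cball ?x0 (\<delta>0 / 2)"
          using that psi_phi[OF i(1) True] unfolding K_def by (metis imageI)
        then have "b (\<phi> i q') = 0" by (intro b0) (simp add: dist_norm norm_minus_commute)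
        then show ?thesis by (simp add: u_def)
      qed (simp add: u_def)
      have qK: "q \<notin> K"
      proof
        assume "q \<in> K"
        then obtain x where "x \<in> cball ?x0 (\<delta>0 / 2)" "q = \<psi> i x" by (auto simp: K_def)
        then show False
          using False cU psi_in[OF i(1)] phi_psi[OF i(1)] \<delta>0(1) by (auto simp: dist_norm norm_minus_commute subset_iff)
      qed
      obtain j where j: "j \<in> charts M" "q \<in> D j" using chart_cover[OF q] by blast
      obtain \<delta> where \<delta>: "\<delta> > 0" "\<And>x. norm (x - \<phi> j q) < \<delta> \<Longrightarrow> \<psi> j x \<in> points M - K"
        using chart_ball[OF j opK] q qK by blast
      have "pointwise_short M j q u"
        unfolding pointwise_short_def
      proof (intro allI impI)
        fix \<epsilon> :: real assume "\<epsilon> > 0"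
        then show "\<exists>\<delta>>0. \<forall>x. norm (x - \<phi> j q) < \<delta> \<longrightarrow>
            \<bar>u (\<psi> j x) - u q\<bar> \<le> N j q (x - \<phi> j q) + \<epsilon> * norm (x - \<phi> j q)"
          using \<delta> u0 qK chart_norm_nonneg[OF j] by (intro exI[of _ \<delta>]) auto
      qed
      then show ?thesis using j by blast
    qed
  qed
  define \<delta> where "\<delta> = min \<delta>0 (R / C)"
  show ?thesis
  proof (intro exI[of _ \<delta>] conjI allI impI)
    show "\<delta> > 0" using \<delta>0 R C by (simp add: \<delta>_def)
    fix x assume x: "norm (x - ?x0) < \<delta>"
    then have x0: "norm (x - ?x0) < \<delta>0" by (simp add: \<delta>_def)
    have "u (\<psi> i x) = b x" using x0 \<delta>0(2) psi_in[OF i(1)] phi_psi[OF i(1)] by (auto simp: u_def)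
    moreover have "u p = R" using i \<delta>0(1) R chart_norm_zero[OF i, of 0] by (simp add: u_def b_def)
    moreover have "(1 - e) * N i p (x - ?x0) \<le> R"
    proof -
      have "(1 - e) * N i p (x - ?x0) \<le> 1 * N i p (x - ?x0)"
        using e chart_norm_nonneg[OF i] by (intro mult_right_mono) auto
      also have "\<dots> \<le> C * norm (x - ?x0)" using C(2) by simp
      also have "\<dots> \<le> R" using x C(1) by (simp add: \<delta>_def pos_less_divide_eq mult.commute)
      finally show ?thesis .
    qed
    ultimately show "\<exists>u. test_function M u \<and> (1 - e) * N i p (x - ?x0) \<le> u p - u (\<psi> i x)"
      using tf by (intro exI[of _ u]) (simp add: b_def)
  qed
qed

lemma test_function_const: "test_function M (\<lambda>p. 0)"
  unfolding test_function_def
proof (intro ballI)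
  fix p assume "p \<in> points M"
  then obtain i where i: "i \<in> charts M" "p \<in> D i" using chart_cover by blast
  then have "pointwise_short M i p (\<lambda>p. 0)"
    using chart_norm_nonneg[OF i] by (auto simp: pointwise_short_def intro!: exI[of _ 1])
  with i show "0 \<le> (0::real) \<and> 0 \<le> (1::real) \<and> (\<exists>i\<in>charts M. p \<in> D i \<and> pointwise_short M i p (\<lambda>p. 0))" by auto
qed

section \<open>The truncated distance and surjective short maps\<close>

lemma test_dist_ge:
  assumes "test_function M u" "p \<in> points M" "q \<in> points M" shows "\<bar>u p - u q\<bar> \<le> test_dist M p q"
  unfolding test_dist_def
proof (rule cSup_upper)
  show "bdd_above ((\<lambda>u. \<bar>u p - u q\<bar>) ` Collect (test_function M))"
  proof (rule bdd_aboveI[of _ 1])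
    fix x assume "x \<in> (\<lambda>u. \<bar>u p - u q\<bar>) ` Collect (test_function M)"
    then obtain v where v: "test_function M v" "x = \<bar>v p - v q\<bar>" by blast
    then have "0 \<le> v p" "v p \<le> 1" "0 \<le> v q" "v q \<le> 1" using assms(2,3) by (auto simp: test_function_def)
    then show "x \<le> 1" using v by simp
  qed
qed (use assms in auto)

lemma test_dist_le:
  assumes "\<And>u. test_function M u \<Longrightarrow> \<bar>u p - u q\<bar> \<le> B" shows "test_dist M p q \<le> B"
  unfolding test_dist_def using test_function_const assms by (intro cSup_least) auto

lemma test_dist_sym: "test_dist M p q = test_dist M q p"
  by (simp add: test_dist_def abs_minus_commute)

lemma test_dist_triangle:
  assumes "p \<in> points M" "q \<in> points M" "r \<in> points M"
  shows "test_dist M p r \<le> test_dist M p q + test_dist M q r"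
proof (rule test_dist_le)
  fix u assume "test_function M u"
  then show "\<bar>u p - u r\<bar> \<le> test_dist M p q + test_dist M q r"
    using test_dist_ge[of u p q] test_dist_ge[of u q r] assms by linarith
qed

text \<open>\<open>test_function_upper\<close> bounds all test functions near a point uniformly, so
  small coordinate balls are small for \<open>test_dist\<close>; compactness leaves finitely
  many.\<close>

lemma test_dist_totally_bounded:
  assumes comp: "compact_space (topo M)" and e: "e > 0"
  obtains \<F> where "finite \<F>" "points M \<subseteq> \<Union>\<F>"
    "\<And>S p q. \<lbrakk>S \<in> \<F>; p \<in> S; q \<in> S; p \<in> points M; q \<in> points M\<rbrakk> \<Longrightarrow> test_dist M p q < e"
proof -
  have "\<exists>S. openin (topo M) S \<and> p \<in> S \<and> (\<forall>q\<in>S. test_dist M q p < e / 2)" if pp: "p \<in> points M" for p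
  proof -
    obtain i where i: "i \<in> charts M" "p \<in> D i" using chart_cover[OF pp] by blast
    obtain C where C: "C > 0" "\<And>v. N i p v \<le> C * norm v" using chart_norm_bounds[OF i] by blast
    obtain \<delta> where \<delta>: "\<delta> > 0" "\<And>x. norm (x - \<phi> i p) < \<delta> \<Longrightarrow> x \<in> U i \<and>
     (\<forall>u. test_function M u \<longrightarrow> \<bar>u (\<psi> i x) - u p\<bar> \<le> N i p (x - \<phi> i p) + 1 * norm (x - \<phi> i p))"
      using test_function_upper[OF i, of 1] by auto
    define r where "r = min \<delta> (e / (4 * (C + 1)))"
    have r: "r > 0" using \<delta> e C by (simp add: r_def)
    have "test_dist M q p < e / 2" if q: "q \<in> D i" "norm (\<phi> i q - \<phi> i p) < r" for q
    proof -
      have "test_dist M q p \<le> (C + 1) * norm (\<phi> i q - \<phi> i p)"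
      proof (rule test_dist_le)
        fix u assume "test_function M u"
        then have "\<bar>u q - u p\<bar> \<le> N i p (\<phi> i q - \<phi> i p) + 1 * norm (\<phi> i q - \<phi> i p)"
          using \<delta>(2)[of "\<phi> i q"] q psi_phi[OF i(1) q(1)] by (auto simp: r_def)
        then show "\<bar>u q - u p\<bar> \<le> (C + 1) * norm (\<phi> i q - \<phi> i p)"
          using C(2)[of "\<phi> i q - \<phi> i p"] by (simp add: algebra_simps)
      qed
      also have "\<dots> < (C + 1) * (e / (4 * (C + 1)))"
        using q(2) C by (intro mult_strict_left_mono) (auto simp: r_def)
      also have "\<dots> = e / 4" using C by (simp add: field_simps)
      also have "\<dots> < e / 2" using e by simp
      finally show ?thesis .
    qed
    moreover have "p \<in> {q \<in> D i. \<phi> i q \<in> ball (\<phi> i p) r}" using i r by simp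
    ultimately show ?thesis
      using openin_chart_preimage[OF i(1) open_ball[of "\<phi> i p" r]]
      by (intro exI[of _ "{q \<in> D i. \<phi> i q \<in> ball (\<phi> i p) r}"]) (auto simp: dist_norm norm_minus_commute)
  qed
  then obtain S where S: "\<And>p. p \<in> points M \<Longrightarrow> openin (topo M) (S p) \<and> p \<in> S p \<and> (\<forall>q\<in>S p. test_dist M q p < e / 2)"
    by metis
  have "\<forall>V\<in>S ` points M. openin (topo M) V" "points M \<subseteq> \<Union>(S ` points M)" using S by blast+
  then obtain \<F> where \<F>: "finite \<F>" "\<F> \<subseteq> S ` points M" "points M \<subseteq> \<Union>\<F>"
    using comp unfolding compact_space_alt by (metis (no_types, lifting))
  show ?thesis
  proof (rule that[OF \<F>(1,3)])
    fix V p q assume V: "V \<in> \<F>" "p \<in> V" "q \<in> V" "p \<in> points M" "q \<in> points M"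
    then obtain o' where o': "o' \<in> points M" "V = S o'" using \<F>(2) by blast
    have "test_dist M p q \<le> test_dist M p o' + test_dist M o' q"
      using V o' by (intro test_dist_triangle)
    also have "\<dots> < e"
      using S[OF o'(1)] V o' test_dist_sym[of o' q] by (metis add_strict_mono field_sum_of_halves)
    finally show "test_dist M p q < e" .
  qed
qed

text \<open>A surjective nonexpanding self-map of a totally bounded space does not contract: follow
  preimages backwards until both orbits come close to themselves.\<close>

lemma surjective_short_test_dist:
  assumes comp: "compact_space (topo M)" and surj: "g ` points M = points M"
    and short: "\<And>p q. p \<in> points M \<Longrightarrow> q \<in> points M \<Longrightarrow> test_dist M (g p) (g q) \<le> test_dist M p q"
    and pq: "p \<in> points M" "q \<in> points M"
  shows "test_dist M p q \<le> test_dist M (g p) (g q)"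
proof (rule field_le_epsilon)
  fix e :: real assume e: "e > 0"
  define s where "s = inv_into (points M) g"
  have s: "s x \<in> points M" "g (s x) = x" if "x \<in> points M" for x
    unfolding s_def using surj that by (auto simp: inv_into_into f_inv_into_f)
  have sp: "(s ^^ k) x \<in> points M" if "x \<in> points M" for k x
    using that s by (induction k) auto
  have gs: "(g ^^ k) ((s ^^ (k + m)) x) = (s ^^ m) x" if "x \<in> points M" for k m x
  proof (induction k)
    case (Suc k)
    have "(g ^^ Suc k) ((s ^^ (Suc k + m)) x) = (g ^^ k) (g (s ((s ^^ (k + m)) x)))"
      by (simp add: funpow_swap1)
    also have "\<dots> = (s ^^ m) x" using s(2)[OF sp[OF that]] Suc by simp
    finally show ?case .
  qed simp
  have gpts: "(g ^^ k) x \<in> points M" if "x \<in> points M" for k x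
    using that surj by (induction k) auto
  have shortk: "test_dist M ((g ^^ k) x) ((g ^^ k) y) \<le> test_dist M x y"
    if xy: "x \<in> points M" "y \<in> points M" for k x y
  proof (induction k)
    case (Suc k)
    then show ?case using short[OF gpts[OF xy(1)] gpts[OF xy(2)], of k k] by simp
  qed simp
  obtain \<F> where \<F>: "finite \<F>" "points M \<subseteq> \<Union>\<F>"
    "\<And>S p q. \<lbrakk>S \<in> \<F>; p \<in> S; q \<in> S; p \<in> points M; q \<in> points M\<rbrakk> \<Longrightarrow> test_dist M p q < e / 2"
    using test_dist_totally_bounded[OF comp, of "e / 2"] e by auto
  define cl where "cl = (\<lambda>x. SOME S. S \<in> \<F> \<and> x \<in> S)"
  have cl: "cl x \<in> \<F> \<and> x \<in> cl x" if "x \<in> points M" for x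
    unfolding cl_def by (rule someI_ex) (use \<F>(2) that in blast)
  have gp: "g p \<in> points M" "g q \<in> points M" using surj pq by auto
  \<comment> \<open>\<open>xs\<close> runs backwards from the pair of images: index 0 holds
    \<open>(g p, g q)\<close>, index 1 holds \<open>(p, q)\<close>, and applying \<open>g\<close>
    lowers the index by one.\<close>
  define xs where "xs = (\<lambda>k. (if k = 0 then g p else (s ^^ (k - 1)) p, if k = 0 then g q else (s ^^ (k - 1)) q))"
  have xs: "fst (xs k) \<in> points M" "snd (xs k) \<in> points M" for k
    using gp pq sp by (auto simp: xs_def)
  have bk: "g (fst (xs (Suc k))) = fst (xs k)" "g (snd (xs (Suc k))) = snd (xs k)" for k
    using s(2)[OF sp[OF pq(1)]] s(2)[OF sp[OF pq(2)]] by (cases k; simp add: xs_def)+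
  have bkk: "(g ^^ k) (fst (xs (k + m))) = fst (xs m)" "(g ^^ k) (snd (xs (k + m))) = snd (xs m)" for k m
    by (induction k) (simp_all add: funpow_Suc_right bk del: funpow.simps)
  \<comment> \<open>As the cover is finite, two indices \<open>a < b\<close> put both components
    into the same pair of cells.\<close>
  define f where "f = (\<lambda>k. (cl (fst (xs k)), cl (snd (xs k))))"
  have "range f \<subseteq> \<F> \<times> \<F>" using cl xs by (auto simp: f_def)
  then have "finite (range f)" using \<F>(1) finite_subset finite_cartesian_product by blast
  then have "\<not> inj f" using finite_imageD infinite_UNIV_nat by blast
  then obtain a b where ab: "a < b" "f a = f b" by (metis injI linorder_neqE_nat)
  define m where "m = b - a"
  have m: "m > 0" "b = a + m" using ab by (auto simp: m_def)
  have close: "test_dist M (fst (xs a)) (fst (xs b)) < e / 2" "test_dist M (snd (xs a)) (snd (xs b)) < e / 2"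
    using \<F>(3) cl xs ab(2) unfolding f_def by (metis prod.inject)+
  \<comment> \<open>Applying \<open>g\<close> to both points \<open>a\<close> times shifts the close
    indices \<open>a\<close> and \<open>b\<close> to 0 and \<open>m\<close>.\<close>
  have c1: "test_dist M (fst (xs 0)) (fst (xs m)) < e / 2"
    using shortk[OF xs(1)[of a] xs(1)[of b], of a] close(1) bkk(1)[of a 0] bkk(1)[of a m] m by simp
  have c2: "test_dist M (snd (xs 0)) (snd (xs m)) < e / 2"
    using shortk[OF xs(2)[of a] xs(2)[of b], of a] close(2) bkk(2)[of a 0] bkk(2)[of a m] m by simp
  \<comment> \<open>Applying \<open>g\<close> another \<open>m - 1\<close> times, possible since
    \<open>m\<close> is positive, brings index \<open>m\<close> to index 1, that is, to
    \<open>p\<close> and \<open>q\<close>.\<close>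
  have "test_dist M (fst (xs 1)) (snd (xs 1)) \<le> test_dist M (fst (xs m)) (snd (xs m))"
    using shortk[OF xs(1)[of m] xs(2)[of m], of "m - 1"] bkk[of "m - 1" 1] m by simp
  also have "\<dots> \<le> test_dist M (fst (xs m)) (fst (xs 0)) + test_dist M (fst (xs 0)) (snd (xs m))"
    by (intro test_dist_triangle xs)
  also have "test_dist M (fst (xs 0)) (snd (xs m)) \<le> test_dist M (fst (xs 0)) (snd (xs 0)) + test_dist M (snd (xs 0)) (snd (xs m))"
    by (intro test_dist_triangle xs)
  finally have "test_dist M p q \<le> test_dist M (g p) (g q) + e"
    using c1 c2 test_dist_sym[of "fst (xs m)" "fst (xs 0)"] by (simp add: xs_def)
  then show "test_dist M p q \<le> test_dist M (g p) (g q) + e" .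
qed

text \<open>A test function of nearly full slope bounds the distance from \<open>p\<close> to a
  nearby point from below, and the uniform estimate at \<open>g p\<close> bounds the distance of the
  images from above. As \<open>g\<close> does not decrease \<open>test_dist\<close>, dividing by the
  step length \<open>t\<close> compares the norms.\<close>

theorem surjective_short_map_isometric:
  assumes comp: "compact_space (topo M)" and surj: "g ` points M = points M"
    and g: "continuous_map (topo M) (topo M) g"
    and short: "\<And>p i j. \<lbrakk>i \<in> charts M; p \<in> D i; j \<in> charts M; g p \<in> D j\<rbrakk> \<Longrightarrow> \<exists>A. short_at M M i j g A p"
    and A: "short_at M M i j g A p"
  shows "N j (g p) (A v) = N i p v"
proof (rule antisym)
  interpret two_riemannian M M by unfold_locales
  have i: "i \<in> charts M" "p \<in> D i" and j: "j \<in> charts M" "g p \<in> D j"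
    and der: "(local_expr M M i j g has_derivative A) (at (\<phi> i p))"
    and le: "\<And>v. N j (g p) (A v) \<le> N i p v"
    using A by (auto simp: short_at_def)
  show "N j (g p) (A v) \<le> N i p v" by (rule le)
  have gpts: "g q \<in> points M" if "q \<in> points M" for q using surj that by blast
  have pull: "test_function M (u \<circ> g)" if "test_function M u" for u
  proof (rule test_function_pull[OF g _ that])
    fix q j assume "q \<in> points M" "j \<in> charts M" "g q \<in> D j"
    then show "\<exists>i A. short_at M M i j g A q" using chart_cover[of q] short by blast
  qed
  have sd: "test_dist M (g x) (g y) \<le> test_dist M x y" if xy: "x \<in> points M" "y \<in> points M" for x y
  proof (rule test_dist_le)
    fix u assume "test_function M u"
    from test_dist_ge[OF pull[OF this] xy] show "\<bar>u (g x) - u (g y)\<bar> \<le> test_dist M x y" by simp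
  qed
  have exp: "test_dist M x y \<le> test_dist M (g x) (g y)" if "x \<in> points M" "y \<in> points M" for x y
    by (rule surjective_short_test_dist[OF comp surj _ that]) (rule sd)
  obtain C where C: "C > 0" "\<And>w. N j (g p) w \<le> C * norm w" using chart_norm_bounds[OF j] by blast
  \<comment> \<open>\<open>K\<close> collects the coefficients of \<open>e\<close>: the loss of
    slope, the remainder of the expansion and the slack at \<open>g p\<close>.\<close>
  define K where "K = N i p v + C * norm v + norm (A v) + norm v"
  have K: "K \<ge> 0" unfolding K_def using chart_norm_nonneg[OF i] C by simp
  have main: "N i p v \<le> N j (g p) (A v) + e * K" if e: "0 < e" "e < 1" for e
  proof -
    obtain \<delta>1 where \<delta>1: "\<delta>1 > 0" "\<And>x. norm (x - \<phi> i p) < \<delta>1 \<Longrightarrow>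
       \<exists>u. test_function M u \<and> (1 - e) * N i p (x - \<phi> i p) \<le> u p - u (\<psi> i x)"
      using test_function_lower[OF i e] by blast
    obtain \<delta>2 where \<delta>2: "\<delta>2 > 0" "\<And>y. norm (y - \<phi> j (g p)) < \<delta>2 \<Longrightarrow>
       (\<forall>u. test_function M u \<longrightarrow> \<bar>u (\<psi> j y) - u (g p)\<bar> \<le> N j (g p) (y - \<phi> j (g p)) + e * norm (y - \<phi> j (g p)))"
      using test_function_upper[OF j e(1)] by blast
    obtain \<delta>3 where \<delta>3: "\<delta>3 > 0" "\<And>x. norm (x - \<phi> i p) < \<delta>3 \<Longrightarrow> g (\<psi> i x) = \<psi> j (local_expr M M i j g x) \<and>
       norm (local_expr M M i j g x - \<phi> j (g p) - A (x - \<phi> i p)) \<le> e * norm (x - \<phi> i p)"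
      using local_expansion[OF i j g der e(1)] by blast
    obtain \<delta>4 where \<delta>4: "\<delta>4 > 0" "\<And>x. norm (x - \<phi> i p) < \<delta>4 \<Longrightarrow> x \<in> U i"
      using chart_ball[OF i openin_topspace dom_points[OF i]] by blast
    define d where "d = Min {\<delta>1, \<delta>2, \<delta>3, \<delta>4}"
    have d: "d > 0" "d \<le> \<delta>1" "d \<le> \<delta>2" "d \<le> \<delta>3" "d \<le> \<delta>4" using \<delta>1 \<delta>2 \<delta>3 \<delta>4 by (auto simp: d_def)
    \<comment> \<open>Small enough for the step in the source and the one in the target to stay
      below \<open>d\<close>.\<close>
    define t where "t = d / (2 * (norm v + norm (A v) + 1))"
    have den: "norm v + norm (A v) + 1 > 0" by (simp add: add_nonneg_pos)
    have t: "t > 0" using d den by (simp add: t_def)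
    have td: "t * (norm v + norm (A v)) < d"
    proof -
      have "t * (norm v + norm (A v)) \<le> t * (norm v + norm (A v) + 1)" using t by simp
      also have "\<dots> = d / 2" using den unfolding t_def by (simp add: field_simps)
      finally show ?thesis using d by simp
    qed
    define x where "x = \<phi> i p + t *\<^sub>R v"
    have hx: "x - \<phi> i p = t *\<^sub>R v" by (simp add: x_def)
    have "t * norm v \<le> t * (norm v + norm (A v))" using t by (intro mult_left_mono) auto
    then have nx: "norm (x - \<phi> i p) < d" unfolding hx using t td by (simp only: norm_scaleR abs_of_pos)
    have q: "\<psi> i x \<in> points M" using \<delta>4(2)[of x] nx d psi_in[OF i(1)] dom_points[OF i(1)] by auto
    have pp: "p \<in> points M" using dom_points[OF i] .
    define y where "y = local_expr M M i j g x"
    define r where "r = y - \<phi> j (g p) - t *\<^sub>R A v"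
    have lin: "A (t *\<^sub>R v) = t *\<^sub>R A v" using has_derivative_linear[OF der] by (simp add: linear_scale)
    have gx: "g (\<psi> i x) = \<psi> j y" and r: "norm r \<le> e * (t * norm v)"
      using \<delta>3(2)[of x] nx d t lin by (auto simp: hx y_def r_def)
    have yy: "y - \<phi> j (g p) = t *\<^sub>R A v + r" by (simp add: r_def)
    have ny: "norm (y - \<phi> j (g p)) \<le> t * (norm (A v) + norm v)"
    proof -
      have "norm (y - \<phi> j (g p)) \<le> t * norm (A v) + e * (t * norm v)"
        unfolding yy using norm_triangle_ineq[of "t *\<^sub>R A v" r] r t by simp
      also have "e * (t * norm v) \<le> 1 * (t * norm v)" using e t by (intro mult_right_mono) auto
      finally show ?thesis by (simp add: algebra_simps)
    qed
    obtain u where u: "test_function M u" "(1 - e) * N i p (x - \<phi> i p) \<le> u p - u (\<psi> i x)"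
      using \<delta>1(2)[of x] nx d by auto
    have "(1 - e) * (t * N i p v) \<le> test_dist M p (\<psi> i x)"
      using u(2) test_dist_ge[OF u(1) pp q] t by (simp add: hx chart_norm_scale[OF i])
    also have "\<dots> \<le> test_dist M (g p) (g (\<psi> i x))" by (rule exp[OF pp q])
    also have "\<dots> \<le> N j (g p) (y - \<phi> j (g p)) + e * norm (y - \<phi> j (g p))"
    proof (rule test_dist_le)
      fix u assume "test_function M u"
      moreover have "norm (y - \<phi> j (g p)) < \<delta>2" using ny td d by (simp add: algebra_simps)
      ultimately show "\<bar>u (g p) - u (g (\<psi> i x))\<bar> \<le> N j (g p) (y - \<phi> j (g p)) + e * norm (y - \<phi> j (g p))"
        using \<delta>2(2)[of y] by (simp add: gx abs_minus_commute)
    qed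
    also have "N j (g p) (y - \<phi> j (g p)) \<le> t * N j (g p) (A v) + C * (e * (t * norm v))"
    proof -
      have "N j (g p) (y - \<phi> j (g p)) \<le> N j (g p) (t *\<^sub>R A v) + N j (g p) r"
        unfolding yy by (rule chart_norm_triangle[OF j])
      also have "N j (g p) r \<le> C * (e * (t * norm v))"
        using C(2)[of r] mult_left_mono[OF r, of C] C(1) by linarith
      finally show ?thesis using t by (simp add: chart_norm_scale[OF j])
    qed
    also have "e * norm (y - \<phi> j (g p)) \<le> e * (t * (norm (A v) + norm v))"
      using ny e by (intro mult_left_mono) auto
    finally have "t * ((1 - e) * N i p v) \<le> t * (N j (g p) (A v) + e * (C * norm v + norm (A v) + norm v))"
      by (simp add: algebra_simps)
    then have "(1 - e) * N i p v \<le> N j (g p) (A v) + e * (C * norm v + norm (A v) + norm v)"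
      using t by simp
    then show ?thesis by (simp add: K_def algebra_simps)
  qed
  show "N i p v \<le> N j (g p) (A v)"
  proof (rule field_le_epsilon)
    fix \<epsilon> :: real assume \<epsilon>: "\<epsilon> > 0"
    define e where "e = min (1/2) (\<epsilon> / (K + 1))"
    have e: "0 < e" "e < 1" using \<epsilon> K by (auto simp: e_def)
    have "e * K \<le> \<epsilon> / (K + 1) * (K + 1)" using K \<epsilon> by (intro mult_mono) (auto simp: e_def)
    then have "e * K \<le> \<epsilon>" using K by simp
    with main[OF e] show "N i p v \<le> N j (g p) (A v) + \<epsilon>" by simp
  qed
qed

end

section \<open>Isometries of a product split\<close>

text \<open>The image of a basis is independent; a vector outside its span would give an independent
  set larger than the basis.\<close>

lemma finite_dim_linear_inj_surj:
  fixes A :: "'e::real_normed_vector \<Rightarrow> 'e"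
  assumes fd: "\<exists>B::'e set. finite B \<and> span B = UNIV" and A: "linear A" "inj A"
  shows "surj A"
proof -
  obtain B :: "'e set" where "B \<subseteq> UNIV" and B: "independent B" "UNIV \<subseteq> span B" "card B = dim (UNIV :: 'e set)"
    by (rule basis_exists)
  obtain B0 where B0: "finite B0" "span B0 = (UNIV :: 'e set)" using fd by blast
  have finB: "finite B" using independent_span_bound[OF B0(1) B(1)] B0(2) by auto
  have ind: "independent (A ` B)"
    using linear_independent_injective_image[OF A(1) B(1) inj_on_subset[OF A(2) subset_UNIV]] .
  have "x \<in> span (A ` B)" for x
  proof (rule ccontr)
    assume x: "x \<notin> span (A ` B)"
    then have i2: "independent (insert x (A ` B))" using ind by (rule independent_insertI)
    have "card (insert x (A ` B)) \<le> card B"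
      using independent_span_bound[OF finB i2] B(2) by auto
    moreover have "x \<notin> A ` B" using x span_base[of x "A ` B"] by blast
    then have "card (insert x (A ` B)) = Suc (card B)"
      using finB A(2) by (simp add: card_image inj_on_subset)
    ultimately show False by simp
  qed
  then have "UNIV = A ` span B" using linear_span_image[OF A(1), of B] by auto
  then show ?thesis by blast
qed

text \<open>The derivative vanishes on coordinate balls, which are convex, so \<open>F\<close> is
  locally constant; a level set is then open together with its complement.\<close>

lemma (in two_riemannian) zero_derivative_constant:
  assumes F: "continuous_map (topo M) (topo M') F" and conn: "connected_space (topo M)"
    and der: "\<And>i j p. \<lbrakk>i \<in> charts M; p \<in> chart_dom M i; j \<in> charts M'; F p \<in> chart_dom M' j\<rbrakk> \<Longrightarrow>
       (local_expr M M' i j F has_derivative (\<lambda>v. 0)) (at (chart_coord M i p))"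
    and pq: "p \<in> points M" "q \<in> points M"
  shows "F p = F q"
proof -
  have loc: "\<exists>V. openin (topo M) V \<and> p \<in> V \<and> (\<forall>p'\<in>V. F p' = F p)" if p: "p \<in> points M" for p
  proof -
    obtain i where i: "i \<in> charts M" "p \<in> chart_dom M i" using src.chart_cover[OF p] by blast
    have "F p \<in> points M'" using F p by (auto simp: continuous_map_def)
    then obtain j where j: "j \<in> charts M'" "F p \<in> chart_dom M' j" using tgt.chart_cover by blast
    have V: "openin (topo M) {q \<in> topspace (topo M). F q \<in> chart_dom M' j}"
      by (rule openin_continuous_map_preimage[OF F tgt.openin_dom[OF j(1)]])
    obtain \<delta> where \<delta>: "\<delta> > 0" "\<And>x. norm (x - chart_coord M i p) < \<delta> \<Longrightarrow> x \<in> chart_coord M i ` chart_dom M i \<and>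
        F (chart_inv M i x) \<in> chart_dom M' j"
      using src.chart_ball[OF i V] j(2) p by auto
    let ?B = "ball (chart_coord M i p) \<delta>"
    have B: "x \<in> chart_coord M i ` chart_dom M i" "F (chart_inv M i x) \<in> chart_dom M' j" if "x \<in> ?B" for x
      using \<delta>(2)[of x] that by (auto simp: dist_norm norm_minus_commute)
    have "(local_expr M M' i j F has_derivative (\<lambda>v. 0)) (at x within ?B)" if x: "x \<in> ?B" for x
    proof -
      have "(local_expr M M' i j F has_derivative (\<lambda>v. 0)) (at (chart_coord M i (chart_inv M i x)))"
        by (rule der[OF i(1) src.psi_in[OF i(1) B(1)[OF x]] j(1) B(2)[OF x]])
      then show ?thesis
        using src.phi_psi[OF i(1) B(1)[OF x]] by (simp add: has_derivative_at_withinI)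
    qed
    from has_derivative_zero_constant[OF convex_ball this]
    obtain c where c: "\<And>x. x \<in> ?B \<Longrightarrow> local_expr M M' i j F x = c" by blast
    have eq: "F (chart_inv M i x) = chart_inv M' j c" if x: "x \<in> ?B" for x
      using c[OF x] tgt.psi_phi[OF j(1) B(2)[OF x]] by (simp add: local_expr_def)
    have p0: "F p = chart_inv M' j c" using eq[of "chart_coord M i p"] \<delta>(1) src.psi_phi[OF i] by simp
    show ?thesis
    proof (intro exI[of _ "{q \<in> chart_dom M i. chart_coord M i q \<in> ?B}"] conjI ballI)
      show "openin (topo M) {q \<in> chart_dom M i. chart_coord M i q \<in> ?B}"
        by (rule src.openin_chart_preimage[OF i(1) open_ball])
      show "p \<in> {q \<in> chart_dom M i. chart_coord M i q \<in> ?B}" using i \<delta>(1) by simp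
      fix q assume "q \<in> {q \<in> chart_dom M i. chart_coord M i q \<in> ?B}"
      then show "F q = F p" using eq[of "chart_coord M i q"] p0 src.psi_phi[OF i(1), of q] by auto
    qed
  qed
  define E where "E = {x \<in> points M. F x = F p}"
  have oE: "openin (topo M) E"
  proof (subst openin_subopen, intro ballI)
    fix x assume x: "x \<in> E"
    then obtain V where V: "openin (topo M) V" "x \<in> V" "\<forall>p'\<in>V. F p' = F x"
      using loc[of x] by (auto simp: E_def)
    have "V \<subseteq> E" using V(3) x openin_subset[OF V(1)] by (auto simp: E_def)
    then show "\<exists>T. openin (topo M) T \<and> x \<in> T \<and> T \<subseteq> E" using V by blast
  qed
  have oE': "openin (topo M) (points M - E)"
  proof (subst openin_subopen, intro ballI)
    fix x assume x: "x \<in> points M - E"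
    then obtain V where V: "openin (topo M) V" "x \<in> V" "\<forall>p'\<in>V. F p' = F x"
      using loc[of x] by auto
    have "V \<subseteq> points M - E" using V(3) x openin_subset[OF V(1)] by (auto simp: E_def)
    then show "\<exists>T. openin (topo M) T \<and> x \<in> T \<and> T \<subseteq> points M - E" using V by blast
  qed
  have "E = {} \<or> E = points M"
    using conn oE oE' unfolding connected_space_clopen_in closedin_def using openin_subset by blast
  moreover have "p \<in> E" using pq by (simp add: E_def)
  ultimately have "q \<in> E" using pq by blast
  then show ?thesis by (simp add: E_def)
qed

section \<open>The differential of an isometry of the product\<close>

locale riemannian_product = A: riemannian M + B: riemannian N
  for M :: "('a, 'e::real_normed_vector, 'i) riemannian" and N :: "('b, 'f::real_normed_vector, 'j) riemannian"
begin

abbreviation "P \<equiv> prod_riemannian M N"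

lemma prod_simps:
  "topo P = prod_topology (topo M) (topo N)" "charts P = charts M \<times> charts N"
  "chart_dom P (i, k) = chart_dom M i \<times> chart_dom N k"
  "chart_coord P (i, k) = map_prod (chart_coord M i) (chart_coord N k)"
  "metric P (i, k) (p, q) (u, u') (v, v') = metric M i p u v + metric N k q u' v'"
  "points P = points M \<times> points N"
  by (simp_all add: prod_riemannian_def)

lemma chart_inv_prod:
  assumes "i \<in> charts M" "k \<in> charts N" "x \<in> chart_coord M i ` chart_dom M i" "y \<in> chart_coord N k ` chart_dom N k"
  shows "chart_inv P (i, k) (x, y) = (chart_inv M i x, chart_inv N k y)"
proof -
  obtain p q where pq: "p \<in> chart_dom M i" "x = chart_coord M i p" "q \<in> chart_dom N k" "y = chart_coord N k q"
    using assms by blast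
  have "inj_on (chart_coord P (i, k)) (chart_dom P (i, k))"
    using A.inj_chart[OF assms(1)] B.inj_chart[OF assms(2)] by (auto simp: prod_simps inj_on_def)
  then have "chart_inv P (i, k) (chart_coord P (i, k) (p, q)) = (p, q)"
    unfolding chart_inv_def using pq by (intro inv_into_f_f) (auto simp: prod_simps)
  then show ?thesis using pq A.psi_phi[OF assms(1)] B.psi_phi[OF assms(2)] by (simp add: prod_simps)
qed

text \<open>\<open>L\<close> is the differential of \<open>f\<close> at \<open>(p, q)\<close> read
  in charts. Listed are the blocks that the splitting argument inspects: both components along
  \<open>M\<close> and the \<open>M\<close>-component along \<open>N\<close>. The last clause says
  that \<open>L\<close> preserves the product metric.\<close>

definition deriv_blocks ::
    "('a \<times> 'b \<Rightarrow> 'a \<times> 'b) \<Rightarrow> 'i \<Rightarrow> 'j \<Rightarrow> 'i \<Rightarrow> 'j \<Rightarrow> 'a \<Rightarrow> 'b \<Rightarrow> ('e \<times> 'f \<Rightarrow> 'e \<times> 'f) \<Rightarrow> bool" where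
  "deriv_blocks f i k j l p q L \<longleftrightarrow> linear L \<and>
     (local_expr M M i j (\<lambda>x. fst (f (x, q))) has_derivative (\<lambda>v. fst (L (v, 0)))) (at (chart_coord M i p)) \<and>
     (local_expr M N i l (\<lambda>x. snd (f (x, q))) has_derivative (\<lambda>v. snd (L (v, 0)))) (at (chart_coord M i p)) \<and>
     (local_expr N M k j (\<lambda>y. fst (f (p, y))) has_derivative (\<lambda>w. fst (L (0, w)))) (at (chart_coord N k q)) \<and>
     (\<forall>a b. metric M j (fst (f (p, q))) (fst (L a)) (fst (L b)) + metric N l (snd (f (p, q))) (snd (L a)) (snd (L b))
        = metric M i p (fst a) (fst b) + metric N k q (snd a) (snd b))"

text \<open>The blocks arise by composing the local expression of \<open>f\<close> with the
  inclusions of the two coordinate slices.\<close>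

lemma isometry_deriv_blocks:
  assumes f: "isometry P P f"
    and c: "i \<in> charts M" "p \<in> chart_dom M i" "k \<in> charts N" "q \<in> chart_dom N k"
      "j \<in> charts M" "fst (f (p, q)) \<in> chart_dom M j" "l \<in> charts N" "snd (f (p, q)) \<in> chart_dom N l"
  shows "\<exists>L. deriv_blocks f i k j l p q L"
proof -
  let ?E = "local_expr P P (i, k) (j, l) f" and ?x = "chart_coord M i p" and ?y = "chart_coord N k q"
  let ?L = "local_deriv P P (i, k) (j, l) f (p, q)"
  have sm: "smooth_map P P f" and mp: "metric_preserving P P f" using f by (auto simp: isometry_def)
  have fpq: "f (p, q) \<in> chart_dom P (j, l)" using c by (cases "f (p, q)") (simp add: prod_simps)
  have "smooth_on (chart_coord P (i, k) ` {p \<in> chart_dom P (i, k). f p \<in> chart_dom P (j, l)}) ?E"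
    using sm c by (auto simp: smooth_map_def prod_simps)
  moreover have pqin: "(p, q) \<in> {p \<in> chart_dom P (i, k). f p \<in> chart_dom P (j, l)}"
    using c fpq by (auto simp: prod_simps)
  moreover have "g differentiable (at x)" if "smooth_on S g" "x \<in> S" for S and g :: "'e \<times> 'f \<Rightarrow> 'e \<times> 'f" and x
  proof -
    have "Ck_on (Suc 0) S g" using that(1) unfolding smooth_on_def by blast
    then show ?thesis using that(2) by simp
  qed
  ultimately have "?E differentiable (at (chart_coord P (i, k) (p, q)))"
    by blast
  then have der: "(?E has_derivative ?L) (at (?x, ?y))"
    unfolding local_deriv_def using frechet_derivative_works by (auto simp: prod_simps)
  have d1: "((\<lambda>x. (x, ?y)) has_derivative (\<lambda>v. (v, 0))) (at ?x)"
    by (auto intro!: derivative_eq_intros)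
  have d2: "((\<lambda>y. (?x, y)) has_derivative (\<lambda>w. (0, w))) (at ?y)"
    by (auto intro!: derivative_eq_intros)
  have D1: "((\<lambda>x. ?E (x, ?y)) has_derivative (\<lambda>v. ?L (v, 0))) (at ?x)"
    by (rule has_derivative_compose[OF d1 der])
  have D2: "((\<lambda>y. ?E (?x, y)) has_derivative (\<lambda>w. ?L (0, w))) (at ?y)"
    by (rule has_derivative_compose[OF d2 der])
  have xU: "?x \<in> chart_coord M i ` chart_dom M i" and yU: "?y \<in> chart_coord N k ` chart_dom N k" using c by auto
  have ceq: "chart_coord P (j, l) z = (chart_coord M j (fst z), chart_coord N l (snd z))" for z
    by (cases z) (simp add: prod_simps)
  \<comment> \<open>On the chart, the slice of the local expression of \<open>f\<close> is the pair
    of local expressions of its components, so the derivatives can be transferred.\<close>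
  have e1: "?E (x, ?y) = (local_expr M M i j (\<lambda>x. fst (f (x, q))) x, local_expr M N i l (\<lambda>x. snd (f (x, q))) x)"
    if "x \<in> chart_coord M i ` chart_dom M i" for x
    using chart_inv_prod[OF c(1,3) that yU] B.psi_phi[OF c(3,4)] by (simp add: local_expr_def ceq)
  have e2: "?E (?x, y) = (local_expr N M k j (\<lambda>y. fst (f (p, y))) y, local_expr N N k l (\<lambda>y. snd (f (p, y))) y)"
    if "y \<in> chart_coord N k ` chart_dom N k" for y
    using chart_inv_prod[OF c(1,3) xU that] A.psi_phi[OF c(1,2)] by (simp add: local_expr_def ceq)
  have "(local_expr M M i j (\<lambda>x. fst (f (x, q))) has_derivative (\<lambda>v. fst (?L (v, 0)))) (at ?x)"
    by (rule has_derivative_transform_within_open[OF has_derivative_fst[OF D1] A.open_U[OF c(1)] xU]) (simp add: e1)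
  moreover have "(local_expr M N i l (\<lambda>x. snd (f (x, q))) has_derivative (\<lambda>v. snd (?L (v, 0)))) (at ?x)"
    by (rule has_derivative_transform_within_open[OF has_derivative_snd[OF D1] A.open_U[OF c(1)] xU]) (simp add: e1)
  moreover have "(local_expr N M k j (\<lambda>y. fst (f (p, y))) has_derivative (\<lambda>w. fst (?L (0, w)))) (at ?y)"
    by (rule has_derivative_transform_within_open[OF has_derivative_fst[OF D2] B.open_U[OF c(3)] yU]) (simp add: e2)
  moreover have "linear ?L" using der has_derivative_linear by blast
  moreover have "metric M j (fst (f (p, q))) (fst (?L a)) (fst (?L b)) + metric N l (snd (f (p, q))) (snd (?L a)) (snd (?L b))
        = metric M i p (fst a) (fst b) + metric N k q (snd a) (snd b)" for a b
  proof -
    have "(i, k) \<in> charts P" "(j, l) \<in> charts P" "(p, q) \<in> chart_dom P (i, k)"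
      using c by (auto simp: prod_simps)
    then have "metric P (j, l) (f (p, q)) (?L a) (?L b) = metric P (i, k) (p, q) a b"
      using mp fpq unfolding metric_preserving_def by blast
    moreover have "metric P (j, l) (f (p, q)) (?L a) (?L b) =
        metric M j (fst (f (p, q))) (fst (?L a)) (fst (?L b)) + metric N l (snd (f (p, q))) (snd (?L a)) (snd (?L b))"
      by (metis prod.collapse prod_simps(5))
    moreover have "metric P (i, k) (p, q) a b = metric M i p (fst a) (fst b) + metric N k q (snd a) (snd b)"
      by (metis prod.collapse prod_simps(5))
    ultimately show ?thesis by simp
  qed
  ultimately show ?thesis unfolding deriv_blocks_def by blast
qed

lemma isometry_homeomorphic:
  assumes f: "isometry P P f"
  shows "homeomorphic_maps (topo P) (topo P) f (inv_into (points P) f)"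
  using f unfolding isometry_def smooth_map_def homeomorphic_maps_def
  by (auto simp: bij_betw_inv_into_left bij_betw_inv_into_right)

lemma slice_fst_surjective:
  assumes f: "isometry P P f" and comp: "closed_manifold M" and star: "star_condition M N" and q: "q \<in> points N"
  shows "(\<lambda>x. fst (f (x, q))) ` points M = points M"
proof -
  interpret finite_dim_normed "TYPE('e)" "mdim M"
    by unfold_locales (use A.finite_basis in \<open>auto simp: mdim_def\<close>)
  have "(fst \<circ> f \<circ> (\<lambda>x. (x, q))) ` topspace (topo M) = topspace (topo M)"
  proof (rule star_imp_surjective[where P = "topo P" and F' = "inv_into (points P) f"])
    show "Hausdorff_space (topo M)" by (rule A.Hausdorff)
    show "compact_space (topo M)" using comp by (simp add: closed_manifold_def)
    fix x assume "x \<in> topspace (topo M)"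
    then obtain i where i: "i \<in> charts M" "x \<in> chart_dom M i" using A.chart_cover by blast
    then show "\<exists>W Q f g. x \<in> W \<and> openin (topo M) W \<and> open (Q :: 'e set) \<and>
        homeomorphic_maps (subtopology (topo M) W) (top_of_set Q) f g"
      using A.openin_dom A.open_U A.chart_homeo_maps by blast
  next
    show "continuous_map (topo P) (topo M) fst" by (simp add: prod_simps continuous_map_fst)
    show "continuous_map (topo M) (topo P) (\<lambda>x. (x, q))"
      using q by (simp add: prod_simps continuous_map_pairwise o_def)
    show "homeomorphic_maps (topo P) (topo P) f (inv_into (points P) f)" by (rule isometry_homeomorphic[OF f])
    have "bij_betw (cohomology_map Z2 (mdim M) (topo P) fst)
        (carrier (cohomology_group Z2 (mdim M) (topo M))) (carrier (cohomology_group Z2 (mdim M) (topo P)))"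
      using star by (simp add: star_condition_def iso_def)
    then show "carrier (cohomology_group Z2 (mdim M) (topo P))
        \<subseteq> cohomology_map Z2 (mdim M) (topo P) fst ` carrier (cohomology_group Z2 (mdim M) (topo M))"
      by (simp add: bij_betw_def)
  qed simp
  then show ?thesis by (simp add: o_def)
qed

theorem isometry_splits:
  assumes f: "isometry P P f" and comp: "closed_manifold M" and star: "star_condition M N"
    and conM: "connected_manifold M" and conN: "connected_manifold N"
  shows "splits M N f"
proof -
  interpret MM: two_riemannian M M by unfold_locales
  interpret MN: two_riemannian M N by unfold_locales
  interpret NM: two_riemannian N M by unfold_locales
  have cf: "continuous_map (prod_topology (topo M) (topo N)) (prod_topology (topo M) (topo N)) f"
    using f by (auto simp: isometry_def smooth_map_def prod_simps)
  have fin: "fst (f (x, y)) \<in> points M" "snd (f (x, y)) \<in> points N" if "x \<in> points M" "y \<in> points N" for x y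
    using cf that by (auto simp: continuous_map_def Pi_iff mem_Times_iff)
  have c1: "continuous_map (topo M) (topo M) (\<lambda>x. fst (f (x, q)))"
    and c2: "continuous_map (topo M) (topo N) (\<lambda>x. snd (f (x, q)))" if "q \<in> points N" for q
  proof -
    have "continuous_map (topo M) (prod_topology (topo M) (topo N)) (\<lambda>x. (x, q))"
      using that by (simp add: continuous_map_pairwise o_def)
    from continuous_map_compose[OF this cf]
    have "continuous_map (topo M) (prod_topology (topo M) (topo N)) (\<lambda>x. f (x, q))" by (simp add: o_def)
    then show "continuous_map (topo M) (topo M) (\<lambda>x. fst (f (x, q)))" "continuous_map (topo M) (topo N) (\<lambda>x. snd (f (x, q)))"
      by (simp_all add: continuous_map_pairwise o_def)
  qed
  have c3: "continuous_map (topo N) (topo M) (\<lambda>y. fst (f (p, y)))" if "p \<in> points M" for p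
  proof -
    have "continuous_map (topo N) (prod_topology (topo M) (topo N)) (\<lambda>y. (p, y))"
      using that by (simp add: continuous_map_pairwise o_def)
    from continuous_map_compose[OF this cf]
    have "continuous_map (topo N) (prod_topology (topo M) (topo N)) (\<lambda>y. f (p, y))" by (simp add: o_def)
    then show ?thesis by (simp add: continuous_map_pairwise o_def)
  qed
  \<comment> \<open>The \<open>N\<close>-component of the image of \<open>(v, 0)\<close> contributes
    a nonnegative square, so the \<open>M\<close>-component cannot be longer than
    \<open>v\<close>.\<close>
  have short: "short_at M M i j (\<lambda>x. fst (f (x, q))) (\<lambda>v. fst (L (v, 0))) p"
    if c: "i \<in> charts M" "p \<in> chart_dom M i" "k \<in> charts N" "q \<in> chart_dom N k"
      "j \<in> charts M" "fst (f (p, q)) \<in> chart_dom M j" "l \<in> charts N" "snd (f (p, q)) \<in> chart_dom N l"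
      and L: "deriv_blocks f i k j l p q L" for i j k l p q L
  proof -
    have "chart_norm M j (fst (f (p, q))) (fst (L (v, 0))) \<le> chart_norm M i p v" for v
    proof -
      have "metric M j (fst (f (p, q))) (fst (L (v, 0))) (fst (L (v, 0))) +
            metric N l (snd (f (p, q))) (snd (L (v, 0))) (snd (L (v, 0))) = metric M i p v v"
        using L B.metric_zero[OF c(3,4)] unfolding deriv_blocks_def by simp
      then show ?thesis using B.metric_nonneg[OF c(7,8), of "snd (L (v, 0))"] by (simp add: chart_norm_def)
    qed
    then show ?thesis using L c by (simp add: short_at_def deriv_blocks_def)
  qed
  \<comment> \<open>The slice map is onto and short, hence isometric; the \<open>M\<close>-component
    uses up the whole length and leaves none for the \<open>N\<close>-component.\<close>
  have iso1: "snd (L (v, 0)) = 0 \<and> chart_norm M j (fst (f (p, q))) (fst (L (v, 0))) = chart_norm M i p v"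
    if c: "i \<in> charts M" "p \<in> chart_dom M i" "k \<in> charts N" "q \<in> chart_dom N k"
      "j \<in> charts M" "fst (f (p, q)) \<in> chart_dom M j" "l \<in> charts N" "snd (f (p, q)) \<in> chart_dom N l"
      and L: "deriv_blocks f i k j l p q L" for i j k l p q L v
  proof -
    have qN: "q \<in> points N" using B.dom_points[OF c(3,4)] .
    have eq: "chart_norm M j (fst (f (p, q))) (fst (L (v, 0))) = chart_norm M i p v"
    proof (rule A.surjective_short_map_isometric[OF _ slice_fst_surjective[OF f comp star qN] c1[OF qN] _ short[OF c L]])
      show "compact_space (topo M)" using comp by (simp add: closed_manifold_def)
      fix p' i' j' assume c': "i' \<in> charts M" "p' \<in> chart_dom M i'" "j' \<in> charts M" "fst (f (p', q)) \<in> chart_dom M j'"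
      have p': "p' \<in> points M" using A.dom_points[OF c'(1,2)] .
      obtain l' where l': "l' \<in> charts N" "snd (f (p', q)) \<in> chart_dom N l'"
        using B.chart_cover[OF fin(2)[OF p' qN]] by blast
      obtain L' where L': "deriv_blocks f i' k j' l' p' q L'"
        using isometry_deriv_blocks[OF f c'(1,2) c(3,4) c'(3,4) l'] by blast
      show "\<exists>A. short_at M M i' j' (\<lambda>x. fst (f (x, q))) A p'"
        using short[OF c'(1,2) c(3,4) c'(3,4) l' L'] by blast
    qed
    have "metric M j (fst (f (p, q))) (fst (L (v, 0))) (fst (L (v, 0))) +
          metric N l (snd (f (p, q))) (snd (L (v, 0))) (snd (L (v, 0))) = metric M i p v v"
      using L B.metric_zero[OF c(3,4)] unfolding deriv_blocks_def by simp
    moreover have "metric M j (fst (f (p, q))) (fst (L (v, 0))) (fst (L (v, 0))) = metric M i p v v"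
      using eq by (simp add: chart_norm_def)
    ultimately have "metric N l (snd (f (p, q))) (snd (L (v, 0))) (snd (L (v, 0))) = 0" by simp
    then have "snd (L (v, 0)) = 0" using B.metric_pos[OF c(7,8), of "snd (L (v, 0))"] by force
    with eq show ?thesis by simp
  qed
  have zero: "fst (L (0, w)) = 0"
    if c: "i \<in> charts M" "p \<in> chart_dom M i" "k \<in> charts N" "q \<in> chart_dom N k"
      "j \<in> charts M" "fst (f (p, q)) \<in> chart_dom M j" "l \<in> charts N" "snd (f (p, q)) \<in> chart_dom N l"
      and L: "deriv_blocks f i k j l p q L" for i j k l p q L w
  proof -
    note iso1' = iso1[OF c L]
    let ?A = "\<lambda>v. fst (L (v, 0))"
    have linL: "linear L" using L by (simp add: deriv_blocks_def)
    have linA: "linear ?A"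
    proof (rule linearI)
      show "?A (x + y) = ?A x + ?A y" for x y using linear_add[OF linL, of "(x, 0)" "(y, 0)"] by simp
      show "?A (r *\<^sub>R x) = r *\<^sub>R ?A x" for r x using linear_scale[OF linL, of r "(x, 0)"] by simp
    qed
    have "inj ?A"
      unfolding linear_injective_0[OF linA]
    proof (intro allI impI)
      fix v assume "?A v = 0"
      then have "chart_norm M i p v = 0" using iso1'[of v] A.chart_norm_zero[OF c(5,6), of 0] by simp
      then show "v = 0" using A.chart_norm_zero[OF c(1,2)] by simp
    qed
    \<comment> \<open>An injective endomorphism of the model space is onto, so
      \<open>fst (L (0, w))\<close> is the image of some \<open>v\<close>. As \<open>(v, 0)\<close>
      and \<open>(0, w)\<close> are orthogonal and the \<open>N\<close>-component of the first image
      vanishes, that vector is orthogonal to itself.\<close>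
    then have "surj ?A" using finite_dim_linear_inj_surj[OF A.finite_basis linA] by blast
    from surjD[OF this, of "fst (L (0, w))"] obtain v where v: "fst (L (0, w)) = ?A v" by blast
    have "metric M j (fst (f (p, q))) (?A v) (fst (L (0, w))) +
          metric N l (snd (f (p, q))) (snd (L (v, 0))) (snd (L (0, w))) = metric M i p v 0 + metric N k q 0 w"
      using L by (simp add: deriv_blocks_def)
    then have "metric M j (fst (f (p, q))) (fst (L (0, w))) (fst (L (0, w))) = 0"
      using iso1'[of v] A.metric_zero[OF c(1,2)] B.metric_zero[OF c(3,4)] B.metric_zero[OF c(7,8)] v by simp
    then show ?thesis using A.metric_pos[OF c(5,6), of "fst (L (0, w))"] by force
  qed
  have "snd (f (x, y)) = snd (f (x', y))" if xy: "x \<in> points M" "x' \<in> points M" "y \<in> points N" for x x' y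
  proof (rule MN.zero_derivative_constant[OF c2[OF xy(3)] _ _ xy(1,2)])
    show "connected_space (topo M)" using conM by (simp add: connected_manifold_def)
    fix i l p assume c: "i \<in> charts M" "p \<in> chart_dom M i" "l \<in> charts N" "snd (f (p, y)) \<in> chart_dom N l"
    obtain k where k: "k \<in> charts N" "y \<in> chart_dom N k" using B.chart_cover[OF xy(3)] by blast
    obtain j where j: "j \<in> charts M" "fst (f (p, y)) \<in> chart_dom M j"
      using A.chart_cover[OF fin(1)[OF A.dom_points[OF c(1,2)] xy(3)]] by blast
    obtain L where L: "deriv_blocks f i k j l p y L"
      using isometry_deriv_blocks[OF f c(1,2) k j c(3,4)] by blast
    then have "(local_expr M N i l (\<lambda>x. snd (f (x, y))) has_derivative (\<lambda>v. snd (L (v, 0)))) (at (chart_coord M i p))"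
      by (simp add: deriv_blocks_def)
    then show "(local_expr M N i l (\<lambda>x. snd (f (x, y))) has_derivative (\<lambda>v. 0)) (at (chart_coord M i p))"
      using iso1[OF c(1,2) k j c(3,4) L] by simp
  qed
  moreover have "fst (f (x, y)) = fst (f (x, y'))" if xy: "x \<in> points M" "y \<in> points N" "y' \<in> points N" for x y y'
  proof (rule NM.zero_derivative_constant[OF c3[OF xy(1)] _ _ xy(2,3)])
    show "connected_space (topo N)" using conN by (simp add: connected_manifold_def)
    fix k j q assume c: "k \<in> charts N" "q \<in> chart_dom N k" "j \<in> charts M" "fst (f (x, q)) \<in> chart_dom M j"
    obtain i where i: "i \<in> charts M" "x \<in> chart_dom M i" using A.chart_cover[OF xy(1)] by blast
    obtain l where l: "l \<in> charts N" "snd (f (x, q)) \<in> chart_dom N l"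
      using B.chart_cover[OF fin(2)[OF xy(1) B.dom_points[OF c(1,2)]]] by blast
    obtain L where L: "deriv_blocks f i k j l x q L"
      using isometry_deriv_blocks[OF f i c l] by blast
    then have "(local_expr N M k j (\<lambda>y. fst (f (x, y))) has_derivative (\<lambda>w. fst (L (0, w)))) (at (chart_coord N k q))"
      by (simp add: deriv_blocks_def)
    then show "(local_expr N M k j (\<lambda>y. fst (f (x, y))) has_derivative (\<lambda>w. 0)) (at (chart_coord N k q))"
      using zero[OF i c l L] by simp
  qed
  ultimately show ?thesis unfolding splits_def by blast
qed

end

section \<open>Products of isometries\<close>

text \<open>On an open set the derivatives are determined by the values in that set, so the
  induction can pass to the directional derivatives.\<close>

lemma Ck_on_cong:
  assumes "open S" "\<And>x. x \<in> S \<Longrightarrow> f x = g x" "Ck_on k S f"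
  shows "Ck_on k S g"
  using assms
proof (induction k arbitrary: f g)
  case 0
  have "continuous_on S g \<longleftrightarrow> continuous_on S f" by (rule continuous_on_cong) (use 0 in auto)
  then show ?case using 0 by simp
next
  case (Suc k)
  have der: "(g has_derivative frechet_derivative f (at x)) (at x)" if x: "x \<in> S" for x
  proof (rule has_derivative_transform_within_open[OF _ Suc.prems(1) x])
    show "(f has_derivative frechet_derivative f (at x)) (at x)"
      using Suc.prems(3) x frechet_derivative_works by auto
  qed (use Suc.prems(2) in auto)
  have eq: "frechet_derivative f (at x) v = frechet_derivative g (at x) v" if "x \<in> S" for x v
    using frechet_derivative_at[OF der[OF that]] by simp
  have "Ck_on k S (\<lambda>x. frechet_derivative g (at x) v)" for v
    by (rule Suc.IH[OF Suc.prems(1) eq]) (use Suc.prems(3) in auto)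
  then show ?case using der by (auto simp: differentiable_def)
qed

lemma smooth_on_cong:
  "\<lbrakk>open S; \<And>x. x \<in> S \<Longrightarrow> f x = g x; smooth_on S f\<rbrakk> \<Longrightarrow> smooth_on S g"
  unfolding smooth_on_def using Ck_on_cong by blast

lemma smooth_on_has_derivative:
  assumes "smooth_on S f" "x \<in> S"
  shows "(f has_derivative frechet_derivative f (at x)) (at x)"
proof -
  have "Ck_on (Suc 0) S f" using assms(1) unfolding smooth_on_def by blast
  then show ?thesis using assms(2) frechet_derivative_works by auto
qed

lemma has_derivative_map_prod:
  assumes f: "(f has_derivative f') (at (fst z))" and g: "(g has_derivative g') (at (snd z))"
  shows "((\<lambda>z. (f (fst z), g (snd z))) has_derivative (\<lambda>v. (f' (fst v), g' (snd v)))) (at z)"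
proof (rule has_derivative_Pair)
  show "((\<lambda>z. f (fst z)) has_derivative (\<lambda>v. f' (fst v))) (at z)"
    by (rule has_derivative_compose[OF has_derivative_fst[OF has_derivative_ident] f])
  show "((\<lambda>z. g (snd z)) has_derivative (\<lambda>v. g' (snd v))) (at z)"
    by (rule has_derivative_compose[OF has_derivative_snd[OF has_derivative_ident] g])
qed

text \<open>A directional derivative of a product map is the product of directional derivatives, so
  the induction runs over all pairs \<open>f\<close>, \<open>g\<close>.\<close>

lemma Ck_on_prod:
  assumes "open S" "open T" "Ck_on k S f" "Ck_on k T g"
  shows "Ck_on k (S \<times> T) (\<lambda>z. (f (fst z), g (snd z)))"
  using assms
proof (induction k arbitrary: f g)
  case 0
  have "continuous_on (S \<times> T) (\<lambda>z. f (fst z))"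
    by (rule continuous_on_compose2[of S f]) (use 0 in \<open>auto intro: continuous_intros\<close>)
  moreover have "continuous_on (S \<times> T) (\<lambda>z. g (snd z))"
    by (rule continuous_on_compose2[of T g]) (use 0 in \<open>auto intro: continuous_intros\<close>)
  ultimately show ?case by (simp add: continuous_on_Pair)
next
  case (Suc k)
  have der: "((\<lambda>z. (f (fst z), g (snd z))) has_derivative
      (\<lambda>v. (frechet_derivative f (at (fst z)) (fst v), frechet_derivative g (at (snd z)) (snd v)))) (at z)"
    if z: "z \<in> S \<times> T" for z
  proof (rule has_derivative_map_prod)
    show "(f has_derivative frechet_derivative f (at (fst z))) (at (fst z))"
      "(g has_derivative frechet_derivative g (at (snd z))) (at (snd z))"
      using Suc.prems(3,4) z by (auto simp: mem_Times_iff intro: frechet_derivative_works[THEN iffD1])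
  qed
  have "Ck_on k (S \<times> T) (\<lambda>z. frechet_derivative (\<lambda>z. (f (fst z), g (snd z))) (at z) v)" for v
  proof (rule Ck_on_cong)
    show "open (S \<times> T)" using Suc.prems open_Times by blast
    show "Ck_on k (S \<times> T) (\<lambda>z. (frechet_derivative f (at (fst z)) (fst v), frechet_derivative g (at (snd z)) (snd v)))"
      using Suc.prems(3,4) by (intro Suc.IH[OF Suc.prems(1,2)]) auto
    fix z assume "z \<in> S \<times> T"
    from fun_cong[OF frechet_derivative_at[OF der[OF this]], of v]
    show "(frechet_derivative f (at (fst z)) (fst v), frechet_derivative g (at (snd z)) (snd v)) =
        frechet_derivative (\<lambda>z. (f (fst z), g (snd z))) (at z) v" by simp
  qed
  moreover have "(\<lambda>z. (f (fst z), g (snd z))) differentiable (at z)" if "z \<in> S \<times> T" for z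
    using der[OF that] by (rule differentiableI)
  ultimately show ?case by simp
qed

lemma smooth_on_prod:
  "\<lbrakk>open S; open T; smooth_on S f; smooth_on T g\<rbrakk> \<Longrightarrow> smooth_on (S \<times> T) (\<lambda>z. (f (fst z), g (snd z)))"
  unfolding smooth_on_def using Ck_on_prod by blast

text \<open>Restriction to an affine slice followed by a linear projection: differentiating
  reproduces this form, with \<open>E\<close> replaced by a directional derivative. It extracts the
  factors of a smooth product map.\<close>

lemma Ck_on_slice:
  assumes lin: "bounded_linear a" "bounded_linear b" and S: "open S" "\<And>x. x \<in> S \<Longrightarrow> c + a x \<in> W"
    and "Ck_on k W E"
  shows "Ck_on k S (\<lambda>x. b (E (c + a x)))"
  using assms(5)
proof (induction k arbitrary: E)
  case 0
  have "continuous_on S (\<lambda>x. E (c + a x))"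
    by (rule continuous_on_compose2[of W E])
      (use 0 S in \<open>auto intro!: continuous_intros bounded_linear.continuous_on[OF lin(1)]\<close>)
  then show ?case by (simp add: bounded_linear.continuous_on[OF lin(2)])
next
  case (Suc k)
  have der: "((\<lambda>x. b (E (c + a x))) has_derivative (\<lambda>v. b (frechet_derivative E (at (c + a x)) (a v)))) (at x)"
    if x: "x \<in> S" for x
  proof -
    have 1: "((\<lambda>x. c + a x) has_derivative a) (at x)"
      using bounded_linear_imp_has_derivative[OF lin(1)] by (auto intro!: derivative_eq_intros)
    have "(E has_derivative frechet_derivative E (at (c + a x))) (at (c + a x))"
      using Suc.prems S(2)[OF x] frechet_derivative_works by auto
    from has_derivative_compose[OF 1 this] show ?thesis
      by (rule bounded_linear.has_derivative[OF lin(2)])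
  qed
  have "Ck_on k S (\<lambda>x. frechet_derivative (\<lambda>x. b (E (c + a x))) (at x) v)" for v
  proof (rule Ck_on_cong[OF S(1)])
    show "Ck_on k S (\<lambda>x. b (frechet_derivative E (at (c + a x)) (a v)))"
      using Suc.prems by (intro Suc.IH[of "\<lambda>z. frechet_derivative E (at z) (a v)"]) auto
    fix x assume "x \<in> S"
    from fun_cong[OF frechet_derivative_at[OF der[OF this]], of v]
    show "b (frechet_derivative E (at (c + a x)) (a v)) = frechet_derivative (\<lambda>x. b (E (c + a x))) (at x) v"
      by simp
  qed
  then show ?case using der by (auto simp: differentiable_def)
qed

lemma smooth_on_slice:
  assumes "bounded_linear a" "bounded_linear b" "open S" "\<And>x. x \<in> S \<Longrightarrow> c + a x \<in> W" "smooth_on W E"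
  shows "smooth_on S (\<lambda>x. b (E (c + a x)))"
  using Ck_on_slice[OF assms(1-4)] assms(5) by (auto simp: smooth_on_def)

lemma (in two_riemannian) open_chart_domain:
  assumes "i \<in> charts M" "j \<in> charts M'" "continuous_map (topo M) (topo M') g"
  shows "open (chart_coord M i ` {p \<in> chart_dom M i. g p \<in> chart_dom M' j})"
proof -
  have V: "openin (topo M) {q \<in> topspace (topo M). g q \<in> chart_dom M' j}"
    by (rule openin_continuous_map_preimage[OF assms(3) tgt.openin_dom[OF assms(2)]])
  have "chart_coord M i ` {p \<in> chart_dom M i. g p \<in> chart_dom M' j} =
      {x \<in> chart_coord M i ` chart_dom M i. chart_inv M i x \<in> {q \<in> topspace (topo M). g q \<in> chart_dom M' j}}"
    using src.psi_phi[OF assms(1)] src.dom_points[OF assms(1)] by auto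
  then show ?thesis using src.open_psi_preimage[OF assms(1) V] by simp
qed

lemma (in two_riemannian) smooth_map_has_derivative:
  assumes g: "smooth_map M M' g" and c: "i \<in> charts M" "p \<in> chart_dom M i" "j \<in> charts M'" "g p \<in> chart_dom M' j"
  shows "(local_expr M M' i j g has_derivative local_deriv M M' i j g p) (at (chart_coord M i p))"
  unfolding local_deriv_def
proof (rule smooth_on_has_derivative)
  show "smooth_on (chart_coord M i ` {p \<in> chart_dom M i. g p \<in> chart_dom M' j}) (local_expr M M' i j g)"
    using g c by (simp add: smooth_map_def)
qed (use c in auto)

text \<open>The equation is asked on points alone, because group elements are
  \<open>undefined\<close> elsewhere. Nonempty factors supply the base points for recovering
  \<open>g\<close> and \<open>h\<close> from \<open>F\<close>.\<close>

locale product_map = riemannian_product M N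
  for M :: "('a, 'e::real_normed_vector, 'i) riemannian" and N :: "('b, 'f::real_normed_vector, 'j) riemannian" +
  fixes F :: "'a \<times> 'b \<Rightarrow> 'a \<times> 'b" and g :: "'a \<Rightarrow> 'a" and h :: "'b \<Rightarrow> 'b"
  assumes F: "\<And>x y. \<lbrakk>x \<in> points M; y \<in> points N\<rbrakk> \<Longrightarrow> F (x, y) = (g x, h y)"
    and ne: "points M \<noteq> {}" "points N \<noteq> {}"
begin

sublocale MM: two_riemannian M M by unfold_locales
sublocale NN: two_riemannian N N by unfold_locales

lemma local_expr_prod:
  assumes "i \<in> charts M" "k \<in> charts N" "x \<in> chart_coord M i ` chart_dom M i" "y \<in> chart_coord N k ` chart_dom N k"
  shows "local_expr P P (i, k) (j, l) F (x, y) = (local_expr M M i j g x, local_expr N N k l h y)"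
  using chart_inv_prod[OF assms] F A.dom_points[OF assms(1) A.psi_in[OF assms(1,3)]]
    B.dom_points[OF assms(2) B.psi_in[OF assms(2,4)]]
  by (simp add: local_expr_def prod_simps)

lemma chart_domain_prod:
  assumes "i \<in> charts M" "k \<in> charts N"
  shows "chart_coord P (i, k) ` {z \<in> chart_dom P (i, k). F z \<in> chart_dom P (j, l)} =
    (chart_coord M i ` {p \<in> chart_dom M i. g p \<in> chart_dom M j}) \<times>
    (chart_coord N k ` {q \<in> chart_dom N k. h q \<in> chart_dom N l})"
proof -
  have "{z \<in> chart_dom P (i, k). F z \<in> chart_dom P (j, l)} =
      {p \<in> chart_dom M i. g p \<in> chart_dom M j} \<times> {q \<in> chart_dom N k. h q \<in> chart_dom N l}"
    using F A.dom_points[OF assms(1)] B.dom_points[OF assms(2)] by (auto simp: prod_simps)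
  then show ?thesis by (simp add: prod_simps map_prod_image)
qed

lemma continuous_prod_iff:
  "continuous_map (topo P) (topo P) F \<longleftrightarrow> continuous_map (topo M) (topo M) g \<and> continuous_map (topo N) (topo N) h"
proof
  assume cF: "continuous_map (topo P) (topo P) F"
  obtain x0 y0 where x0: "x0 \<in> points M" and y0: "y0 \<in> points N" using ne by blast
  have "continuous_map (topo M) (topo P) (\<lambda>x. (x, y0))" "continuous_map (topo N) (topo P) (\<lambda>y. (x0, y))"
    using x0 y0 by (simp_all add: prod_simps continuous_map_pairwise o_def)
  from this[THEN continuous_map_compose, OF cF]
  have "continuous_map (topo M) (topo M) (fst \<circ> (F \<circ> (\<lambda>x. (x, y0))))" "continuous_map (topo N) (topo N) (snd \<circ> (F \<circ> (\<lambda>y. (x0, y))))"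
    by (simp_all add: prod_simps continuous_map_pairwise)
  then show "continuous_map (topo M) (topo M) g \<and> continuous_map (topo N) (topo N) h"
    using F x0 y0 by (auto elim!: continuous_map_eq)
next
  assume gh: "continuous_map (topo M) (topo M) g \<and> continuous_map (topo N) (topo N) h"
  then have "continuous_map (topo P) (topo M) (g \<circ> fst)" "continuous_map (topo P) (topo N) (h \<circ> snd)"
    by (auto simp: prod_simps intro: continuous_map_compose continuous_map_fst continuous_map_snd)
  then have "continuous_map (topo P) (topo P) (\<lambda>z. (g (fst z), h (snd z)))"
    by (simp add: prod_simps continuous_map_pairwise o_def)
  then show "continuous_map (topo P) (topo P) F"
    by (rule continuous_map_eq) (auto simp: prod_simps F)
qed

text \<open>A slice through a base point isolates each factor; conversely, the local expressions of
  \<open>F\<close> are products of those of \<open>g\<close> and \<open>h\<close>.\<close>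

lemma smooth_prod_iff: "smooth_map P P F \<longleftrightarrow> smooth_map M M g \<and> smooth_map N N h"
proof
  assume sF: "smooth_map P P F"
  then have cg: "continuous_map (topo M) (topo M) g" and ch: "continuous_map (topo N) (topo N) h"
    using continuous_prod_iff by (auto simp: smooth_map_def)
  obtain x0 y0 where x0: "x0 \<in> points M" and y0: "y0 \<in> points N" using ne by blast
  have gx0: "g x0 \<in> points M" and hy0: "h y0 \<in> points N"
    using cg ch x0 y0 by (auto simp: continuous_map_def)
  have sm: "smooth_on ((chart_coord M i ` {p \<in> chart_dom M i. g p \<in> chart_dom M j}) \<times>
    (chart_coord N k ` {q \<in> chart_dom N k. h q \<in> chart_dom N l})) (local_expr P P (i, k) (j, l) F)"
    if "i \<in> charts M" "j \<in> charts M" "k \<in> charts N" "l \<in> charts N" for i j k l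
  proof -
    have "smooth_on (chart_coord P (i, k) ` {z \<in> chart_dom P (i, k). F z \<in> chart_dom P (j, l)}) (local_expr P P (i, k) (j, l) F)"
      using sF that unfolding smooth_map_def by (simp add: prod_simps)
    then show ?thesis using chart_domain_prod[OF that(1,3)] by metis
  qed
  have "smooth_on (chart_coord M i ` {p \<in> chart_dom M i. g p \<in> chart_dom M j}) (local_expr M M i j g)"
    if ij: "i \<in> charts M" "j \<in> charts M" for i j
  proof -
    obtain k l where k: "k \<in> charts N" "y0 \<in> chart_dom N k" and l: "l \<in> charts N" "h y0 \<in> chart_dom N l"
      using B.chart_cover y0 hy0 by blast
    let ?S = "chart_coord M i ` {p \<in> chart_dom M i. g p \<in> chart_dom M j}" and ?y = "chart_coord N k y0"
    have "smooth_on ?S (\<lambda>x. fst (local_expr P P (i, k) (j, l) F ((0, ?y) + (x, 0))))"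
      by (rule smooth_on_slice[where a = "\<lambda>x. (x, 0)" and b = fst and E = "local_expr P P (i, k) (j, l) F",
           OF _ bounded_linear_fst MM.open_chart_domain[OF ij cg] _ sm[OF ij k(1) l(1)]])
        (use k l in \<open>auto intro!: bounded_linear_Pair bounded_linear_ident bounded_linear_zero\<close>)
    then show ?thesis
      by (rule smooth_on_cong[OF MM.open_chart_domain[OF ij cg], rotated]) (use local_expr_prod ij k in auto)
  qed
  moreover have "smooth_on (chart_coord N k ` {q \<in> chart_dom N k. h q \<in> chart_dom N l}) (local_expr N N k l h)"
    if kl: "k \<in> charts N" "l \<in> charts N" for k l
  proof -
    obtain i j where i: "i \<in> charts M" "x0 \<in> chart_dom M i" and j: "j \<in> charts M" "g x0 \<in> chart_dom M j"
      using A.chart_cover x0 gx0 by blast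
    let ?T = "chart_coord N k ` {q \<in> chart_dom N k. h q \<in> chart_dom N l}" and ?x = "chart_coord M i x0"
    have "smooth_on ?T (\<lambda>y. snd (local_expr P P (i, k) (j, l) F ((?x, 0) + (0, y))))"
      by (rule smooth_on_slice[where a = "\<lambda>y. (0, y)" and b = snd and E = "local_expr P P (i, k) (j, l) F",
           OF _ bounded_linear_snd NN.open_chart_domain[OF kl ch] _ sm[OF i(1) j(1) kl]])
        (use i j in \<open>auto intro!: bounded_linear_Pair bounded_linear_ident bounded_linear_zero\<close>)
    then show ?thesis
      by (rule smooth_on_cong[OF NN.open_chart_domain[OF kl ch], rotated]) (use local_expr_prod kl i in auto)
  qed
  ultimately show "smooth_map M M g \<and> smooth_map N N h" using cg ch by (simp add: smooth_map_def)
next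
  assume gh: "smooth_map M M g \<and> smooth_map N N h"
  then have cg: "continuous_map (topo M) (topo M) g" and ch: "continuous_map (topo N) (topo N) h"
    by (auto simp: smooth_map_def)
  have "smooth_on (chart_coord P (i, k) ` {z \<in> chart_dom P (i, k). F z \<in> chart_dom P (j, l)}) (local_expr P P (i, k) (j, l) F)"
    if c: "i \<in> charts M" "j \<in> charts M" "k \<in> charts N" "l \<in> charts N" for i j k l
  proof -
    let ?S = "chart_coord M i ` {p \<in> chart_dom M i. g p \<in> chart_dom M j}"
    let ?T = "chart_coord N k ` {q \<in> chart_dom N k. h q \<in> chart_dom N l}"
    have o: "open ?S" "open ?T" using MM.open_chart_domain cg NN.open_chart_domain ch c by blast+
    have "smooth_on ?S (local_expr M M i j g)" "smooth_on ?T (local_expr N N k l h)"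
      using gh c by (auto simp: smooth_map_def)
    from smooth_on_prod[OF o this]
    have "smooth_on (?S \<times> ?T) (local_expr P P (i, k) (j, l) F)"
      by (rule smooth_on_cong[OF open_Times[OF o], rotated]) (use local_expr_prod[OF c(1,3)] in auto)
    then show ?thesis by (simp only: chart_domain_prod[OF c(1,3)])
  qed
  then show "smooth_map P P F"
    using continuous_prod_iff cg ch unfolding smooth_map_def by (simp add: prod_simps)
qed

text \<open>The differential of \<open>F\<close> is block diagonal; inserting zero vectors in one
  factor over a base point isolates the condition on the other.\<close>

lemma metric_preserving_prod_iff:
  assumes s: "smooth_map M M g" "smooth_map N N h"
  shows "metric_preserving P P F \<longleftrightarrow> metric_preserving M M g \<and> metric_preserving N N h"
proof -
  have cg: "continuous_map (topo M) (topo M) g" and ch: "continuous_map (topo N) (topo N) h"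
    using s by (auto simp: smooth_map_def)
  have der: "local_deriv P P (i, k) (j, l) F (p, q) (v, w) = (local_deriv M M i j g p v, local_deriv N N k l h q w)"
    if c: "i \<in> charts M" "p \<in> chart_dom M i" "k \<in> charts N" "q \<in> chart_dom N k"
      "j \<in> charts M" "g p \<in> chart_dom M j" "l \<in> charts N" "h q \<in> chart_dom N l" for i j k l p q v w
  proof -
    let ?z = "(chart_coord M i p, chart_coord N k q)"
    have "((\<lambda>z. (local_expr M M i j g (fst z), local_expr N N k l h (snd z))) has_derivative
        (\<lambda>v. (local_deriv M M i j g p (fst v), local_deriv N N k l h q (snd v)))) (at ?z)"
      using MM.smooth_map_has_derivative[OF s(1) c(1,2,5,6)] NN.smooth_map_has_derivative[OF s(2) c(3,4,7,8)]
      by (intro has_derivative_map_prod) simp_all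
    then have "(local_expr P P (i, k) (j, l) F has_derivative
        (\<lambda>v. (local_deriv M M i j g p (fst v), local_deriv N N k l h q (snd v)))) (at ?z)"
      by (rule has_derivative_transform_within_open[OF _ open_Times[OF A.open_U[OF c(1)] B.open_U[OF c(3)]]])
        (use c local_expr_prod[OF c(1,3)] in auto)
    from frechet_derivative_at[OF this] show ?thesis by (simp add: local_deriv_def prod_simps fun_eq_iff)
  qed
  have met: "metric P (j, l) (F (p, q)) (local_deriv P P (i, k) (j, l) F (p, q) (v, w)) (local_deriv P P (i, k) (j, l) F (p, q) (v', w'))
      = metric M j (g p) (local_deriv M M i j g p v) (local_deriv M M i j g p v') +
        metric N l (h q) (local_deriv N N k l h q w) (local_deriv N N k l h q w')"
    if c: "i \<in> charts M" "p \<in> chart_dom M i" "k \<in> charts N" "q \<in> chart_dom N k"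
      "j \<in> charts M" "g p \<in> chart_dom M j" "l \<in> charts N" "h q \<in> chart_dom N l" for i j k l p q v w v' w'
    using der[OF c] F A.dom_points[OF c(1,2)] B.dom_points[OF c(3,4)] by (simp add: prod_simps)
  show ?thesis
  proof
    assume mp: "metric_preserving P P F"
    have both: "metric M j (g p) (local_deriv M M i j g p v) (local_deriv M M i j g p v') +
        metric N l (h q) (local_deriv N N k l h q w) (local_deriv N N k l h q w') = metric M i p v v' + metric N k q w w'"
      if c: "i \<in> charts M" "p \<in> chart_dom M i" "k \<in> charts N" "q \<in> chart_dom N k"
        "j \<in> charts M" "g p \<in> chart_dom M j" "l \<in> charts N" "h q \<in> chart_dom N l" for i j k l p q v w v' w'
    proof -
      have "(i, k) \<in> charts P" "(j, l) \<in> charts P" "(p, q) \<in> chart_dom P (i, k)" "F (p, q) \<in> chart_dom P (j, l)"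
        using c F A.dom_points[OF c(1,2)] B.dom_points[OF c(3,4)] by (auto simp: prod_simps)
      then have "metric P (j, l) (F (p, q)) (local_deriv P P (i, k) (j, l) F (p, q) (v, w)) (local_deriv P P (i, k) (j, l) F (p, q) (v', w'))
          = metric P (i, k) (p, q) (v, w) (v', w')"
        using mp unfolding metric_preserving_def by blast
      then show ?thesis unfolding met[OF c] by (simp add: prod_simps)
    qed
    have lz: "local_deriv M M i j g p 0 = 0" if "i \<in> charts M" "p \<in> chart_dom M i" "j \<in> charts M" "g p \<in> chart_dom M j" for i j p
      using MM.smooth_map_has_derivative[OF s(1) that] has_derivative_linear linear_0 by blast
    have lz': "local_deriv N N k l h q 0 = 0" if "k \<in> charts N" "q \<in> chart_dom N k" "l \<in> charts N" "h q \<in> chart_dom N l" for k l q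
      using NN.smooth_map_has_derivative[OF s(2) that] has_derivative_linear linear_0 by blast
    obtain x0 y0 where x0: "x0 \<in> points M" and y0: "y0 \<in> points N" using ne by blast
    have gx0: "g x0 \<in> points M" and hy0: "h y0 \<in> points N"
      using cg ch x0 y0 by (auto simp: continuous_map_def)
    obtain i0 j0 where i0: "i0 \<in> charts M" "x0 \<in> chart_dom M i0" and j0: "j0 \<in> charts M" "g x0 \<in> chart_dom M j0"
      using A.chart_cover x0 gx0 by blast
    obtain k0 l0 where k0: "k0 \<in> charts N" "y0 \<in> chart_dom N k0" and l0: "l0 \<in> charts N" "h y0 \<in> chart_dom N l0"
      using B.chart_cover y0 hy0 by blast
    have "metric M j (g p) (local_deriv M M i j g p v) (local_deriv M M i j g p v') = metric M i p v v'"
      if c: "i \<in> charts M" "j \<in> charts M" "p \<in> chart_dom M i" "g p \<in> chart_dom M j" for i j p v v'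
      using both[OF c(1,3) k0 c(2,4) l0, of v v' 0 0] lz'[OF k0 l0] B.metric_zero[OF k0] B.metric_zero[OF l0] by simp
    moreover have "metric N l (h q) (local_deriv N N k l h q w) (local_deriv N N k l h q w') = metric N k q w w'"
      if c: "k \<in> charts N" "l \<in> charts N" "q \<in> chart_dom N k" "h q \<in> chart_dom N l" for k l q w w'
      using both[OF i0 c(1,3) j0 c(2,4), of 0 0 w w'] lz[OF i0 j0] A.metric_zero[OF i0] A.metric_zero[OF j0] by simp
    ultimately show "metric_preserving M M g \<and> metric_preserving N N h"
      unfolding metric_preserving_def by blast
  next
    assume mp: "metric_preserving M M g \<and> metric_preserving N N h"
    have "metric P (j, l) (F (p, q)) (local_deriv P P (i, k) (j, l) F (p, q) a) (local_deriv P P (i, k) (j, l) F (p, q) b)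
          = metric P (i, k) (p, q) a b"
      if c: "i \<in> charts M" "p \<in> chart_dom M i" "k \<in> charts N" "q \<in> chart_dom N k"
        "j \<in> charts M" "l \<in> charts N" and Fc: "F (p, q) \<in> chart_dom P (j, l)" for i j k l p q a b
    proof -
      have gh: "g p \<in> chart_dom M j" "h q \<in> chart_dom N l"
        using Fc F A.dom_points[OF c(1,2)] B.dom_points[OF c(3,4)] by (auto simp: prod_simps)
      obtain v w v' w' where ab: "a = (v, w)" "b = (v', w')" by (cases a, cases b)
      have "metric M j (g p) (local_deriv M M i j g p v) (local_deriv M M i j g p v') = metric M i p v v'"
        "metric N l (h q) (local_deriv N N k l h q w) (local_deriv N N k l h q w') = metric N k q w w'"
        using mp c gh unfolding metric_preserving_def by blast+
      then show ?thesis unfolding ab met[OF c(1-5) gh(1) c(6) gh(2)] by (simp add: prod_simps)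
    qed
    then show "metric_preserving P P F"
      unfolding metric_preserving_def prod_simps(2) by (auto simp: prod_simps(3))
  qed
qed

lemma bij_prod_iff:
  "bij_betw F (points P) (points P) \<longleftrightarrow> bij_betw g (points M) (points M) \<and> bij_betw h (points N) (points N)"
proof
  obtain x0 y0 where x0: "x0 \<in> points M" and y0: "y0 \<in> points N" using ne by blast
  assume F': "bij_betw F (points P) (points P)"
  then have inj: "inj_on F (points M \<times> points N)" and im: "F ` (points M \<times> points N) = points M \<times> points N"
    by (auto simp: bij_betw_def prod_simps)
  have in_pts: "g x \<in> points M \<and> h y \<in> points N" if "x \<in> points M" "y \<in> points N" for x y
    using im F[OF that] that by (metis image_eqI mem_Sigma_iff)
  have "inj_on g (points M)"
  proof (rule inj_onI)
    fix x x' assume "x \<in> points M" "x' \<in> points M" "g x = g x'"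
    then show "x = x'" using inj_onD[OF inj, of "(x, y0)" "(x', y0)"] F y0 by simp
  qed
  moreover have "inj_on h (points N)"
  proof (rule inj_onI)
    fix y y' assume "y \<in> points N" "y' \<in> points N" "h y = h y'"
    then show "y = y'" using inj_onD[OF inj, of "(x0, y)" "(x0, y')"] F x0 by simp
  qed
  moreover have "z \<in> g ` points M" if "z \<in> points M" for z
  proof -
    have "(z, y0) \<in> F ` (points M \<times> points N)" using im that y0 by simp
    then obtain x y where "x \<in> points M" "y \<in> points N" "(z, y0) = F (x, y)" by auto
    then show ?thesis using F by auto
  qed
  moreover have "z \<in> h ` points N" if "z \<in> points N" for z
  proof -
    have "(x0, z) \<in> F ` (points M \<times> points N)" using im that x0 by simp
    then obtain x y where "x \<in> points M" "y \<in> points N" "(x0, z) = F (x, y)" by auto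
    then show ?thesis using F by auto
  qed
  ultimately show "bij_betw g (points M) (points M) \<and> bij_betw h (points N) (points N)"
    using in_pts x0 y0 by (auto simp: bij_betw_def)
next
  assume "bij_betw g (points M) (points M) \<and> bij_betw h (points N) (points N)"
  then have "bij_betw (map_prod g h) (points M \<times> points N) (points M \<times> points N)"
    by (simp add: bij_betw_map_prod)
  moreover have "map_prod g h z = F z" if "z \<in> points M \<times> points N" for z
    using that F by auto
  ultimately have "bij_betw F (points M \<times> points N) (points M \<times> points N)"
    using bij_betw_cong[of "points M \<times> points N" "map_prod g h" F] by blast
  then show "bij_betw F (points P) (points P)" by (simp only: prod_simps(6))
qed

text \<open>The inverse of \<open>F\<close> is again a product map, that of the inverses, so
  smoothness of the inverse is another instance of \<open>smooth_prod_iff\<close>.\<close>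

lemma isometry_prod_iff: "isometry P P F \<longleftrightarrow> isometry M M g \<and> isometry N N h"
proof (cases "bij_betw F (points P) (points P)")
  case False
  then show ?thesis using bij_prod_iff by (auto simp: isometry_def)
next
  case True
  then have g: "bij_betw g (points M) (points M)" and h: "bij_betw h (points N) (points N)"
    using bij_prod_iff by auto
  interpret I: product_map M N "inv_into (points P) F" "inv_into (points M) g" "inv_into (points N) h"
  proof unfold_locales
    fix x y assume xy: "x \<in> points M" "y \<in> points N"
    let ?x = "inv_into (points M) g x" and ?y = "inv_into (points N) h y"
    have 1: "?x \<in> points M" "?y \<in> points N" "g ?x = x" "h ?y = y"
      using g h xy by (auto simp: bij_betw_def inv_into_into f_inv_into_f)
    then have "F (?x, ?y) = (x, y)" using F by simp
    then show "inv_into (points P) F (x, y) = (?x, ?y)"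
      using True 1 by (metis bij_betw_inv_into_left mem_Sigma_iff prod_simps(6))
  qed (use ne in auto)
  show ?thesis
    using True g h smooth_prod_iff I.smooth_prod_iff metric_preserving_prod_iff unfolding isometry_def by blast
qed

end

section \<open>The isomorphism of isometry groups\<close>

lemma carrier_Iso: "f \<in> carrier (Iso M) \<longleftrightarrow> f \<in> extensional (points M) \<and> isometry M M f"
  by (simp add: Iso_def)

lemma mult_Iso:
  assumes "f \<in> carrier (Iso M)" "g \<in> carrier (Iso M)"
  shows "f \<otimes>\<^bsub>Iso M\<^esub> g = compose (points M) f g"
proof -
  have "f \<in> Bij (points M)" "g \<in> Bij (points M)"
    using assms by (auto simp: carrier_Iso isometry_def Bij_def)
  then show ?thesis by (simp add: Iso_def BijGroup_def)
qed

text \<open>Splitting makes the map onto: the factors of an isometry are its components on the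
  slices through fixed base points.\<close>

lemma (in riemannian_product) prod_isometry_iso:
  assumes ne: "points M \<noteq> {}" "points N \<noteq> {}"
    and split: "\<And>f. isometry P P f \<Longrightarrow> splits M N f"
  shows "prod_isometry M N \<in> iso (Iso M \<times>\<times> Iso N) (Iso P)"
proof (rule isoI)
  have pm: "product_map M N (prod_isometry M N (g, h)) g h" for g h
    by unfold_locales (use ne in \<open>auto simp: prod_isometry_def\<close>)
  have car: "prod_isometry M N (g, h) \<in> carrier (Iso P)" if "g \<in> carrier (Iso M)" "h \<in> carrier (Iso N)" for g h
    using product_map.isometry_prod_iff[OF pm, of g h] that
    by (simp add: carrier_Iso prod_isometry_def prod_simps)
  show "prod_isometry M N \<in> hom (Iso M \<times>\<times> Iso N) (Iso P)"
  proof (rule homI)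
    fix a assume "a \<in> carrier (Iso M \<times>\<times> Iso N)"
    then show "prod_isometry M N a \<in> carrier (Iso P)" using car by (auto simp: DirProd_def)
  next
    fix a b assume ab: "a \<in> carrier (Iso M \<times>\<times> Iso N)" "b \<in> carrier (Iso M \<times>\<times> Iso N)"
    obtain g h g' h' where a: "a = (g, h)" "b = (g', h')" by (cases a, cases b)
    have c: "g \<in> carrier (Iso M)" "h \<in> carrier (Iso N)" "g' \<in> carrier (Iso M)" "h' \<in> carrier (Iso N)"
      using ab a by (auto simp: DirProd_def)
    have in_pts: "g' x \<in> points M" "h' y \<in> points N" if "x \<in> points M" "y \<in> points N" for x y
      using c(3,4) that by (auto simp: carrier_Iso isometry_def bij_betw_def)
    have "prod_isometry M N (a \<otimes>\<^bsub>Iso M \<times>\<times> Iso N\<^esub> b) = prod_isometry M N (compose (points M) g g', compose (points N) h h')"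
      using c by (simp add: a DirProd_def mult_Iso)
    also have "\<dots> = compose (points P) (prod_isometry M N (g, h)) (prod_isometry M N (g', h'))"
      using in_pts by (auto simp: prod_isometry_def compose_def prod_simps fun_eq_iff restrict_def)
    also have "\<dots> = prod_isometry M N a \<otimes>\<^bsub>Iso P\<^esub> prod_isometry M N b"
      using mult_Iso[OF car[OF c(1,2)] car[OF c(3,4)]] by (simp add: a)
    finally show "prod_isometry M N (a \<otimes>\<^bsub>Iso M \<times>\<times> Iso N\<^esub> b) = prod_isometry M N a \<otimes>\<^bsub>Iso P\<^esub> prod_isometry M N b" .
  qed
  obtain x0 y0 where x0: "x0 \<in> points M" and y0: "y0 \<in> points N" using ne by blast
  have "inj_on (prod_isometry M N) (carrier (Iso M \<times>\<times> Iso N))"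
  proof (rule inj_onI)
    fix a b assume ab: "a \<in> carrier (Iso M \<times>\<times> Iso N)" "b \<in> carrier (Iso M \<times>\<times> Iso N)"
      and eq: "prod_isometry M N a = prod_isometry M N b"
    obtain g h g' h' where a: "a = (g, h)" "b = (g', h')" by (cases a, cases b)
    have e: "g \<in> extensional (points M)" "h \<in> extensional (points N)" "g' \<in> extensional (points M)" "h' \<in> extensional (points N)"
      using ab a by (auto simp: DirProd_def carrier_Iso)
    have pt: "g x = g' x \<and> h y = h' y" if "x \<in> points M" "y \<in> points N" for x y
      using fun_cong[OF eq, of "(x, y)"] that by (simp add: a prod_isometry_def)
    have "g = g'" by (rule extensionalityI[OF e(1,3)]) (use pt y0 in blast)
    moreover have "h = h'" by (rule extensionalityI[OF e(2,4)]) (use pt x0 in blast)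
    ultimately show "a = b" by (simp add: a)
  qed
  moreover have "f \<in> prod_isometry M N ` carrier (Iso M \<times>\<times> Iso N)" if f: "f \<in> carrier (Iso P)" for f
  proof -
    have iso: "isometry P P f" and ext: "f \<in> extensional (points M \<times> points N)"
      using f by (auto simp: carrier_Iso prod_simps)
    \<comment> \<open>Restriction to the points makes the factors extensional, as the carriers
      demand; splitting makes them independent of the base points.\<close>
    define g where "g = (\<lambda>x\<in>points M. fst (f (x, y0)))"
    define h where "h = (\<lambda>y\<in>points N. snd (f (x0, y)))"
    have feq: "f (x, y) = (g x, h y)" if xy: "x \<in> points M" "y \<in> points N" for x y
    proof -
      have "fst (f (x, y)) = fst (f (x, y0))" "snd (f (x, y)) = snd (f (x0, y))"
        using split[OF iso] xy x0 y0 unfolding splits_def by blast+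
      then show ?thesis using xy by (metis g_def h_def prod.collapse restrict_apply')
    qed
    interpret product_map M N f g h
      by unfold_locales (use feq ne in auto)
    have "isometry M M g" "isometry N N h" using isometry_prod_iff iso by auto
    then have "(g, h) \<in> carrier (Iso M \<times>\<times> Iso N)"
      by (simp add: DirProd_def carrier_Iso g_def h_def)
    moreover have "f = prod_isometry M N (g, h)"
    proof (rule extensionalityI[OF ext])
      show "prod_isometry M N (g, h) \<in> extensional (points M \<times> points N)" by (simp add: prod_isometry_def)
      fix z assume "z \<in> points M \<times> points N"
      then show "f z = prod_isometry M N (g, h) z" using feq by (auto simp: prod_isometry_def)
    qed
    ultimately show ?thesis by blast
  qed
  ultimately show "bij_betw (prod_isometry M N) (carrier (Iso M \<times>\<times> Iso N)) (carrier (Iso P))"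
    using car by (auto simp: bij_betw_def DirProd_def)
qed

theorem corollary1p3:
  fixes M :: "('a, 'e::real_normed_vector, 'i) riemannian"
    and N :: "('b, 'f::real_normed_vector, 'j) riemannian"
  assumes "riemannian_manifold M" and "closed_manifold M" and "connected_manifold M"
    and "riemannian_manifold N" and "connected_manifold N"
    and "star_condition M N"
  shows "(\<forall>f. isometry (prod_riemannian M N) (prod_riemannian M N) f \<longrightarrow> splits M N f) \<and>
    prod_isometry M N \<in> iso (Iso M \<times>\<times> Iso N) (Iso (prod_riemannian M N))"
proof -
  interpret riemannian_product M N
    by unfold_locales (use assms in auto)
  have split: "splits M N f" if "isometry P P f" for f
    using isometry_splits[OF that] assms by blast
  then show ?thesis
    using prod_isometry_iso[OF _ _ split] assms by (auto simp: connected_manifold_def)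
qed

end
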